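(* Let $\nu$ be a probability measure on $\mathbb{R}^d$ that is absolutely continuous with respect to the Lebesgue measure and has a finite second moment. Suppose that $\nu$ satisfies at least one of the following: (i) $\nu$ is $\beta$-semi-log-convex for some $\beta>0$ and $\kappa$-semi-log-concave for some $\kappa>0$, with $\mathrm{supp}(\nu)=\mathbb{R}^d$; (iii) $\nu=N(0,\sigma^2\mathbf{I}_d)*\rho$ with $\sigma>0$, where $\rho$ is a probability measure supported on a Euclidean ball of radius $R$ in $\mathbb{R}^d$; (iv) $\nu$ is $\beta$-semi-log-convex for some $\beta>0$, $\kappa$-semi-log-concave for some $\kappa\le0$, and $\frac{d\nu}{d\gamma_d}(x)$ is $L$-log-Lipschitz in $x$ for some $L\ge0$, with $\mathrm{supp}(\nu)=\mathbb{R}^d$. Let $v$ and $X_1$ be the velocity field and the time-one flow map of the Gaussian interpolation flow associated with $\nu$, and set $$C_1:=\sup_{x\in\mathbb{R}^d}\|\nabla_xX_1(x)\|_{2,2},\qquad C_2:=\sup_{(t,x)\in[0,1]\times\mathbb{R}^d}\|\nabla_xv(t,x)\|_{2,2}$$ (both are finite). If the source measure $\mu=\mathrm{Law}(a_0\mathsf{Z}+b_0\mathsf{X}_1)$ is replaced with the Gaussian measure $\gamma_{d,a_0^2}=N(0,a_0^2\mathbf{I}_d)$, then $$W_2({X_1}_{\#}\gamma_{d,a_0^2},\nu)\le C_1\,b_0\,\sqrt{\mathbb{E}_\nu[\|\mathsf{X}_1\|^2]}\,\exp(C_2d),$$ where $W_2$ is the quadratic Wasserstein distance.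
   Context: Fix functions $a_t,b_t$ of $t\in[0,1]$ (a dot denotes the time derivative) satisfying: $\dot a_t\le 0$, $\dot b_t\ge 0$, $a_0>0$, $b_0\ge 0$, $a_1=0$, $b_1=1$; $a_t>0$ and $b_t>0$ for all $t\in(0,1)$; $a_t,b_t\in C^2([0,1))$, $a_t^2\in C^1([0,1])$, $b_t\in C^1([0,1])$. Let $\gamma_d:=N(0,\mathbf{I}_d)$, let $\mathsf{Z}\sim\gamma_d$ and $\mathsf{X}_1\sim\nu$ be independent, and $\mathsf{X}_t=a_t\mathsf{Z}+b_t\mathsf{X}_1$. The velocity field is $v(t,x)=\mathbb{E}[\dot a_t\mathsf{Z}+\dot b_t\mathsf{X}_1\mid\mathsf{X}_t=x]$ for $t\in(0,1)$, $v(0,x)=\lim_{t\downarrow0}v(t,x)$, $v(1,x)=\lim_{t\uparrow1}v(t,x)$. The Gaussian interpolation flow is the solution $X_t(x)$ of $\frac{d}{dt}X_t(x)=v(t,X_t(x))$, $X_0(x)=x$, $t\in[0,1]$. A probability measure $\exp(-U)\,dx$ is $\kappa$-semi-log-concave ($\kappa\in\mathbb{R}$) if its support $\Omega\subseteq\mathbb{R}^d$ is convex and $U\in C^2(\Omega)$ satisfies $\nabla^2U(x)\succeq\kappa\mathbf{I}_d$ on $\Omega$; it is $\beta$-semi-log-convex ($\beta>0$) if its support $\Omega$ is convex and $U\in C^2(\Omega)$ satisfies $\nabla^2U(x)\preceq\beta\mathbf{I}_d$ on $\Omega$. A function $f:\mathbb{R}^d\to\mathbb{R}_+$ is $L$-log-Lipschitz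 if $\log f$ is $L$-Lipschitz. $\|\cdot\|_{2,2}$ is the spectral norm. *)

theory Defs
  imports "HOL-Probability.Probability"
begin

definition C1_on :: "real set \<Rightarrow> (real \<Rightarrow> real) \<Rightarrow> bool" where
  "C1_on S f \<longleftrightarrow>
     (\<exists>f'. continuous_on S f' \<and> (\<forall>t\<in>S. (f has_real_derivative f' t) (at t within S)))"

definition C2_on :: "real set \<Rightarrow> (real \<Rightarrow> real) \<Rightarrow> bool" where
  "C2_on S f \<longleftrightarrow>
     (\<exists>f'. C1_on S f' \<and> (\<forall>t\<in>S. (f has_real_derivative f' t) (at t within S)))"

text \<open>Time derivative on the unit interval, one-sided at the end points.\<close>

definition time_deriv :: "(real \<Rightarrow> real) \<Rightarrow> real \<Rightarrow> real" where
  "time_deriv f t = vector_derivative f (at t within {0..1})"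

text \<open>The derivative of \<open>a\<close> need not exist at time 1 (e.g. \<open>a t = sqrt (1 - t\<^sup>2)\<close>), hence the
  half-open interval in its sign condition.\<close>

definition interpolation_coeffs :: "(real \<Rightarrow> real) \<Rightarrow> (real \<Rightarrow> real) \<Rightarrow> bool" where
  "interpolation_coeffs a b \<longleftrightarrow>
     (\<forall>t\<in>{0..<1}. time_deriv a t \<le> 0) \<and> (\<forall>t\<in>{0..1}. 0 \<le> time_deriv b t) \<and>
     0 < a 0 \<and> 0 \<le> b 0 \<and> a 1 = 0 \<and> b 1 = 1 \<and>
     (\<forall>t\<in>{0<..<1}. 0 < a t \<and> 0 < b t) \<and>
     C2_on {0..<1} a \<and> C2_on {0..<1} b \<and>
     C1_on {0..1} (\<lambda>t. (a t)\<^sup>2) \<and> C1_on {0..1} b"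

text \<open>The centred Gaussian with covariance matrix \<open>s\<^sup>2 I\<close>; the parameter \<open>s\<close> is the standard
  deviation, as in \<^const>\<open>normal_density\<close>.\<close>

definition gaussian :: "real \<Rightarrow> (real^'n) measure" where
  "gaussian s = density lborel (\<lambda>x. ennreal (\<Prod>i\<in>UNIV. normal_density 0 s (x $ i)))"

definition msupport :: "'a::topological_space measure \<Rightarrow> 'a set" where
  "msupport M = {x. \<forall>S. open S \<longrightarrow> x \<in> S \<longrightarrow> 0 < emeasure M S}"

text \<open>Derivatives are taken within \<open>S\<close>; they are unique when \<open>S\<close> is convex with nonempty
  interior, which is the case for the convex support of a measure with a Lebesgue density.\<close>

definition C2_with_hessian ::
    "(real^'n) set \<Rightarrow> (real^'n \<Rightarrow> real) \<Rightarrow> (real^'n \<Rightarrow> real^'n^'n) \<Rightarrow> bool" where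
  "C2_with_hessian S U H \<longleftrightarrow> continuous_on S H \<and>
     (\<exists>G. \<forall>x\<in>S. (U has_derivative (\<lambda>h. G x \<bullet> h)) (at x within S) \<and>
                 (G has_derivative (\<lambda>h. H x *v h)) (at x within S))"

text \<open>The Loewner order, used below for symmetric matrices only.\<close>

definition loewner_le :: "real^'n^'n \<Rightarrow> real^'n^'n \<Rightarrow> bool" where
  "loewner_le A B \<longleftrightarrow> (\<forall>h. h \<bullet> (A *v h) \<le> h \<bullet> (B *v h))"

definition exp_potential_measure :: "(real^'n) measure \<Rightarrow> (real^'n \<Rightarrow> real) \<Rightarrow> bool" where
  "exp_potential_measure \<nu> U \<longleftrightarrow>
     \<nu> = density lborel (\<lambda>x. ennreal (exp (- U x)) * indicator (msupport \<nu>) x)"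

definition semi_log_concave :: "real \<Rightarrow> (real^'n) measure \<Rightarrow> bool" where
  "semi_log_concave \<kappa> \<nu> \<longleftrightarrow> convex (msupport \<nu>) \<and>
     (\<exists>U H. exp_potential_measure \<nu> U \<and> C2_with_hessian (msupport \<nu>) U H \<and>
        (\<forall>x\<in>msupport \<nu>. loewner_le (mat \<kappa>) (H x)))"

definition semi_log_convex :: "real \<Rightarrow> (real^'n) measure \<Rightarrow> bool" where
  "semi_log_convex \<beta> \<nu> \<longleftrightarrow> convex (msupport \<nu>) \<and>
     (\<exists>U H. exp_potential_measure \<nu> U \<and> C2_with_hessian (msupport \<nu>) U H \<and>
        (\<forall>x\<in>msupport \<nu>. loewner_le (H x) (mat \<beta>)))"

text \<open>Positivity makes the logarithm finite (\<^term>\<open>ln\<close> is total).\<close>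

definition log_lipschitz :: "real \<Rightarrow> (real^'n \<Rightarrow> real) \<Rightarrow> bool" where
  "log_lipschitz L f \<longleftrightarrow> (\<forall>x. 0 < f x) \<and> L-lipschitz_on UNIV (\<lambda>x. ln (f x))"

definition couplings ::
    "(real^'n) measure \<Rightarrow> (real^'n) measure \<Rightarrow> ((real^'n) \<times> (real^'n)) measure set" where
  "couplings \<mu> \<nu> =
     {\<pi>. sets \<pi> = sets borel \<and> distr \<pi> borel fst = \<mu> \<and> distr \<pi> borel snd = \<nu>}"

definition ennreal_sqrt :: "ennreal \<Rightarrow> ennreal" where
  "ennreal_sqrt x = (if x = \<infinity> then \<infinity> else ennreal (sqrt (enn2real x)))"

definition W2 :: "(real^'n) measure \<Rightarrow> (real^'n) measure \<Rightarrow> ennreal" where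
  "W2 \<mu> \<nu> =
     ennreal_sqrt (INF \<pi>\<in>couplings \<mu> \<nu>. \<integral>\<^sup>+ p. ennreal ((dist (fst p) (snd p))\<^sup>2) \<partial>\<pi>)"

definition interpolant ::
    "(real \<Rightarrow> real) \<Rightarrow> (real \<Rightarrow> real) \<Rightarrow> ('w \<Rightarrow> real^'n) \<Rightarrow> ('w \<Rightarrow> real^'n) \<Rightarrow> real \<Rightarrow> 'w \<Rightarrow> real^'n" where
  "interpolant a b Z X1 t = (\<lambda>w. a t *\<^sub>R Z w + b t *\<^sub>R X1 w)"

definition is_cond_exp_given ::
    "'w measure \<Rightarrow> ('w \<Rightarrow> real^'n) \<Rightarrow> ('w \<Rightarrow> real^'n) \<Rightarrow> (real^'n \<Rightarrow> real^'n) \<Rightarrow> bool" where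
  "is_cond_exp_given M Y X g \<longleftrightarrow>
     (\<forall>i. AE w in M.
        real_cond_exp M (vimage_algebra (space M) X borel) (\<lambda>w. Y w $ i) w = g (X w) $ i)"

text \<open>A conditional expectation given \<open>X\<^sub>t = x\<close> is determined only for almost every \<open>x\<close>.
  For \<open>0 < t < 1\<close> the law of \<open>X\<^sub>t\<close> has a smooth positive density, so there is exactly one
  continuous version; this is the version meant by \<open>v t x\<close>.\<close>

definition is_velocity_field ::
    "'w measure \<Rightarrow> (real \<Rightarrow> real) \<Rightarrow> (real \<Rightarrow> real) \<Rightarrow> ('w \<Rightarrow> real^'n) \<Rightarrow> ('w \<Rightarrow> real^'n)
      \<Rightarrow> (real \<Rightarrow> real^'n \<Rightarrow> real^'n) \<Rightarrow> bool" where
  "is_velocity_field M a b Z X1 v \<longleftrightarrow>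
     (\<forall>t\<in>{0<..<1}. continuous_on UNIV (v t) \<and>
        is_cond_exp_given M (\<lambda>w. time_deriv a t *\<^sub>R Z w + time_deriv b t *\<^sub>R X1 w)
          (interpolant a b Z X1 t) (v t)) \<and>
     (\<forall>x. ((\<lambda>t. v t x) \<longlongrightarrow> v 0 x) (at_right 0)) \<and>
     (\<forall>x. ((\<lambda>t. v t x) \<longlongrightarrow> v 1 x) (at_left 1))"

definition is_flow ::
    "(real \<Rightarrow> real^'n \<Rightarrow> real^'n) \<Rightarrow> (real \<Rightarrow> real^'n \<Rightarrow> real^'n) \<Rightarrow> bool" where
  "is_flow v X \<longleftrightarrow>
     (\<forall>x. X 0 x = x \<and>
        (\<forall>t\<in>{0..1}. ((\<lambda>s. X s x) has_vector_derivative v t (X t x)) (at t within {0..1})))"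

definition spectral_norm :: "real^'n^'n \<Rightarrow> real" where
  "spectral_norm A = onorm (\<lambda>h. A *v h)"

end

theory Submission
  imports Defs
begin

text \<open>
  In each of the three cases \<open>\<nu> = exp (-U) dx\<close> where \<open>G = \<nabla>U\<close> is Lipschitz and
  \<open>(G x - G y) \<bullet> (x - y) \<ge> \<kappa> |x - y|\<^sup>2 - L |x - y|\<close> for some \<open>\<kappa> > 0\<close>. The conditional law of
  \<open>X\<^sub>1\<close> given \<open>X\<^sub>t = x\<close> is proportional to \<open>exp (-|x - b y|\<^sup>2 / 2a\<^sup>2) \<nu>(dy)\<close>. Integration by parts
  against it yields \<open>Cov (G, y) = I - (b\<^sup>2/a\<^sup>2) Cov (y)\<close> and a variance bound
  \<open>C / (\<kappa> + b\<^sup>2/a\<^sup>2)\<close>, so that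
  \<open>\<nabla>v = (a'/a) Cov (G, y) + (b' b/a\<^sup>2) Cov (y)\<close> is bounded uniformly up to \<open>t = 1\<close>, where \<open>a\<close> vanishes.

  Hence every \<open>X\<^sub>t\<close> is a bi-Lipschitz diffeomorphism. For a smooth \<open>g\<close>,
  the expectation of \<open>g\<close> along \<open>X\<^sub>t\<close>-preimages of the interpolant is constant in time, because \<open>v\<close> is
  a conditional expectation; thus the time-one map transports the law of \<open>a\<^sub>0 Z + b\<^sub>0 X\<^sub>1\<close>
  to \<open>\<nu>\<close>. Coupling it with \<open>a\<^sub>0 Z\<close> through the same \<open>Z\<close> gives the bound, even
  without the factor \<open>exp (C\<^sub>2 d) \<ge> 1\<close>.
\<close>

section \<open>Gronwall estimates and linear differential equations\<close>

text \<open>Eliminating \<open>Z\<close> writes the velocity as (a'/a) x + (b' - a' b/a)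
  E[X1 | X_t = x], whose coefficients become singular at t = 1, where only a' a = (a^2)'/2 keeps a
  limit. The identity for Cov (G, y) exhibits the cancellation: it is bounded by \<open>B\<close>
  times the trace of Cov y, and that trace is O(a^2) near t = 1, so a'/a always meets a factor a^2.
  Tracing the same identity and inserting the monotonicity of \<open>G\<close> bounds the trace; the
  factor of dimension this costs is harmless, since \<open>C1\<close> and \<open>C2\<close> only
  have to be finite.

  At t = 1 itself the velocity is known only as a limit. It is computed from the concentration of
  the conditional law at x and equals a combination of \<open>G\<close> and the identity. The flow
  maps are differentiated for t < 1 through the variational equation, and the derivatives converge
  uniformly as t tends to 1. The transport step needs the time derivative of an inverse flow map
  along a random path; an algebraic identity reduces it to the spatial derivative at a frozen
  time.\<close>

lemma gronwall_sq:
  fixes u u' :: "real \<Rightarrow> 'a::real_inner"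
  assumes "s \<le> t" and cont: "continuous_on {s..t} u"
    and der: "\<And>r. s < r \<Longrightarrow> r < t \<Longrightarrow> (u has_vector_derivative u' r) (at r)"
    and bnd: "\<And>r. s < r \<Longrightarrow> r < t \<Longrightarrow> norm (u' r) \<le> K * norm (u r) + e"
    and K: "0 \<le> K" and e: "0 \<le> e"
  shows "(norm (u t))\<^sup>2 \<le> exp ((2 * K + 1) * (t - s)) * ((norm (u s))\<^sup>2 + e\<^sup>2 * (t - s))"
proof -
  \<comment> \<open>The squared norm stays differentiable where \<open>u\<close> vanishes. Its
    derivative is at most 2K|u|^2 + 2e|u|, and 2e|u| <= |u|^2 + e^2; the extra 1 in \<open>c\<close>
    pays for this splitting.\<close>
  define c where "c = 2 * K + 1"
  have c: "c \<ge> 0" using K by (simp add: c_def)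
  define \<phi> where "\<phi> = (\<lambda>r. (u r \<bullet> u r) * exp (- c * (r - s)) - e\<^sup>2 * (r - s))"
  have "\<phi> t \<le> \<phi> s"
  proof (rule DERIV_nonpos_imp_decreasing_open[OF \<open>s \<le> t\<close>])
    fix r assume r: "s < r" "r < t"
    have d: "((\<lambda>r. u r \<bullet> u r) has_real_derivative (2 * (u r \<bullet> u' r))) (at r)"
      using has_derivative_inner[OF der[OF r, unfolded has_vector_derivative_def]
          der[OF r, unfolded has_vector_derivative_def]]
      unfolding has_field_derivative_def
      by (rule has_derivative_eq_rhs) (auto simp: inner_commute algebra_simps)
    have "(\<phi> has_real_derivative
        (2 * (u r \<bullet> u' r) - c * (u r \<bullet> u r)) * exp (- c * (r - s)) - e\<^sup>2) (at r)"
      unfolding \<phi>_def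
      by (rule derivative_eq_intros d refl | simp)+ (simp add: algebra_simps)
    moreover have "(2 * (u r \<bullet> u' r) - c * (u r \<bullet> u r)) * exp (- c * (r - s)) - e\<^sup>2 \<le> 0"
    proof -
      have "u r \<bullet> u' r \<le> norm (u r) * norm (u' r)" by (rule norm_cauchy_schwarz)
      also have "\<dots> \<le> norm (u r) * (K * norm (u r) + e)"
        by (intro mult_left_mono bnd r) auto
      finally have "2 * (u r \<bullet> u' r) \<le> 2 * K * (norm (u r))\<^sup>2 + 2 * (norm (u r) * e)"
        by (simp add: power2_eq_square algebra_simps)
      also have "2 * (norm (u r) * e) \<le> (norm (u r))\<^sup>2 + e\<^sup>2"
        using sum_squares_bound[of "norm (u r)" e] by (simp add: algebra_simps)
      finally have "2 * (u r \<bullet> u' r) - c * (u r \<bullet> u r) \<le> e\<^sup>2"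
        by (simp add: c_def power2_norm_eq_inner algebra_simps)
      then have "(2 * (u r \<bullet> u' r) - c * (u r \<bullet> u r)) * exp (- c * (r - s)) \<le> e\<^sup>2 * exp (- c * (r - s))"
        by (intro mult_right_mono) auto
      also have "\<dots> \<le> e\<^sup>2 * 1"
        using r c by (intro mult_left_mono) auto
      finally show ?thesis by simp
    qed
    ultimately show "\<exists>y. (\<phi> has_real_derivative y) (at r) \<and> y \<le> 0" by blast
  next
    show "continuous_on {s..t} \<phi>" unfolding \<phi>_def by (intro continuous_intros cont)
  qed
  then have "(norm (u t))\<^sup>2 * exp (- c * (t - s)) \<le> (norm (u s))\<^sup>2 + e\<^sup>2 * (t - s)"
    by (simp add: \<phi>_def power2_norm_eq_inner)
  then have "exp (c * (t - s)) * ((norm (u t))\<^sup>2 * exp (- c * (t - s)))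
     \<le> exp (c * (t - s)) * ((norm (u s))\<^sup>2 + e\<^sup>2 * (t - s))"
    by (intro mult_left_mono) auto
  also have "exp (c * (t - s)) * ((norm (u t))\<^sup>2 * exp (- c * (t - s))) = (norm (u t))\<^sup>2"
    by (simp add: exp_minus)
  finally show ?thesis by (simp add: c_def)
qed

text \<open>On a time span of at most 1 the rate 2K + 1 is rounded up to 2K + 2, so that taking the
  square root leaves the single factor exp (K + 1) used in all flow estimates.\<close>

lemma gronwall_forward:
  fixes u u' :: "real \<Rightarrow> 'a::real_inner"
  assumes "s \<le> t" "t - s \<le> 1" "0 \<le> K" "0 \<le> e" and cont: "continuous_on {s..t} u"
    and der: "\<And>r. s < r \<Longrightarrow> r < t \<Longrightarrow> (u has_vector_derivative u' r) (at r)"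
    and bnd: "\<And>r. s < r \<Longrightarrow> r < t \<Longrightarrow> norm (u' r) \<le> K * norm (u r) + e"
  shows "norm (u t) \<le> exp (K + 1) * (norm (u s) + e)"
proof -
  have "(norm (u t))\<^sup>2 \<le> exp ((2 * K + 1) * (t - s)) * ((norm (u s))\<^sup>2 + e\<^sup>2 * (t - s))"
    using assms by (intro gronwall_sq[where u' = u']) auto
  also have "\<dots> \<le> exp (2 * K + 2) * ((norm (u s))\<^sup>2 + e\<^sup>2 * 1)"
  proof (intro mult_mono add_mono order_refl)
    have "(2 * K + 1) * (t - s) \<le> (2 * K + 1) * 1" using assms by (intro mult_left_mono) auto
    then show "exp ((2 * K + 1) * (t - s)) \<le> exp (2 * K + 2)" by simp
  qed (use assms in auto)
  also have "\<dots> \<le> exp (2 * K + 2) * (norm (u s) + e)\<^sup>2"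
    using assms by (intro mult_left_mono) (auto simp: power2_eq_square algebra_simps)
  also have "\<dots> = (exp (K + 1) * (norm (u s) + e))\<^sup>2"
    using exp_double[of "K + 1"] by (simp add: power_mult_distrib ac_simps)
  finally show ?thesis
    by (rule power2_le_imp_le) (use assms in auto)
qed

lemma gronwall_backward:
  fixes u u' :: "real \<Rightarrow> 'a::real_inner"
  assumes "s \<le> t" "t - s \<le> 1" "0 \<le> K" "0 \<le> e" and cont: "continuous_on {s..t} u"
    and der: "\<And>r. s < r \<Longrightarrow> r < t \<Longrightarrow> (u has_vector_derivative u' r) (at r)"
    and bnd: "\<And>r. s < r \<Longrightarrow> r < t \<Longrightarrow> norm (u' r) \<le> K * norm (u r) + e"
  shows "norm (u s) \<le> exp (K + 1) * (norm (u t) + e)"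
proof -
  \<comment> \<open>Time reversal exchanges the two end points and only flips the sign of the
    derivative, so the hypothesis on its norm is preserved.\<close>
  define w where "w = (\<lambda>r. u (s + t - r))"
  have "norm (w t) \<le> exp (K + 1) * (norm (w s) + e)"
  proof (rule gronwall_forward[where u' = "\<lambda>r. - u' (s + t - r)"])
    show "continuous_on {s..t} w" unfolding w_def
      by (intro continuous_on_compose2[OF cont] continuous_intros) auto
    fix r assume r: "s < r" "r < t"
    have "((\<lambda>r. s + t - r) has_vector_derivative -1) (at r)"
      by (auto intro!: derivative_eq_intros)
    from vector_diff_chain_at[OF this, of u "u' (s + t - r)"] der[of "s + t - r"] r
    show "(w has_vector_derivative - u' (s + t - r)) (at r)"
      unfolding w_def o_def by auto
    show "norm (- u' (s + t - r)) \<le> K * norm (w r) + e"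
      using bnd[of "s + t - r"] r by (simp add: w_def)
  qed (use assms in auto)
  then show ?thesis by (simp add: w_def)
qed

section \<open>Linear equations with a time-dependent bounded operator\<close>

lemma linear_sum_Basis:
  fixes f :: "'a::euclidean_space \<Rightarrow> 'b::real_vector"
  assumes "linear f"
  shows "f w = (\<Sum>b\<in>Basis. (w \<bullet> b) *\<^sub>R f b)"
  by (metis (no_types, lifting) euclidean_representation linear_scale[OF assms] linear_sum[OF assms] sum.cong)

text \<open>The solution is the Peano-Baker series: \<open>y n\<close> is its n-th term, the n-fold
  iterated integral, and not the n-th Picard iterate. The bound |k| (Kt)^n / n! makes the series
  converge uniformly, and it is differentiated term by term. \<open>A\<close> is continuous only for
  each fixed vector; expanding in a basis makes \<open>A s (w s)\<close> continuous for continuous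
  \<open>w\<close>.\<close>

lemma linear_ode_exists:
  fixes A :: "real \<Rightarrow> 'a::euclidean_space \<Rightarrow> 'a"
  assumes T: "0 \<le> T" and K: "0 \<le> K"
    and lin: "\<And>t. t \<in> {0..T} \<Longrightarrow> linear (A t)"
    and bnd: "\<And>t h. t \<in> {0..T} \<Longrightarrow> norm (A t h) \<le> K * norm h"
    and cont: "\<And>h. continuous_on {0..T} (\<lambda>t. A t h)"
  obtains \<xi> where "\<xi> 0 = k"
    "\<And>t. t \<in> {0..T} \<Longrightarrow> (\<xi> has_vector_derivative A t (\<xi> t)) (at t within {0..T})"
proof -
  have contA: "continuous_on {0..T} (\<lambda>s. A s (w s))" if "continuous_on {0..T} w" for w
  proof (rule continuous_on_eq)
    show "continuous_on {0..T} (\<lambda>s. \<Sum>b\<in>Basis. (w s \<bullet> b) *\<^sub>R A s b)"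
      by (intro continuous_intros that cont)
    show "(\<Sum>b\<in>Basis. (w s \<bullet> b) *\<^sub>R A s b) = A s (w s)" if "s \<in> {0..T}" for s
      by (rule linear_sum_Basis[OF lin[OF that], symmetric])
  qed
  define y where "y = rec_nat (\<lambda>t. k) (\<lambda>_ f t. integral {0..t} (\<lambda>s. A s (f s)))"
  have y0: "y 0 = (\<lambda>t. k)" and yS: "y (Suc n) = (\<lambda>t. integral {0..t} (\<lambda>s. A s (y n s)))" for n
    by (simp_all add: y_def)
  have yc: "continuous_on {0..T} (y n)" for n
  proof (induction n)
    case 0 then show ?case unfolding y0 by (rule continuous_on_const)
  next
    case (Suc n)
    show ?case unfolding yS
      by (intro indefinite_integral_continuous_1 integrable_continuous_real contA Suc)
  qed
  have yd: "(y (Suc n) has_vector_derivative A t (y n t)) (at t within {0..T})" if "t \<in> {0..T}" for n t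
    unfolding yS by (rule integral_has_vector_derivative[OF contA[OF yc] that])
  have yb: "norm (y n t) \<le> norm k * (K * t) ^ n / fact n" if t: "t \<in> {0..T}" for n t
    using t
  proof (induction n arbitrary: t)
    case 0 then show ?case by (simp add: y0)
  next
    case (Suc n)
    show ?case
    proof (cases "t = 0")
      case True then show ?thesis by (simp add: yS)
    next
      case False
      then have t: "0 < t" "t \<le> T" using Suc.prems by auto
      have "norm (y (Suc n) t - y (Suc n) 0) \<le>
          norm k * (K * t) ^ Suc n / fact (Suc n) - norm k * (K * 0) ^ Suc n / fact (Suc n)"
      proof (rule differentiable_bound_general[OF t(1)])
        show "continuous_on {0..t} (y (Suc n))"
          by (rule continuous_on_subset[OF yc]) (use t in auto)
        show "continuous_on {0..t} (\<lambda>t. norm k * (K * t) ^ Suc n / fact (Suc n))"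
          by (intro continuous_intros) auto
        fix s assume s: "0 < s" "s < t"
        have "(y (Suc n) has_vector_derivative A s (y n s)) (at s within {0<..<T})"
          by (rule has_vector_derivative_within_subset[OF yd]) (use s t in auto)
        then show "(y (Suc n) has_vector_derivative A s (y n s)) (at s)"
          using s t by (subst (asm) at_within_open) auto
        have "((\<lambda>t. norm k * (K * t) ^ Suc n / fact (Suc n)) has_real_derivative
            norm k * (real (Suc n) * K * (K * s) ^ n) / fact (Suc n)) (at s)"
          by (auto intro!: derivative_eq_intros simp del: power_Suc fact_Suc)
        also have "norm k * (real (Suc n) * K * (K * s) ^ n) / fact (Suc n)
            = K * (norm k * (K * s) ^ n / fact n)"
          unfolding fact_Suc by (simp add: divide_simps del: of_nat_Suc)
        finally show "((\<lambda>t. norm k * (K * t) ^ Suc n / fact (Suc n)) has_vector_derivative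
            K * (norm k * (K * s) ^ n / fact n)) (at s)"
          unfolding has_real_derivative_iff_has_vector_derivative[symmetric] .
        have "norm (A s (y n s)) \<le> K * norm (y n s)" using s t by (intro bnd) auto
        also have "\<dots> \<le> K * (norm k * (K * s) ^ n / fact n)"
          by (intro mult_left_mono Suc.IH) (use K s t in auto)
        finally show "norm (A s (y n s)) \<le> K * (norm k * (K * s) ^ n / fact n)" .
      qed
      then show ?thesis by (simp add: yS)
    qed
  qed
  define S where "S = (\<lambda>t. \<Sum>n. y n t)"
  have sm: "summable (\<lambda>n. norm k * (K * T) ^ n / fact n)"
    using summable_mult[OF summable_exp[of "K * T"], of "norm k"] by (simp add: field_simps)
  have yb': "norm (y n t) \<le> norm k * (K * T) ^ n / fact n" if t: "t \<in> {0..T}" for n t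
  proof -
    have "(K * t) ^ n \<le> (K * T) ^ n"
      using t K by (intro power_mono mult_left_mono) auto
    then have "norm k * (K * t) ^ n / fact n \<le> norm k * (K * T) ^ n / fact n"
      by (intro divide_right_mono mult_left_mono) auto
    with yb[OF t, of n] show ?thesis by linarith
  qed
  have ul: "uniform_limit {0..T} (\<lambda>n t. \<Sum>i<n. y i t) S sequentially"
    unfolding S_def by (rule Weierstrass_m_test[OF _ sm]) (use yb' in auto)
  have sums: "(\<lambda>n. y n t) sums S t" if "t \<in> {0..T}" for t
    unfolding S_def by (rule summable_sums[OF summable_comparison_test'[OF sm yb'[OF that]]])
  define f' where "f' = (\<lambda>n t (h::real). case n of 0 \<Rightarrow> 0 | Suc m \<Rightarrow> h *\<^sub>R A t (y m t))"
  have "\<exists>g. \<forall>t\<in>{0..T}. (\<lambda>n. y n t) sums g t \<and> (g has_derivative (\<lambda>h. h *\<^sub>R A t (S t))) (at t within {0..T})"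
  proof (rule has_derivative_series[where f' = f'])
    show "convex {0..T}" by simp
    show "(y n has_derivative f' n t) (at t within {0..T})" if "t \<in> {0..T}" for n t
    proof (cases n)
      case 0 then show ?thesis by (simp add: f'_def y0)
    next
      case (Suc m) then show ?thesis
        using yd[OF that, of m] by (simp add: f'_def has_vector_derivative_def)
    qed
    show "\<forall>\<^sub>F n in sequentially. \<forall>t\<in>{0..T}. \<forall>h. norm ((\<Sum>i<n. f' i t h) - h *\<^sub>R A t (S t)) \<le> e * norm h"
      (is "eventually ?P _") if e: "0 < e" for e
    proof -
      have "\<forall>\<^sub>F n in sequentially. \<forall>t\<in>{0..T}. dist (\<Sum>i<n. y i t) (S t) < e / (K + 1)"
        using ul e K unfolding uniform_limit_iff by simp
      \<comment> \<open>The derivative of term i + 1 is \<open>A\<close> applied to term i, and term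
        0 is constant. Hence the derivative of the first \<open>Suc n\<close> terms is
        \<open>A\<close> applied to the first \<open>n\<close> terms, and the estimate is proved for
        the shifted index and shifted back at the end.\<close>
      then have "\<forall>\<^sub>F n in sequentially. \<forall>t\<in>{0..T}. \<forall>h.
          norm ((\<Sum>i<Suc n. f' i t h) - h *\<^sub>R A t (S t)) \<le> e * norm h"
      proof eventually_elim
        case (elim n)
        show ?case
        proof (intro ballI allI)
          fix t h assume t: "t \<in> {0..T}"
          have "(\<Sum>i<Suc n. f' i t h) = (\<Sum>i<n. h *\<^sub>R A t (y i t))"
            by (subst sum.lessThan_Suc_shift) (simp add: f'_def)
          also have "\<dots> = h *\<^sub>R A t (\<Sum>i<n. y i t)"
            by (simp add: scaleR_sum_right linear_sum[OF lin[OF t]])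
          finally have "norm ((\<Sum>i<Suc n. f' i t h) - h *\<^sub>R A t (S t))
              = \<bar>h\<bar> * norm (A t ((\<Sum>i<n. y i t) - S t))"
            by (simp add: linear_diff[OF lin[OF t]] scaleR_diff_right[symmetric])
          also have "\<dots> \<le> \<bar>h\<bar> * (K * norm ((\<Sum>i<n. y i t) - S t))"
            by (intro mult_left_mono bnd t) auto
          also have "\<dots> \<le> \<bar>h\<bar> * ((K + 1) * (e / (K + 1)))"
          proof (intro mult_left_mono mult_mono)
            show "norm ((\<Sum>i<n. y i t) - S t) \<le> e / (K + 1)"
              using elim t by (force simp: dist_norm)
          qed (use K in auto)
          also have "\<dots> = e * norm h" using K by simp
          finally show "norm ((\<Sum>i<Suc n. f' i t h) - h *\<^sub>R A t (S t)) \<le> e * norm h" .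
        qed
      qed
      then show ?thesis using eventually_sequentially_Suc[of ?P] by blast
    qed
    show "0 \<in> {0..T}" using T by simp
    show "(\<lambda>n. y n 0) sums S 0" using sums T by simp
  qed
  then obtain g where g: "\<And>t. t \<in> {0..T} \<Longrightarrow> (\<lambda>n. y n t) sums g t"
    "\<And>t. t \<in> {0..T} \<Longrightarrow> (g has_derivative (\<lambda>h. h *\<^sub>R A t (S t))) (at t within {0..T})" by blast
  have gS: "g t = S t" if "t \<in> {0..T}" for t
    using sums_unique2[OF g(1) sums] that by auto
  show thesis
  proof (rule that)
    have "(\<lambda>n. y n 0) = (\<lambda>n. if n = 0 then k else 0)"
    proof
      show "y n 0 = (if n = 0 then k else 0)" for n by (cases n) (auto simp: y0 yS)
    qed
    then have "(\<lambda>n. y n 0) sums k" using sums_single[of 0 "\<lambda>_. k"] by simp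
    then show "g 0 = k" using sums_unique2[OF g(1)[of 0]] T by simp
    show "(g has_vector_derivative A t (g t)) (at t within {0..T})" if "t \<in> {0..T}" for t
      using g(2)[OF that] gS[OF that] by (simp add: has_vector_derivative_def)
  qed
qed

section \<open>Flows of vector fields with bounded derivative\<close>

text \<open>A local bound on increments passes to the derivative: evaluate both at x + s h with s
  small and divide by s. The upper bound turns Lipschitz constants into operator bounds; the lower
  one makes the derivative of a bi-Lipschitz map injective.\<close>

lemma has_derivative_norm_bounds:
  fixes f :: "'a::real_normed_vector \<Rightarrow> 'b::real_normed_vector"
  assumes "(f has_derivative f') (at x)"
  shows has_derivative_norm_le:
      "eventually (\<lambda>y. norm (f y - f x) \<le> C * norm (y - x)) (nhds x) \<Longrightarrow> norm (f' h) \<le> C * norm h"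
    and has_derivative_norm_ge:
      "eventually (\<lambda>y. C * norm (y - x) \<le> norm (f y - f x)) (nhds x) \<Longrightarrow> C * norm h \<le> norm (f' h)"
proof -
  interpret bounded_linear f' using assms by (rule has_derivative_bounded_linear)
  have *: "\<exists>s>0. norm (f (x + s *\<^sub>R h) - f x - s *\<^sub>R f' h) \<le> e * (s * norm h) \<and> P (x + s *\<^sub>R h)"
    if e0: "e > 0" and P: "eventually P (nhds x)" for e P
  proof (cases "h = 0")
    case True
    have "norm (f (x + 1 *\<^sub>R h) - f x - 1 *\<^sub>R f' h) \<le> e * (1 * norm h) \<and> P (x + 1 *\<^sub>R h)"
      using eventually_nhds_x_imp_x[OF P] by (simp add: True zero)
    then show ?thesis using zero_less_one by blast
  next
    case False
    obtain d where d: "d > 0" "\<And>y. norm (y - x) < d \<Longrightarrow> norm (f y - f x - f' (y - x)) \<le> e * norm (y - x)"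
      using conjunct2[OF assms[unfolded has_derivative_at_alt], rule_format, OF e0] by blast
    obtain \<delta> where \<delta>: "\<delta> > 0" "\<And>y. dist y x < \<delta> \<Longrightarrow> P y"
      using P unfolding eventually_nhds_metric by blast
    define s where "s = min d \<delta> / (2 * norm h)"
    have "norm ((x + s *\<^sub>R h) - x) = min d \<delta> / 2" using d \<delta> False by (simp add: s_def)
    then have s: "s > 0" "norm ((x + s *\<^sub>R h) - x) < d" "dist (x + s *\<^sub>R h) x < \<delta>"
      using d \<delta> False by (auto simp: s_def dist_norm)
    have "norm (f (x + s *\<^sub>R h) - f x - s *\<^sub>R f' h) \<le> e * (s * norm h)"
      using d(2)[OF s(2)] s(1) by (simp add: scaleR)
    with s(1) \<delta>(2)[OF s(3)] show ?thesis by blast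
  qed
  show "norm (f' h) \<le> C * norm h" if C: "eventually (\<lambda>y. norm (f y - f x) \<le> C * norm (y - x)) (nhds x)"
  proof (rule field_le_epsilon)
    fix e :: real assume "e > 0"
    define e' where "e' = e / (norm h + 1)"
    have "e' > 0" using \<open>e > 0\<close> by (auto simp: e'_def add_nonneg_pos)
    from *[OF this C] obtain s where s: "s > 0"
      "norm (f (x + s *\<^sub>R h) - f x - s *\<^sub>R f' h) \<le> e' * (s * norm h)"
      "norm (f (x + s *\<^sub>R h) - f x) \<le> C * norm ((x + s *\<^sub>R h) - x)" by blast
    have "s * norm (f' h) = norm (s *\<^sub>R f' h)" using s by simp
    also have "\<dots> \<le> norm (f (x + s *\<^sub>R h) - f x - s *\<^sub>R f' h) + norm (f (x + s *\<^sub>R h) - f x)"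
      using norm_triangle_ineq4[of "f (x + s *\<^sub>R h) - f x" "f (x + s *\<^sub>R h) - f x - s *\<^sub>R f' h"]
      by simp
    also have "\<dots> \<le> e' * (s * norm h) + C * (s * norm h)"
      using s by simp
    finally have "s * norm (f' h) \<le> s * (C * norm h + e' * norm h)" by (simp add: algebra_simps)
    then have "norm (f' h) \<le> C * norm h + e' * norm h" using s by simp
    also have "e' * norm h \<le> e" using \<open>e > 0\<close> by (simp add: e'_def divide_simps add_nonneg_pos)
    finally show "norm (f' h) \<le> C * norm h + e" by simp
  qed
  show "C * norm h \<le> norm (f' h)" if C: "eventually (\<lambda>y. C * norm (y - x) \<le> norm (f y - f x)) (nhds x)"
  proof (rule field_le_epsilon)
    fix e :: real assume "e > 0"
    define e' where "e' = e / (norm h + 1)"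
    have "e' > 0" using \<open>e > 0\<close> by (auto simp: e'_def add_nonneg_pos)
    from *[OF this C] obtain s where s: "s > 0"
      "norm (f (x + s *\<^sub>R h) - f x - s *\<^sub>R f' h) \<le> e' * (s * norm h)"
      "C * norm ((x + s *\<^sub>R h) - x) \<le> norm (f (x + s *\<^sub>R h) - f x)" by blast
    have "C * (s * norm h) \<le> norm (f (x + s *\<^sub>R h) - f x)"
      using s by simp
    also have "\<dots> \<le> norm (f (x + s *\<^sub>R h) - f x - s *\<^sub>R f' h) + norm (s *\<^sub>R f' h)"
      using norm_triangle_ineq[of "f (x + s *\<^sub>R h) - f x - s *\<^sub>R f' h" "s *\<^sub>R f' h"] by simp
    also have "\<dots> \<le> e' * (s * norm h) + s * norm (f' h)"
      using s by simp
    finally have "s * (C * norm h) \<le> s * (norm (f' h) + e' * norm h)" by (simp add: algebra_simps)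
    then have "C * norm h \<le> norm (f' h) + e' * norm h" using s by simp
    also have "e' * norm h \<le> e" using \<open>e > 0\<close> by (simp add: e'_def divide_simps add_nonneg_pos)
    finally show "C * norm h \<le> norm (f' h) + e" by simp
  qed
qed

text \<open>Regularity of \<open>v\<close> is required on the half-open interval only, with one
  constant \<open>K\<close> up to time 1; at time 1 nothing but the equation for \<open>X\<close> is
  assumed. \<open>D\<close> is continuous for each fixed direction \<open>h\<close>, which is what
  dominated convergence delivers for the conditional covariance.\<close>

locale bounded_flow =
  fixes v :: "real \<Rightarrow> 'a::euclidean_space \<Rightarrow> 'a" and D :: "real \<Rightarrow> 'a \<Rightarrow> 'a \<Rightarrow> 'a"
    and K :: real and X :: "real \<Rightarrow> 'a \<Rightarrow> 'a"
  assumes K0: "0 \<le> K"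
    and v_deriv: "\<And>t x. t \<in> {0..<1} \<Longrightarrow> (v t has_derivative D t x) (at x)"
    and D_bound: "\<And>t x h. t \<in> {0..<1} \<Longrightarrow> norm (D t x h) \<le> K * norm h"
    and v_cont: "continuous_on ({0..<1} \<times> UNIV) (\<lambda>(t, x). v t x)"
    and D_cont: "\<And>h. continuous_on ({0..<1} \<times> UNIV) (\<lambda>(t, x). D t x h)"
    and X_0: "\<And>x. X 0 x = x"
    and X_deriv: "\<And>t x. t \<in> {0..1} \<Longrightarrow> ((\<lambda>s. X s x) has_vector_derivative v t (X t x)) (at t within {0..1})"
begin

text \<open>The Gronwall factor; it is a Lipschitz constant of every \<open>X t\<close> and of every
  inverse.\<close>

definition E where "E = exp (K + 1)"

lemma E_pos: "0 < E" by (simp add: E_def)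

lemma D_linear: "t \<in> {0..<1} \<Longrightarrow> linear (D t x)"
  using has_derivative_linear[OF v_deriv] .

lemma v_lip: "t \<in> {0..<1} \<Longrightarrow> norm (v t x - v t y) \<le> K * norm (x - y)"
  by (rule differentiable_bound[of UNIV _ "D t"])
     (auto intro!: onorm_bound K0 v_deriv[THEN has_derivative_at_withinI] D_bound)

lemma X_deriv_at: "0 < t \<Longrightarrow> t < 1 \<Longrightarrow> ((\<lambda>s. X s x) has_vector_derivative v t (X t x)) (at t)"
  using X_deriv[of t x] at_within_interior[of t "{0..1::real}"] by simp

lemma X_cont: "continuous_on {0..1} (\<lambda>s. X s x)"
  using X_deriv has_vector_derivative_continuous unfolding continuous_on_eq_continuous_within by blast

lemma X_cont': "a \<ge> 0 \<Longrightarrow> b \<le> 1 \<Longrightarrow> continuous_on {a..b} (\<lambda>s. X s x)"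
  by (rule continuous_on_subset[OF X_cont]) auto

lemma X_diff_bounds:
  assumes "0 \<le> s" "s \<le> t" "t \<le> 1"
  shows X_diff_forward: "norm (X t x - X t y) \<le> E * norm (X s x - X s y)"
    and X_diff_backward: "norm (X s x - X s y) \<le> E * norm (X t x - X t y)"
proof -
  have 1: "((\<lambda>r. X r x - X r y) has_vector_derivative v r (X r x) - v r (X r y)) (at r)"
    and 2: "norm (v r (X r x) - v r (X r y)) \<le> K * norm (X r x - X r y) + 0"
    if "s < r" "r < t" for r
    using that assms v_lip[of r] by (auto intro!: has_vector_derivative_diff X_deriv_at)
  show "norm (X t x - X t y) \<le> E * norm (X s x - X s y)"
    using gronwall_forward[OF _ _ K0 order_refl _ 1 2, of s t] assms
    by (simp add: E_def continuous_on_diff X_cont')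
  show "norm (X s x - X s y) \<le> E * norm (X t x - X t y)"
    using gronwall_backward[OF _ _ K0 order_refl _ 1 2, of s t] assms
    by (simp add: E_def continuous_on_diff X_cont')
qed

lemma X_upper: "t \<in> {0..1} \<Longrightarrow> norm (X t x - X t y) \<le> E * norm (x - y)"
  and X_lower: "t \<in> {0..1} \<Longrightarrow> norm (x - y) \<le> E * norm (X t x - X t y)"
  using X_diff_forward[of 0 t x y] X_diff_backward[of 0 t x y] by (auto simp: X_0)

text \<open>The factor |x - y| is the point: it makes \<open>X t - X s\<close> Lipschitz in space
  with a constant proportional to |t - s|, so the spatial derivatives are Cauchy as t tends to
  1.\<close>

lemma X_diff_time:
  assumes "s \<in> {0..1}" "t \<in> {0..1}"
  shows "norm ((X t x - X t y) - (X s x - X s y)) \<le> K * E * \<bar>t - s\<bar> * norm (x - y)"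
proof -
  have *: "norm ((X t x - X t y) - (X s x - X s y)) \<le> K * E * (t - s) * norm (x - y)"
    if st: "0 \<le> s" "s < t" "t \<le> 1" for s t
  proof -
    define C where "C = K * E * norm (x - y)"
    have "norm ((X t x - X t y) - (X s x - X s y)) \<le> C * t - C * s"
    proof (rule differentiable_bound_general[OF \<open>s < t\<close>])
      show "continuous_on {s..t} (\<lambda>r. X r x - X r y)"
        using st by (intro continuous_on_diff X_cont') auto
      show "continuous_on {s..t} (\<lambda>r. C * r)" by (intro continuous_intros)
      fix r assume r: "s < r" "r < t"
      show "((\<lambda>r. X r x - X r y) has_vector_derivative v r (X r x) - v r (X r y)) (at r)"
        using r st by (intro has_vector_derivative_diff X_deriv_at) auto
      show "((\<lambda>r. C * r) has_vector_derivative C) (at r)"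
        unfolding has_real_derivative_iff_has_vector_derivative[symmetric]
        by (auto intro!: derivative_eq_intros)
      have "norm (v r (X r x) - v r (X r y)) \<le> K * norm (X r x - X r y)"
        using r st by (intro v_lip) auto
      also have "\<dots> \<le> K * (E * norm (x - y))"
        using r st by (intro mult_left_mono X_upper K0) auto
      finally show "norm (v r (X r x) - v r (X r y)) \<le> C" by (simp add: C_def mult.assoc)
    qed
    then show ?thesis by (simp add: C_def algebra_simps)
  qed
  consider "s < t" | "s = t" | "t < s" by linarith
  then show ?thesis
  proof cases
    case 3
    have "norm ((X t x - X t y) - (X s x - X s y)) = norm ((X s x - X s y) - (X t x - X t y))"
      by (rule norm_minus_commute)
    also have "\<dots> \<le> K * E * (s - t) * norm (x - y)" using * assms 3 by simp
    finally show ?thesis using 3 by simp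
  qed (use * assms in auto)
qed

section \<open>Differentiability of the flow maps in the starting point\<close>

text \<open>The derivative in direction k is the solution \<open>\<xi> k\<close> of the variational
  equation along the trajectory of x. The defect X s y - X s x - \<xi> (y - x) s obeys the same
  linear estimate with a small source term, because \<open>D\<close> is uniformly continuous on a
  compact tube around the trajectory; t < 1 keeps this tube inside the domain of continuity.\<close>

lemma X_differentiable_lt1:
  assumes t: "t \<in> {0..<1}"
  shows "\<exists>f'. (X t has_derivative f') (at x)"
proof -
  have sub: "{0..t} \<subseteq> {0..<1}" using t by auto
  have contA: "continuous_on {0..t} (\<lambda>s. D s (X s x) h)" for h
    by (rule continuous_on_compose2[OF D_cont[of h], where f = "\<lambda>s. (s, X s x)", simplified])
       (use t in \<open>auto intro!: continuous_intros X_cont'\<close>)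
  have "\<exists>\<xi>. \<xi> 0 = k \<and> (\<forall>s\<in>{0..t}. (\<xi> has_vector_derivative D s (X s x) (\<xi> s)) (at s within {0..t}))" for k
    by (rule linear_ode_exists[of t K "\<lambda>s. D s (X s x)" k])
       (use t K0 in \<open>auto intro!: D_linear D_bound contA\<close>)
  then obtain \<xi> where \<xi>0: "\<And>k. \<xi> k 0 = k" and
    \<xi>d: "\<And>k s. s \<in> {0..t} \<Longrightarrow> (\<xi> k has_vector_derivative D s (X s x) (\<xi> k s)) (at s within {0..t})"
    by metis
  have \<xi>c: "continuous_on {0..t} (\<xi> k)" for k
    using \<xi>d has_vector_derivative_continuous unfolding continuous_on_eq_continuous_within by blast
  have \<xi>d': "(\<xi> k has_vector_derivative D s (X s x) (\<xi> k s)) (at s)" if "0 < s" "s < t" for k s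
    using \<xi>d[of s k] at_within_interior[of s "{0..t}"] that by simp
  \<comment> \<open>Linearity in the initial value is uniqueness: the defect of additivity or
    homogeneity solves the same equation and starts at 0.\<close>
  have lin: "linear (\<lambda>k. \<xi> k t)"
  proof (rule linearI)
    fix k k'
    have "norm (\<xi> (k + k') t - \<xi> k t - \<xi> k' t) \<le> exp (K + 1) * (norm (\<xi> (k + k') 0 - \<xi> k 0 - \<xi> k' 0) + 0)"
    proof (rule gronwall_forward[where u' = "\<lambda>s. D s (X s x) (\<xi> (k + k') s) - D s (X s x) (\<xi> k s) - D s (X s x) (\<xi> k' s)"])
      fix r assume r: "0 < r" "r < t"
      then have "D r (X r x) (\<xi> (k + k') r) - D r (X r x) (\<xi> k r) - D r (X r x) (\<xi> k' r)
        = D r (X r x) (\<xi> (k + k') r - \<xi> k r - \<xi> k' r)"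
        using t D_linear[of r "X r x"] by (simp add: linear_diff)
      then show "norm (D r (X r x) (\<xi> (k + k') r) - D r (X r x) (\<xi> k r) - D r (X r x) (\<xi> k' r))
         \<le> K * norm (\<xi> (k + k') r - \<xi> k r - \<xi> k' r) + 0" using D_bound r t by simp
    qed (use t K0 in \<open>auto intro!: has_vector_derivative_diff \<xi>d' continuous_on_diff \<xi>c\<close>)
    then show "\<xi> (k + k') t = \<xi> k t + \<xi> k' t" by (simp add: \<xi>0 algebra_simps)
  next
    fix c k
    have "norm (\<xi> (c *\<^sub>R k) t - c *\<^sub>R \<xi> k t) \<le> exp (K + 1) * (norm (\<xi> (c *\<^sub>R k) 0 - c *\<^sub>R \<xi> k 0) + 0)"
    proof (rule gronwall_forward[where u' = "\<lambda>s. D s (X s x) (\<xi> (c *\<^sub>R k) s) - c *\<^sub>R D s (X s x) (\<xi> k s)"])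
      fix r assume r: "0 < r" "r < t"
      then have "D r (X r x) (\<xi> (c *\<^sub>R k) r) - c *\<^sub>R D r (X r x) (\<xi> k r)
        = D r (X r x) (\<xi> (c *\<^sub>R k) r - c *\<^sub>R \<xi> k r)"
        using t D_linear[of r "X r x"] by (simp add: linear_diff linear_scale)
      then show "norm (D r (X r x) (\<xi> (c *\<^sub>R k) r) - c *\<^sub>R D r (X r x) (\<xi> k r))
         \<le> K * norm (\<xi> (c *\<^sub>R k) r - c *\<^sub>R \<xi> k r) + 0" using D_bound r t by simp
      show "((\<lambda>s. \<xi> (c *\<^sub>R k) s - c *\<^sub>R \<xi> k s) has_vector_derivative
         D r (X r x) (\<xi> (c *\<^sub>R k) r) - c *\<^sub>R D r (X r x) (\<xi> k r)) (at r)"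
        using r by (intro has_vector_derivative_diff \<xi>d' bounded_linear.has_vector_derivative[OF bounded_linear_scaleR_right])
    qed (use t K0 in \<open>auto intro!: continuous_intros \<xi>c\<close>)
    then show "\<xi> (c *\<^sub>R k) t = c *\<^sub>R \<xi> k t" by (simp add: \<xi>0)
  qed
  have "(X t has_derivative (\<lambda>k. \<xi> k t)) (at x)"
    unfolding has_derivative_at_alt
  proof (intro conjI allI impI)
    show "bounded_linear (\<lambda>k. \<xi> k t)" using lin by (simp add: linear_conv_bounded_linear)
    fix e :: real assume "e > 0"
    \<comment> \<open>One factor \<open>E\<close> comes from |X s y - X s x| <= E |y - x|, the other
      from Gronwall, and the dimension from combining the continuity of \<open>D\<close> in the
      separate basis directions.\<close>
    define e' where "e' = e / (E * E * real DIM('a))"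
    have e': "e' > 0" using \<open>e > 0\<close> E_pos by (simp add: e'_def)
    have "bounded ((\<lambda>s. X s x) ` {0..t})"
      by (intro compact_imp_bounded compact_continuous_image X_cont') (use t in auto)
    then obtain R where R: "\<And>s. s \<in> {0..t} \<Longrightarrow> norm (X s x) \<le> R" unfolding bounded_iff by (metis imageI)
    define S where "S = {0..t} \<times> cball (0::'a) (R + 1)"
    have "\<exists>d>0. \<forall>p\<in>S. \<forall>q\<in>S. dist q p < d \<longrightarrow> dist ((\<lambda>(s, z). D s z b) q) ((\<lambda>(s, z). D s z b) p) < e'" for b
    proof -
      have "uniformly_continuous_on S (\<lambda>(s, z). D s z b)"
        unfolding S_def using t
        by (intro compact_uniformly_continuous continuous_on_subset[OF D_cont[of b]] compact_Times) auto
      then show ?thesis using e' unfolding uniformly_continuous_on_def by blast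
    qed
    then obtain d where d: "\<And>b. d b > 0" and
      dd: "\<And>b p q. p \<in> S \<Longrightarrow> q \<in> S \<Longrightarrow> dist q p < d b \<Longrightarrow> dist ((\<lambda>(s, z). D s z b) q) ((\<lambda>(s, z). D s z b) p) < e'"
      by metis
    \<comment> \<open>The minimum with 1 keeps points within \<open>d0\<close> of the trajectory
      inside the compact tube \<open>S\<close>.\<close>
    define d0 where "d0 = min 1 (Min (d ` Basis))"
    have d0: "d0 > 0" using d by (simp add: d0_def)
    have Dclose: "norm (D s z h - D s (X s x) h) \<le> real DIM('a) * e' * norm h"
      if s: "s \<in> {0..t}" and z: "norm (z - X s x) < d0" for s z h
    proof -
      have st: "s \<in> {0..<1}" using s sub by auto
      have "norm z \<le> norm (z - X s x) + norm (X s x)"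
        using norm_triangle_ineq[of "z - X s x" "X s x"] by simp
      then have S: "(s, z) \<in> S" "(s, X s x) \<in> S" using s z R[OF s] by (auto simp: S_def d0_def)
      have b: "norm (D s z b - D s (X s x) b) \<le> e'" if "b \<in> Basis" for b
      proof -
        have "d0 \<le> d b" using that by (auto simp: d0_def intro!: min.coboundedI2 Min_le)
        then show ?thesis using dd[OF S(2) S(1), of b] z by (simp add: dist_Pair_Pair dist_norm)
      qed
      have "D s z h - D s (X s x) h = (\<Sum>b\<in>Basis. (h \<bullet> b) *\<^sub>R (D s z b - D s (X s x) b))"
        by (subst linear_sum_Basis[OF D_linear[OF st, of z]],
            subst linear_sum_Basis[OF D_linear[OF st, of "X s x"]])
           (simp add: sum_subtractf[symmetric] scaleR_diff_right)
      also have "norm \<dots> \<le> (\<Sum>b\<in>(Basis::'a set). norm h * e')"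
      proof (rule sum_norm_le)
        fix b :: 'a assume B: "b \<in> Basis"
        have "norm ((h \<bullet> b) *\<^sub>R (D s z b - D s (X s x) b)) = \<bar>h \<bullet> b\<bar> * norm (D s z b - D s (X s x) b)" by simp
        also have "\<dots> \<le> norm h * e'" using B by (intro mult_mono Basis_le_norm b) auto
        finally show "norm ((h \<bullet> b) *\<^sub>R (D s z b - D s (X s x) b)) \<le> norm h * e'" .
      qed
      finally show ?thesis by (simp add: algebra_simps)
    qed
    show "\<exists>\<delta>>0. \<forall>y. norm (y - x) < \<delta> \<longrightarrow> norm (X t y - X t x - \<xi> (y - x) t) \<le> e * norm (y - x)"
    proof (intro exI[of _ "d0 / E"] conjI allI impI)
      show "d0 / E > 0" using d0 E_pos by simp
      fix y assume y: "norm (y - x) < d0 / E"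
      define \<epsilon> where "\<epsilon> = real DIM('a) * e' * (E * norm (y - x))"
      have \<epsilon>0: "\<epsilon> \<ge> 0" using e' E_pos by (simp add: \<epsilon>_def)
      have small: "norm (X s y - X s x) \<le> E * norm (y - x)" "norm (X s y - X s x) < d0" if "s \<in> {0..t}" for s
      proof -
        show "norm (X s y - X s x) \<le> E * norm (y - x)" using X_upper[of s y x] that t by auto
        also have "\<dots> < d0" using y E_pos by (simp add: field_simps)
        finally show "norm (X s y - X s x) < d0" .
      qed
      have "norm ((X t y - X t x) - \<xi> (y - x) t) \<le> exp (K + 1) * (norm ((X 0 y - X 0 x) - \<xi> (y - x) 0) + \<epsilon>)"
      proof (rule gronwall_forward[where u' = "\<lambda>s. (v s (X s y) - v s (X s x)) - D s (X s x) (\<xi> (y - x) s)"])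
        fix r assume r: "0 < r" "r < t"
        then have r': "r \<in> {0..t}" "r \<in> {0..<1}" using t by auto
        show "((\<lambda>s. X s y - X s x - \<xi> (y - x) s) has_vector_derivative
             v r (X r y) - v r (X r x) - D r (X r x) (\<xi> (y - x) r)) (at r)"
          using r t by (intro has_vector_derivative_diff \<xi>d' X_deriv_at) auto
        have seg: "X r x + s *\<^sub>R (X r y - X r x) \<in> ball (X r x) d0" if "s \<in> {0..1}" for s
        proof -
          have "s * norm (X r y - X r x) \<le> 1 * norm (X r y - X r x)"
            using that by (intro mult_right_mono) auto
          then show ?thesis using small(2)[OF r'(1)] that by (simp add: dist_norm)
        qed
        have "norm (v r (X r y) - v r (X r x) - D r (X r x) (X r y - X r x))
            \<le> norm (X r y - X r x) * (real DIM('a) * e')"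
        proof (rule differentiable_bound_linearization[where S = "ball (X r x) d0" and f' = "D r"])
          show "(v r has_derivative D r z) (at z within ball (X r x) d0)" for z
            by (rule has_derivative_at_withinI[OF v_deriv[OF r'(2)]])
          show "onorm (D r z - D r (X r x)) \<le> real DIM('a) * e'" if "z \<in> ball (X r x) d0" for z
            using Dclose[OF r'(1), of z] that e'
            by (intro onorm_bound) (auto simp: dist_norm norm_minus_commute)
        qed (use seg d0 in auto)
        also have "\<dots> \<le> (E * norm (y - x)) * (real DIM('a) * e')"
          using small(1)[OF r'(1)] e' by (intro mult_right_mono) auto
        finally have 1: "norm (v r (X r y) - v r (X r x) - D r (X r x) (X r y - X r x)) \<le> \<epsilon>"
          by (simp add: \<epsilon>_def ac_simps)
        have "v r (X r y) - v r (X r x) - D r (X r x) (\<xi> (y - x) r)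
          = D r (X r x) (X r y - X r x - \<xi> (y - x) r) + (v r (X r y) - v r (X r x) - D r (X r x) (X r y - X r x))"
          using linear_diff[OF D_linear[OF r'(2), of "X r x"], of "X r y - X r x" "\<xi> (y - x) r"] by simp
        also have "norm \<dots> \<le> K * norm (X r y - X r x - \<xi> (y - x) r) + \<epsilon>"
          by (rule order_trans[OF norm_triangle_ineq add_mono[OF D_bound[OF r'(2)] 1]])
        finally show "norm (v r (X r y) - v r (X r x) - D r (X r x) (\<xi> (y - x) r))
            \<le> K * norm (X r y - X r x - \<xi> (y - x) r) + \<epsilon>" .
      qed (use t K0 \<epsilon>0 in \<open>auto intro!: continuous_intros X_cont' \<xi>c\<close>)
      also have "\<dots> = E * \<epsilon>" by (simp add: X_0 \<xi>0 E_def)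
      also have "\<dots> = e * norm (y - x)" using E_pos by (simp add: \<epsilon>_def e'_def)
      finally show "norm (X t y - X t x - \<xi> (y - x) t) \<le> e * norm (y - x)" .
    qed
  qed
  then show ?thesis by (intro exI[of _ "\<lambda>k. \<xi> k t"])
qed

text \<open>For t = 1 the maps at times 1 - 1/(n+1) are used: by \<open>X_diff_time\<close> their
  derivatives form a Cauchy sequence uniformly in the base point, and a pointwise limit of maps with
  uniformly convergent derivatives is differentiable.\<close>

lemma X_differentiable:
  assumes t: "t \<in> {0..1}"
  shows "\<exists>f'. (X t has_derivative f') (at x)"
proof (cases "t < 1")
  case True
  then show ?thesis using t by (intro X_differentiable_lt1) simp
next
  case False
  then have t1: "t = 1" using t by simp
  define \<tau> where "\<tau> = (\<lambda>n. 1 - 1 / real (Suc n))"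
  have \<tau>: "\<tau> n \<in> {0..<1}" "\<tau> n \<in> {0..1}" for n by (simp_all add: \<tau>_def)
  have \<tau>lim: "\<tau> \<longlonglongrightarrow> 1"
    unfolding \<tau>_def using tendsto_diff[OF tendsto_const[of 1] LIMSEQ_inverse_real_of_nat]
    by (simp add: inverse_eq_divide)
  define f' where "f' = (\<lambda>n y. frechet_derivative (X (\<tau> n)) (at y))"
  have f': "(X (\<tau> n) has_derivative f' n y) (at y)" for n y
    unfolding f'_def frechet_derivative_works[symmetric] differentiable_def
    by (rule X_differentiable_lt1[OF \<tau>(1)])
  have close: "norm (f' n y h - f' m y h) \<le> K * E * \<bar>\<tau> n - \<tau> m\<bar> * norm h" for n m y h
  proof (rule has_derivative_norm_le[OF has_derivative_diff[OF f' f']], rule always_eventually, rule allI)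
    show "norm (X (\<tau> n) z - X (\<tau> m) z - (X (\<tau> n) y - X (\<tau> m) y)) \<le> K * E * \<bar>\<tau> n - \<tau> m\<bar> * norm (z - y)" for z
      using X_diff_time[OF \<tau>(2)[of m] \<tau>(2)[of n], of z y] by (simp add: algebra_simps)
  qed
  have "convergent (\<lambda>n. f' n y h)" for y h
  proof (rule Cauchy_convergent, rule CauchyI)
    fix e :: real assume e: "e > 0"
    define e' where "e' = e / (K * E * norm h + 1)"
    have p: "K * E * norm h + 1 > 0" using K0 E_pos by (simp add: add_nonneg_pos)
    have "e' > 0" using e p by (simp add: e'_def)
    then obtain N where N: "\<And>m n. m \<ge> N \<Longrightarrow> n \<ge> N \<Longrightarrow> \<bar>\<tau> m - \<tau> n\<bar> < e'"
      using CauchyD[OF LIMSEQ_imp_Cauchy[OF \<tau>lim], of e'] by auto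
    show "\<exists>N. \<forall>m\<ge>N. \<forall>n\<ge>N. norm (f' m y h - f' n y h) < e"
    proof (intro exI[of _ N] allI impI)
      fix m n assume "m \<ge> N" "n \<ge> N"
      have "norm (f' m y h - f' n y h) \<le> \<bar>\<tau> m - \<tau> n\<bar> * (K * E * norm h)"
        using close[of m y h n] by (simp add: ac_simps)
      also have "\<dots> \<le> e' * (K * E * norm h)"
        using N[OF \<open>m \<ge> N\<close> \<open>n \<ge> N\<close>] K0 E_pos by (intro mult_right_mono) auto
      also have "\<dots> < e' * (K * E * norm h + 1)" using \<open>e' > 0\<close> by simp
      also have "\<dots> = e" using p by (simp add: e'_def)
      finally show "norm (f' m y h - f' n y h) < e" .
    qed
  qed
  then obtain g' where g': "\<And>y h. (\<lambda>n. f' n y h) \<longlonglongrightarrow> g' y h"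
    unfolding convergent_def by metis
  have close': "norm (f' n y h - g' y h) \<le> K * E * \<bar>\<tau> n - 1\<bar> * norm h" for n y h
  proof (rule LIMSEQ_le)
    show "(\<lambda>m. norm (f' n y h - f' m y h)) \<longlonglongrightarrow> norm (f' n y h - g' y h)"
      by (intro tendsto_intros g')
    show "(\<lambda>m. K * E * \<bar>\<tau> n - \<tau> m\<bar> * norm h) \<longlonglongrightarrow> K * E * \<bar>\<tau> n - 1\<bar> * norm h"
      by (intro tendsto_intros \<tau>lim)
  qed (use close in blast)
  have "(\<lambda>n. X (\<tau> n) y) \<longlonglongrightarrow> X 1 y" for y
    using X_cont[of y] \<tau>lim \<tau>(2) unfolding continuous_on_sequentially by (auto simp: o_def)
  note Xlim = this
  have "\<exists>g. \<forall>y\<in>UNIV. (\<lambda>n. X (\<tau> n) y) \<longlonglongrightarrow> g y \<and> (g has_derivative g' y) (at y within UNIV)"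
  proof (rule has_derivative_sequence[where f' = f'])
    fix e :: real assume e: "e > 0"
    have "(\<lambda>n. K * E * \<bar>\<tau> n - 1\<bar>) \<longlonglongrightarrow> K * E * \<bar>1 - 1\<bar>" by (intro tendsto_intros \<tau>lim)
    then have "\<forall>\<^sub>F n in sequentially. K * E * \<bar>\<tau> n - 1\<bar> < e" using e by (intro order_tendstoD) auto
    then show "\<forall>\<^sub>F n in sequentially. \<forall>y\<in>UNIV. \<forall>h. norm (f' n y h - g' y h) \<le> e * norm h"
      by eventually_elim (auto intro!: order_trans[OF close'] mult_right_mono)
  qed (use f' Xlim in auto)
  then obtain g where g: "\<And>y. (\<lambda>n. X (\<tau> n) y) \<longlonglongrightarrow> g y" "\<And>y. (g has_derivative g' y) (at y)" by auto
  have "g = X 1" using LIMSEQ_unique[OF g(1) Xlim] by blast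
  then show ?thesis using g(2) t1 by blast
qed

lemma X_continuous: "t \<in> {0..1} \<Longrightarrow> continuous_on UNIV (X t)"
  using X_differentiable by (metis continuous_at_imp_continuous_on has_derivative_continuous)

section \<open>The inverse flow maps\<close>

lemma X_inj: "t \<in> {0..1} \<Longrightarrow> inj (X t)"
proof (rule injI)
  fix x y assume "t \<in> {0..1}" "X t x = X t y"
  then show "x = y" using X_lower[of t x y] by simp
qed

text \<open>The range is open by invariance of domain and closed because preimages of a Cauchy
  sequence are Cauchy by \<open>X_lower\<close>; connectedness leaves the whole space.\<close>

lemma X_surj: assumes t: "t \<in> {0..1}" shows "range (X t) = UNIV"
proof -
  have op: "open (range (X t))"
    by (rule invariance_of_domain[OF X_continuous[OF t] open_UNIV X_inj[OF t]])
  have cl: "closed (range (X t))"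
    unfolding closed_sequential_limits
  proof (intro allI impI, elim conjE)
    fix z l assume z: "\<forall>n. z n \<in> range (X t)" and l: "z \<longlonglongrightarrow> l"
    define y where "y = (\<lambda>n. inv (X t) (z n))"
    have y: "z n = X t (y n)" for n unfolding y_def using z by (simp add: f_inv_into_f)
    have "Cauchy y"
    proof (rule CauchyI)
      fix e :: real assume "e > 0"
      then obtain N where N: "\<forall>m\<ge>N. \<forall>n\<ge>N. norm (z m - z n) < e / E"
        using CauchyD[OF LIMSEQ_imp_Cauchy[OF l], of "e / E"] E_pos by auto
      have "norm (y m - y n) < e" if "m \<ge> N" "n \<ge> N" for m n
      proof -
        have "norm (y m - y n) \<le> E * norm (z m - z n)" using X_lower[OF t, of "y m" "y n"] y by simp
        also have "\<dots> < e" using N that E_pos by (simp add: field_simps)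
        finally show ?thesis .
      qed
      then show "\<exists>M. \<forall>m\<ge>M. \<forall>n\<ge>M. norm (y m - y n) < e" by blast
    qed
    then obtain a where "y \<longlonglongrightarrow> a" using Cauchy_convergent convergent_def by blast
    then have "(\<lambda>n. X t (y n)) \<longlonglongrightarrow> X t a"
      using X_continuous[OF t] by (auto simp: continuous_on_sequentially o_def)
    then have "l = X t a" using LIMSEQ_unique[OF l] by (simp add: y[symmetric])
    then show "l \<in> range (X t)" by simp
  qed
  show ?thesis using clopen[of "range (X t)"] op cl by auto
qed

definition Xi where "Xi t = inv (X t)"

lemma X_Xi [simp]: "t \<in> {0..1} \<Longrightarrow> X t (Xi t z) = z"
  unfolding Xi_def by (rule surj_f_inv_f[OF X_surj])

lemma Xi_X [simp]: "t \<in> {0..1} \<Longrightarrow> Xi t (X t z) = z"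
  unfolding Xi_def by (rule inv_f_f[OF X_inj])

lemma Xi_lip: "t \<in> {0..1} \<Longrightarrow> norm (Xi t z - Xi t w) \<le> E * norm (z - w)"
  using X_lower[of t "Xi t z" "Xi t w"] by simp

lemma Xi_continuous: assumes "t \<in> {0..1}" shows "continuous_on UNIV (Xi t)"
  by (rule lipschitz_on_continuous_on[of E], rule lipschitz_onI)
     (use Xi_lip[OF assms] E_pos in \<open>auto simp: dist_norm\<close>)

text \<open>The lower Lipschitz bound makes the derivative of \<open>X t\<close> injective, hence
  invertible in finite dimension; together with the continuity of \<open>Xi t\<close> this gives the
  derivative of the inverse.\<close>

lemma Xi_differentiable:
  assumes t: "t \<in> {0..1}"
  shows "\<exists>f'. (Xi t has_derivative f') (at z)"
proof -
  obtain f' where f': "(X t has_derivative f') (at (Xi t z))" using X_differentiable[OF t] by blast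
  have lin: "linear f'" by (rule has_derivative_linear[OF f'])
  have ge: "inverse E * norm h \<le> norm (f' h)" for h
    by (rule has_derivative_norm_ge[OF f'])
       (use X_lower[OF t] E_pos in \<open>auto simp: field_simps intro!: always_eventually\<close>)
  have "f' h = 0 \<Longrightarrow> h = 0" for h using ge[of h] E_pos by (simp add: mult_le_0_iff)
  then have "inj f'" using linear_injective_0[OF lin] by blast
  then obtain g' where g': "linear g'" "g' \<circ> f' = id"
    using linear_injective_left_inverse[OF lin] by blast
  have "(Xi t has_derivative g') (at z)"
    by (rule has_derivative_inverse_basic[where f = "X t" and f' = f' and T = UNIV])
       (use f' g' Xi_continuous[OF t] t in \<open>auto simp: linear_conv_bounded_linear continuous_on_eq_continuous_at\<close>)
  then show ?thesis by blast
qed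

lemma X_joint_continuous: "continuous_on ({0..1} \<times> UNIV) (\<lambda>(t, x). X t x)"
  unfolding continuous_on_def
proof clarify
  fix t and x :: 'a assume t: "t \<in> {0..1::real}"
  let ?F = "at (t, x) within {0..1} \<times> (UNIV :: 'a set)"
  have fs: "((\<lambda>p. fst p) \<longlongrightarrow> t) ?F" "((\<lambda>p. snd p) \<longlongrightarrow> x) ?F"
    by (auto intro!: tendsto_eq_intros)
  have "((\<lambda>p. X (fst p) x) \<longlongrightarrow> X t x) ?F"
    using X_cont[of x] t by (rule continuous_on_tendsto_compose[OF _ fs(1)]) (auto simp: eventually_at_filter intro!: always_eventually)
  then have l: "((\<lambda>p. E * norm (snd p - x) + norm (X (fst p) x - X t x)) \<longlongrightarrow> 0) ?F"
    by (auto intro!: tendsto_eq_intros fs)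
  have "((\<lambda>p. X (fst p) (snd p) - X t x) \<longlongrightarrow> 0) ?F"
  proof (rule Lim_null_comparison[OF _ l])
    show "\<forall>\<^sub>F p in ?F. norm (X (fst p) (snd p) - X t x) \<le> E * norm (snd p - x) + norm (X (fst p) x - X t x)"
      unfolding eventually_at_filter
    proof (rule always_eventually, clarsimp)
      fix r y assume r: "0 \<le> r" "r \<le> (1::real)"
      have "norm (X r y - X t x) \<le> norm (X r y - X r x) + norm (X r x - X t x)"
        using norm_triangle_ineq[of "X r y - X r x" "X r x - X t x"] by simp
      then show "norm (X r y - X t x) \<le> E * norm (y - x) + norm (X r x - X t x)"
        using X_upper[of r y x] r by simp
    qed
  qed
  then show "((\<lambda>(t, x). X t x) \<longlongrightarrow> X t x) ?F"
    by (simp add: case_prod_unfold LIM_zero_iff)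
qed

lemma vX_continuous: "continuous_on ({0..<1} \<times> UNIV) (\<lambda>(t, x). v t (X t x))"
proof -
  have "continuous_on ({0..<1} \<times> UNIV) (\<lambda>p. (\<lambda>(t, x). X t x) p)"
    by (rule continuous_on_subset[OF X_joint_continuous]) auto
  then have "continuous_on ({0..<1} \<times> UNIV) (\<lambda>p. (fst p, X (fst p) (snd p)))"
    by (intro continuous_intros) (simp add: case_prod_beta)
  from continuous_on_compose2[OF v_cont this] show ?thesis by (auto simp: case_prod_unfold image_subset_iff)
qed

section \<open>Regularity in time on compact subintervals of [0,1)\<close>

lemma v_growth:
  assumes T: "0 \<le> T" "T < 1"
  obtains V where "0 \<le> V" "\<And>r x. r \<in> {0..T} \<Longrightarrow> norm (v r x) \<le> V + K * norm x"
proof -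
  have "continuous_on {0..T} (\<lambda>r. v r 0)"
    by (rule continuous_on_compose2[OF v_cont, where f = "\<lambda>r. (r, 0)", simplified])
       (use T in \<open>auto intro!: continuous_intros\<close>)
  then have "bounded ((\<lambda>r. v r 0) ` {0..T})"
    by (intro compact_imp_bounded compact_continuous_image) auto
  then obtain V where V: "\<And>r. r \<in> {0..T} \<Longrightarrow> norm (v r 0) \<le> V" unfolding bounded_iff by (metis imageI)
  show thesis
  proof (rule that[of V])
    show "0 \<le> V" using V[of 0] T order_trans[OF norm_ge_zero] by auto
    fix r x assume r: "r \<in> {0..T}"
    have "norm (v r x) \<le> norm (v r x - v r 0) + norm (v r 0)"
      using norm_triangle_ineq[of "v r x - v r 0" "v r 0"] by simp
    also have "\<dots> \<le> K * norm (x - 0) + V" using r T V by (intro add_mono v_lip) auto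
    finally show "norm (v r x) \<le> V + K * norm x" by simp
  qed
qed

text \<open>Gronwall in both time directions bounds a whole trajectory, and so its speed, by its
  position at any chosen reference time s. The constant depends on T < 1 because |v r 0| is bounded
  only on compact subintervals.\<close>

lemma X_time_lip:
  assumes T: "0 \<le> T" "T < 1"
  obtains C where "0 \<le> C"
    "\<And>r s x. r \<in> {0..T} \<Longrightarrow> s \<in> {0..T} \<Longrightarrow> norm (X r x - X s x) \<le> C * (1 + norm (X s x)) * \<bar>r - s\<bar>"
proof -
  obtain V where V: "0 \<le> V" "\<And>r x. r \<in> {0..T} \<Longrightarrow> norm (v r x) \<le> V + K * norm x"
    using v_growth[OF T] by blast
  have bnd: "norm (X r x) \<le> E * (norm (X s x) + V)" if rs: "r \<in> {0..T}" "s \<in> {0..T}" for r s x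
  proof -
    have d: "((\<lambda>q. X q x) has_vector_derivative v q (X q x)) (at q)"
      and b: "norm (v q (X q x)) \<le> K * norm (X q x) + V" if "min r s < q" "q < max r s" for q
    proof -
      have q: "0 < q" "q < 1" "q \<in> {0..T}" using that rs T by (auto simp: min_def max_def split: if_splits)
      show "((\<lambda>q. X q x) has_vector_derivative v q (X q x)) (at q)" by (rule X_deriv_at[OF q(1,2)])
      show "norm (v q (X q x)) \<le> K * norm (X q x) + V" using V(2)[OF q(3), of "X q x"] by simp
    qed
    show ?thesis
    proof (cases "r \<le> s")
      case True
      then show ?thesis using gronwall_backward[of r s K V "\<lambda>q. X q x" "\<lambda>q. v q (X q x)"] d b rs T K0 V(1)
        by (simp add: X_cont' E_def)
    next
      case False
      then show ?thesis using gronwall_forward[of s r K V "\<lambda>q. X q x" "\<lambda>q. v q (X q x)"] d b rs T K0 V(1)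
        by (simp add: X_cont' E_def)
    qed
  qed
  define C where "C = V + K * E * (1 + V)"
  have C0: "0 \<le> C" using V(1) K0 E_pos by (simp add: C_def)
  have "norm (X r x - X s x) \<le> C * (1 + norm (X s x)) * \<bar>r - s\<bar>" if rs: "r \<in> {0..T}" "s \<in> {0..T}" for r s x
  proof -
    have "norm (X r x - X s x) \<le> (C * (1 + norm (X s x))) * norm (r - s)"
    proof (rule differentiable_bound[where S = "{0..T}" and f' = "\<lambda>q h. h *\<^sub>R v q (X q x)"])
      fix q assume q: "q \<in> {0..T}"
      show "((\<lambda>q. X q x) has_derivative (\<lambda>h. h *\<^sub>R v q (X q x))) (at q within {0..T})"
        using X_deriv[of q x] q T unfolding has_vector_derivative_def
        by (rule_tac has_derivative_subset) auto
      have "norm (v q (X q x)) \<le> V + K * (E * (norm (X s x) + V))"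
        by (rule order_trans[OF V(2)[OF q]]) (intro add_left_mono mult_left_mono bnd q rs K0)
      also have "\<dots> \<le> C * (1 + norm (X s x))"
      proof -
        have "0 \<le> V * norm (X s x)" "0 \<le> K * E" "0 \<le> (K * E) * (V * norm (X s x))"
          using V(1) K0 E_pos by auto
        then show ?thesis by (simp add: C_def algebra_simps)
      qed
      finally have "norm (v q (X q x)) \<le> C * (1 + norm (X s x))" .
      then show "onorm (\<lambda>h. h *\<^sub>R v q (X q x)) \<le> C * (1 + norm (X s x))"
        using C0 by (intro onorm_bound) (auto simp: mult.commute[of _ "\<bar>_\<bar>"] intro!: mult_left_mono)
    qed (use rs in auto)
    then show ?thesis by simp
  qed
  with C0 show thesis by (rule that)
qed

lemma pulled_back_path:
  assumes s: "0 < s" "s < 1"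
    and I: "(I has_vector_derivative I') (at s)"
    and g: "((\<lambda>z. g (Xi s z)) has_derivative \<phi>') (at (I s))"
  shows "((\<lambda>r. g (Xi r (I r))) has_vector_derivative \<phi>' (I' - v s (I s))) (at s)"
proof -
  define y where "y = (\<lambda>r. Xi r (I r))"
  define F0 where "F0 = v s (I s)"
  have Xy: "X s (y s) = I s" using s by (simp add: y_def)
  have Icont: "(I \<longlongrightarrow> I s) (at s)"
    using has_vector_derivative_continuous[OF I] by (simp add: continuous_at)
  have "continuous (at s) (\<lambda>r. X r (y s))"
    using has_vector_derivative_continuous[OF X_deriv_at[OF s]] .
  then have "((\<lambda>r. E * norm (I r - X r (y s))) \<longlongrightarrow> E * norm (I s - X s (y s))) (at s)"
    by (intro tendsto_intros Icont) (simp add: continuous_at)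
  then have l: "((\<lambda>r. E * norm (I r - X r (y s))) \<longlongrightarrow> 0) (at s)" by (simp add: Xy)
  have "((\<lambda>r. y r - y s) \<longlongrightarrow> 0) (at s)"
  proof (rule Lim_null_comparison[OF _ l])
    have "\<forall>\<^sub>F r in at s. r \<in> {0<..<1}" using s by (intro eventually_at_in_open') auto
    then show "\<forall>\<^sub>F r in at s. norm (y r - y s) \<le> E * norm (I r - X r (y s))"
    proof eventually_elim
      case (elim r)
      then show ?case using X_lower[of r "y r" "y s"] by (simp add: y_def)
    qed
  qed
  then have ycont: "(y \<longlongrightarrow> y s) (at s)" by (simp add: LIM_zero_iff)
  have \<rho>: "((\<lambda>r. X r (y r) - X s (y r)) has_vector_derivative F0) (at s)"
    unfolding has_vector_derivative_def has_derivative_at_alt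
  proof (intro conjI allI impI)
    show "bounded_linear (\<lambda>x. x *\<^sub>R F0)" by (rule bounded_linear_scaleR_left)
    fix e :: real assume e: "e > 0"
    have "continuous_on ({0<..<1} \<times> UNIV) (\<lambda>(t, x). v t (X t x))"
      by (rule continuous_on_subset[OF vX_continuous]) auto
    then have "isCont (\<lambda>(t, x). v t (X t x)) (s, y s)"
      using s by (subst (asm) continuous_on_eq_continuous_at) (auto intro: open_Times)
    note this[unfolded continuous_at_eps_delta, rule_format, of "e / 3"]
    moreover have "0 < e / 3" using e by simp
    ultimately obtain \<eta> where \<eta>: "\<eta> > 0" "\<And>q. dist q (s, y s) < \<eta> \<Longrightarrow>
        dist ((\<lambda>(t, x). v t (X t x)) q) ((\<lambda>(t, x). v t (X t x)) (s, y s)) < e / 3"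
      by blast
    define m where "m = min (\<eta> / 2) (min s (1 - s))"
    have m: "m > 0" using \<eta> s by (simp add: m_def)
    have near: "norm (v r (X r z) - F0) < e / 3" if "\<bar>r - s\<bar> < m" "norm (z - y s) < \<eta> / 2" for r z
    proof -
      have "dist (r, z) (s, y s) \<le> \<bar>r - s\<bar> + norm (z - y s)"
        unfolding dist_Pair_Pair using sqrt_sum_squares_le_sum_abs[of "dist r s" "dist z (y s)"]
        by (simp add: dist_norm)
      also have "\<dots> < \<eta>" using that by (simp add: m_def)
      finally show ?thesis using \<eta>(2)[of "(r, z)"] Xy by (simp add: dist_norm F0_def)
    qed
    have "\<forall>\<^sub>F r in at s. dist (y r) (y s) < \<eta> / 2"
      using ycont \<eta>(1) by (intro tendstoD) auto
    then obtain d where d: "d > 0" "\<And>r. r \<noteq> s \<Longrightarrow> dist r s < d \<Longrightarrow> dist (y r) (y s) < \<eta> / 2"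
      unfolding eventually_at by auto
    show "\<exists>d>0. \<forall>r. norm (r - s) < d \<longrightarrow>
       norm (X r (y r) - X s (y r) - (X s (y s) - X s (y s)) - (r - s) *\<^sub>R F0) \<le> e * norm (r - s)"
    proof (intro exI[of _ "min d m"] conjI allI impI)
      show "min d m > 0" using d m by simp
      fix r assume r: "norm (r - s) < min d m"
      have yr: "norm (y r - y s) < \<eta> / 2"
        using d(2)[of r] r \<eta>(1) by (cases "r = s") (auto simp: dist_norm)
      define S where "S = {s - m<..<s + m}"
      \<comment> \<open>The starting point \<open>y r\<close> is frozen and the mean value
        inequality is applied in time along its trajectory. Oscillation of the velocity costs 2e/3;
        the remaining e/3 is for replacing the velocity at time s by \<open>F0\<close>.\<close>
      have "norm (X r (y r) - X s (y r) - (r - s) *\<^sub>R v s (X s (y r))) \<le> norm (r - s) * (2 * (e / 3))"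
      proof (rule vector_differentiable_bound_linearization[where S = S and f' = "\<lambda>q. v q (X q (y r))"])
        fix q assume q: "q \<in> S"
        have q': "\<bar>q - s\<bar> < m" "0 < q" "q < 1"
          using q unfolding S_def greaterThanLessThan_iff m_def by linarith+
        show "((\<lambda>q. X q (y r)) has_vector_derivative v q (X q (y r))) (at q within S)"
          by (rule has_vector_derivative_at_within[OF X_deriv_at[OF q'(2,3)]])
        have "norm (v q (X q (y r)) - v s (X s (y r))) \<le>
            norm (v q (X q (y r)) - F0) + norm (v s (X s (y r)) - F0)"
          using norm_triangle_ineq4[of "v q (X q (y r)) - F0" "v s (X s (y r)) - F0"] by simp
        also have "\<dots> \<le> 2 * (e / 3)"
          using near[OF q'(1) yr] near[of s "y r"] yr m by simp
        finally show "norm (v q (X q (y r)) - v s (X s (y r))) \<le> 2 * (e / 3)" .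
      next
        show "closed_segment s r \<subseteq> S" using r m
          by (auto simp: S_def closed_segment_eq_real_ivl split: if_splits)
        show "s \<in> S" using m by (simp add: S_def)
      qed
      moreover have "norm ((r - s) *\<^sub>R (v s (X s (y r)) - F0)) \<le> norm (r - s) * (e / 3)"
        unfolding norm_scaleR real_norm_def
        using near[of s "y r"] yr m by (intro mult_left_mono) auto
      moreover have "norm (X r (y r) - X s (y r) - (r - s) *\<^sub>R F0) \<le>
          norm (X r (y r) - X s (y r) - (r - s) *\<^sub>R v s (X s (y r))) + norm ((r - s) *\<^sub>R (v s (X s (y r)) - F0))"
        using norm_triangle_ineq[of "X r (y r) - X s (y r) - (r - s) *\<^sub>R v s (X s (y r))" "(r - s) *\<^sub>R (v s (X s (y r)) - F0)"]
        by (simp add: algebra_simps)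
      ultimately show "norm (X r (y r) - X s (y r) - (X s (y s) - X s (y s)) - (r - s) *\<^sub>R F0) \<le> e * norm (r - s)"
        by (simp add: algebra_simps)
    qed
  qed
  have "((\<lambda>r. I r - (X r (y r) - X s (y r))) has_vector_derivative I' - F0) (at s)"
    by (intro has_vector_derivative_diff I \<rho>)
  moreover have "\<forall>\<^sub>F r in nhds s. r \<in> {0<..<1}" using s by (intro eventually_nhds_in_open) auto
  then have "\<forall>\<^sub>F r in nhds s. I r - (X r (y r) - X s (y r)) = X s (y r)"
    by eventually_elim (simp add: y_def)
  ultimately have z: "((\<lambda>r. X s (y r)) has_vector_derivative I' - F0) (at s)"
    by (subst has_vector_derivative_cong_ev[symmetric, where f = "\<lambda>r. I r - (X r (y r) - X s (y r))"])
       (auto elim!: eventually_mono simp: Xy)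
  have "((\<lambda>z. g (Xi s z)) has_derivative \<phi>') (at (X s (y s)))" using g Xy by simp
  from has_derivative_compose[OF z[unfolded has_vector_derivative_def] this]
  have "((\<lambda>r. g (y r)) has_derivative (\<lambda>h. \<phi>' (h *\<^sub>R (I' - F0)))) (at s)"
    using s by simp
  moreover have "linear \<phi>'" by (rule has_derivative_linear[OF g])
  ultimately show ?thesis
    by (simp add: has_vector_derivative_def y_def F0_def linear_scale)
qed

text \<open>Provides the domination for differentiating expectations of pulled-back paths: the
  Lipschitz constant in time is affine in the size of the path, hence integrable.\<close>

lemma pulled_back_path_lipschitz:
  assumes T: "0 \<le> T" "T < 1"
  obtains C where "0 \<le> C"
    "\<And>r s I. r \<in> {0..T} \<Longrightarrow> s \<in> {0..T} \<Longrightarrow>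
      norm (Xi r (I r) - Xi s (I s)) \<le> E * norm (I r - I s) + C * (1 + norm (I s)) * \<bar>r - s\<bar>"
proof -
  obtain C where C: "0 \<le> C"
    "\<And>r s x. r \<in> {0..T} \<Longrightarrow> s \<in> {0..T} \<Longrightarrow> norm (X r x - X s x) \<le> C * (1 + norm (X s x)) * \<bar>r - s\<bar>"
    using X_time_lip[OF T] by blast
  show thesis
  proof (rule that[of "E * C"])
    show "0 \<le> E * C" using C E_pos by simp
    fix r s and I :: "real \<Rightarrow> 'a" assume rs: "r \<in> {0..T}" "s \<in> {0..T}"
    then have rs': "r \<in> {0..1}" "s \<in> {0..1}" using T by auto
    have "norm (Xi r (I r) - Xi s (I s)) \<le> E * norm (I r - X r (Xi s (I s)))"
      using X_lower[OF rs'(1), of "Xi r (I r)" "Xi s (I s)"] rs' by simp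
    also have "norm (I r - X r (Xi s (I s))) \<le> norm (I r - I s) + norm (X r (Xi s (I s)) - X s (Xi s (I s)))"
      using norm_triangle_ineq4[of "I r - I s" "X r (Xi s (I s)) - X s (Xi s (I s))"] rs' by simp
    also have "\<dots> \<le> norm (I r - I s) + C * (1 + norm (I s)) * \<bar>r - s\<bar>"
      using C(2)[OF rs, of "Xi s (I s)"] rs' by simp
    finally show "norm (Xi r (I r) - Xi s (I s)) \<le> E * norm (I r - I s) + E * C * (1 + norm (I s)) * \<bar>r - s\<bar>"
      using E_pos by (simp add: algebra_simps)
  qed
qed

end

section \<open>Gaussian smoothing of a measure\<close>

text \<open>The local Lipschitz constant \<open>B y\<close> also bounds the pointwise derivative, so
  the normalised remainder is dominated by \<open>2 * B y\<close>; dominated convergence along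
  sequences then gives the Frechet derivative at once, without partial derivatives.\<close>

lemma has_derivative_lebesgue_integral:
  fixes f :: "'a::euclidean_space \<Rightarrow> 'y \<Rightarrow> 'c::{banach, second_countable_topology}"
  assumes d: "\<delta> > 0"
    and int: "\<And>z. norm (z - x) < \<delta> \<Longrightarrow> integrable M (f z)"
    and f': "\<And>y. y \<in> space M \<Longrightarrow> ((\<lambda>z. f z y) has_derivative f' y) (at x)"
    and lip: "\<And>y z. y \<in> space M \<Longrightarrow> norm (z - x) < \<delta> \<Longrightarrow> norm (f z y - f x y) \<le> B y * norm (z - x)"
    and intB: "integrable M B"
    and meas: "\<And>h. (\<lambda>y. f' y h) \<in> borel_measurable M"
  shows "((\<lambda>z. \<integral>y. f z y \<partial>M) has_derivative (\<lambda>h. \<integral>y. f' y h \<partial>M)) (at x)"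
proof -
  have bnd: "norm (f' y h) \<le> B y * norm h" if "y \<in> space M" for y h
    by (rule has_derivative_norm_le[OF f'[OF that]])
       (use lip[OF that] d in \<open>auto simp: eventually_nhds_metric dist_norm\<close>)
  have I: "integrable M (\<lambda>y. f' y h)" for h
    by (rule Bochner_Integration.integrable_bound[OF integrable_mult_left[OF intB, of "norm h"]])
       (use bnd in \<open>auto intro!: meas AE_I2 order_trans[OF _ abs_ge_self]\<close>)
  have lin: "linear (f' y)" if "y \<in> space M" for y using has_derivative_linear[OF f'[OF that]] .
  have "linear (\<lambda>h. \<integral>y. f' y h \<partial>M)"
  proof (rule linearI)
    show "(\<integral>y. f' y (h + k) \<partial>M) = (\<integral>y. f' y h \<partial>M) + (\<integral>y. f' y k \<partial>M)" for h k
      by (subst Bochner_Integration.integral_add[OF I I, symmetric])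
         (auto intro!: Bochner_Integration.integral_cong linear_add lin)
    show "(\<integral>y. f' y (c *\<^sub>R h) \<partial>M) = c *\<^sub>R (\<integral>y. f' y h \<partial>M)" for c h
      by (subst integral_scaleR_right[symmetric])
         (auto intro!: Bochner_Integration.integral_cong linear_scale lin simp del: integral_scaleR_right)
  qed
  moreover have "((\<lambda>h. norm ((\<integral>y. f (x + h) y \<partial>M) - (\<integral>y. f x y \<partial>M) - (\<integral>y. f' y h \<partial>M)) / norm h) \<longlongrightarrow> 0)
      (at 0 within ball 0 \<delta>)"
    unfolding tendsto_at_iff_sequentially o_def
  proof (intro allI impI)
    fix h :: "nat \<Rightarrow> 'a" assume h: "\<forall>i. h i \<in> ball 0 \<delta> - {0}" and h0: "h \<longlonglongrightarrow> 0"
    have hn: "norm (h n) < \<delta>" "h n \<noteq> 0" for n using h by auto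
    define q where "q = (\<lambda>n y. norm (f (x + h n) y - f x y - f' y (h n)) / norm (h n))"
    have mf: "f (x + h n) \<in> borel_measurable M" "f x \<in> borel_measurable M" for n
      using int[of "x + h n"] int[of x] hn d by auto
    have "(\<lambda>n. \<integral>y. q n y \<partial>M) \<longlonglongrightarrow> (\<integral>y. 0 \<partial>M)"
    proof (rule integral_dominated_convergence)
      show "integrable M (\<lambda>y. 2 * B y)" using intB by simp
      show "q n \<in> borel_measurable M" for n unfolding q_def
        using mf(1)[of n] mf(2) meas[of "h n"] by measurable
      show "AE y in M. (\<lambda>n. q n y) \<longlonglongrightarrow> 0"
      proof (rule AE_I2)
        fix y assume y: "y \<in> space M"
        have "((\<lambda>h. norm (f (x + h) y - f x y - f' y h) / norm h) \<longlongrightarrow> 0) (at 0)"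
          using f'[OF y] unfolding has_derivative_at by blast
        then show "(\<lambda>n. q n y) \<longlonglongrightarrow> 0"
          unfolding tendsto_at_iff_sequentially q_def o_def using hn h0 by blast
      qed
      show "AE y in M. norm (q n y) \<le> 2 * B y" for n
      proof (rule AE_I2)
        fix y assume y: "y \<in> space M"
        have "norm (f (x + h n) y - f x y - f' y (h n)) \<le> B y * norm (h n) + B y * norm (h n)"
          using lip[OF y, of "x + h n"] bnd[OF y, of "h n"] hn(1)[of n]
            norm_triangle_ineq4[of "f (x + h n) y - f x y" "f' y (h n)"]
          by auto
        then show "norm (q n y) \<le> 2 * B y" using hn(2)[of n] by (simp add: q_def divide_simps)
      qed
    qed auto
    then have l: "(\<lambda>n. \<integral>y. q n y \<partial>M) \<longlonglongrightarrow> 0" by simp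
    show "(\<lambda>n. norm ((\<integral>y. f (x + h n) y \<partial>M) - (\<integral>y. f x y \<partial>M) - (\<integral>y. f' y (h n) \<partial>M)) / norm (h n)) \<longlonglongrightarrow> 0"
    proof (rule Lim_null_comparison[OF always_eventually l], rule allI)
      fix n
      have ii: "integrable M (f (x + h n))" "integrable M (f x)" using int hn d by auto
      have "(\<integral>y. f (x + h n) y \<partial>M) - (\<integral>y. f x y \<partial>M) - (\<integral>y. f' y (h n) \<partial>M)
          = (\<integral>y. f (x + h n) y - f x y - f' y (h n) \<partial>M)"
        using ii I by simp
      also have "norm \<dots> \<le> (\<integral>y. norm (f (x + h n) y - f x y - f' y (h n)) \<partial>M)"
        by (rule integral_norm_bound)
      also have "\<dots> = norm (h n) * (\<integral>y. q n y \<partial>M)"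
        unfolding q_def using hn by simp
      finally show "norm (norm ((\<integral>y. f (x + h n) y \<partial>M) - (\<integral>y. f x y \<partial>M) - (\<integral>y. f' y (h n) \<partial>M)) / norm (h n))
          \<le> (\<integral>y. q n y \<partial>M)"
        using hn(2)[of n] by (simp add: divide_simps mult.commute)
    qed
  qed
  ultimately show "((\<lambda>z. \<integral>y. f z y \<partial>M) has_derivative (\<lambda>h. \<integral>y. f' y h \<partial>M)) (at x)"
    using d by (simp add: has_derivative_at linear_conv_bounded_linear at_within_open[of 0 "ball 0 \<delta>"])
qed

text \<open>The Gaussian likelihood of observing x = a Z + b y. The normalising factor is omitted:
  it cancels in conditional expectations, and without it the kernel is at most 1.\<close>

definition gk :: "real \<Rightarrow> real \<Rightarrow> 'a::euclidean_space \<Rightarrow> 'a \<Rightarrow> real" where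
  "gk a b x y = exp (- (norm (x - b *\<^sub>R y))\<^sup>2 / (2 * a\<^sup>2))"

lemma gk_pos: "0 < gk a b x y" and gk_le1: "gk a b x y \<le> 1"
  by (simp_all add: gk_def)

lemma gk_abs [simp]: "\<bar>gk a b x y\<bar> = gk a b x y"
  by (simp add: gk_def)

lemma gk_measurable [measurable]: "gk a b x \<in> borel_measurable borel"
  unfolding gk_def by measurable

lemma gk_deriv: "a > 0 \<Longrightarrow> ((\<lambda>x. gk a b x y) has_derivative
    (\<lambda>h. - ((x - b *\<^sub>R y) \<bullet> h) / a\<^sup>2 * gk a b x y)) (at x)"
  unfolding gk_def power2_norm_eq_inner
  by (auto intro!: derivative_eq_intros simp: inner_commute field_simps)

text \<open>With r = |x - b y| / a the bound reduces to r exp (- r^2 / 2) <= 1, uniformly in x and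
  y. Hence the kernel is globally Lipschitz in x.\<close>

lemma gk_deriv_bound:
  assumes "a > 0"
  shows "norm (- ((x - b *\<^sub>R y) \<bullet> h) / a\<^sup>2 * gk a b x y) \<le> 1 / a * norm h"
proof -
  define r where "r = norm (x - b *\<^sub>R y) / a"
  have "r \<le> 1 + r\<^sup>2 / 2" using sum_squares_bound[of r 1] by simp
  also have "\<dots> \<le> exp (r\<^sup>2 / 2)" by simp
  finally have "r * exp (- (r\<^sup>2 / 2)) \<le> 1" by (simp add: exp_minus divide_simps)
  moreover have "gk a b x y = exp (- (r\<^sup>2 / 2))"
    using assms by (simp add: gk_def r_def power_divide)
  ultimately have r: "r * gk a b x y \<le> 1" by simp
  have "norm (- ((x - b *\<^sub>R y) \<bullet> h) / a\<^sup>2 * gk a b x y) = \<bar>(x - b *\<^sub>R y) \<bullet> h\<bar> / a\<^sup>2 * gk a b x y"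
    using gk_pos[of a b x y] by (simp add: abs_mult)
  also have "\<dots> \<le> (norm (x - b *\<^sub>R y) * norm h) / a\<^sup>2 * gk a b x y"
    using gk_pos[of a b x y] by (intro mult_right_mono divide_right_mono Cauchy_Schwarz_ineq2) auto
  also have "\<dots> = (r * gk a b x y) * norm h / a"
    using assms by (simp add: r_def power2_eq_square)
  also have "\<dots> \<le> 1 * norm h / a"
    using assms r by (intro divide_right_mono mult_right_mono) auto
  finally show ?thesis by simp
qed

lemma gk_lipschitz:
  assumes "a > 0"
  shows "norm (gk a b z y - gk a b x y) \<le> 1 / a * norm (z - x)"
proof (rule differentiable_bound[where S = UNIV and f' = "\<lambda>x h. - ((x - b *\<^sub>R y) \<bullet> h) / a\<^sup>2 * gk a b x y"])
  show "((\<lambda>x. gk a b x y) has_derivative (\<lambda>h. - ((w - b *\<^sub>R y) \<bullet> h) / a\<^sup>2 * gk a b w y)) (at w within UNIV)" for w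
    by (rule has_derivative_at_withinI[OF gk_deriv[OF assms]])
  show "onorm (\<lambda>h. - ((w - b *\<^sub>R y) \<bullet> h) / a\<^sup>2 * gk a b w y) \<le> 1 / a" for w
    by (rule onorm_bound[OF _ gk_deriv_bound[OF assms]]) (use assms in simp)
qed auto

text \<open>No density is asked for here, so that the locale also applies to the mixing measure of a
  Gaussian mixture, which may be singular.\<close>

locale gauss_smoothing = prob_space \<nu> for \<nu> :: "'a::euclidean_space measure" +
  assumes sets_nu [measurable_cong, simp]: "sets \<nu> = sets borel"
    and moment2: "integrable \<nu> (\<lambda>y. (norm y)\<^sup>2)"
begin

lemma space_nu [simp]: "space \<nu> = UNIV"
  using sets_eq_imp_space_eq[OF sets_nu] by simp

lemma moment1: "integrable \<nu> (\<lambda>y. norm y)"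
proof (rule Bochner_Integration.integrable_bound)
  show "integrable \<nu> (\<lambda>y. 1 + (norm y)\<^sup>2)" using moment2 by simp
  have "norm y \<le> 1 + (norm y)\<^sup>2" for y :: 'a
    using sum_squares_bound[of "norm y" 1] by (simp add: power2_eq_square) (use norm_ge_zero[of y] in linarith)
  then show "AE y in \<nu>. norm (norm y) \<le> norm (1 + (norm y)\<^sup>2)" by simp
qed measurable

lemma integrable_id: "integrable \<nu> (\<lambda>y. y)"
  using moment1 by (rule Bochner_Integration.integrable_bound) auto

lemma integrable_inner_scaleR_id: "integrable \<nu> (\<lambda>y. (y \<bullet> h) *\<^sub>R y)"
proof (rule Bochner_Integration.integrable_bound[OF integrable_mult_right[OF moment2, of "norm h"]])
  have "\<bar>y \<bullet> h\<bar> * norm y \<le> (norm y * norm h) * norm y" for y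
    by (intro mult_right_mono Cauchy_Schwarz_ineq2) auto
  then show "AE y in \<nu>. norm ((y \<bullet> h) *\<^sub>R y) \<le> norm (norm h * (norm y)\<^sup>2)"
    by (simp add: power2_eq_square ac_simps)
qed measurable

definition GI :: "real \<Rightarrow> real \<Rightarrow> 'a \<Rightarrow> ('a \<Rightarrow> 'c::{banach, second_countable_topology}) \<Rightarrow> 'c" where
  "GI a b x F = (\<integral>y. gk a b x y *\<^sub>R F y \<partial>\<nu>)"

abbreviation GN where "GN a b x \<equiv> GI a b x (\<lambda>_. 1::real)"

lemma integrable_gk:
  fixes F :: "'a \<Rightarrow> 'c::{banach, second_countable_topology}"
  assumes "integrable \<nu> F"
  shows "integrable \<nu> (\<lambda>y. gk a b x y *\<^sub>R F y)"
proof (rule Bochner_Integration.integrable_bound[OF assms])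
  show "AE y in \<nu>. norm (gk a b x y *\<^sub>R F y) \<le> norm (F y)"
    using gk_pos[of a b x, THEN less_imp_le] gk_le1[of a b x] by (auto intro!: AE_I2 mult_left_le_one_le)
qed (use assms in measurable)

lemma GI_continuous:
  fixes F :: "'a \<Rightarrow> 'c::{banach, second_countable_topology}"
  assumes F: "integrable \<nu> F"
  shows "continuous_on {p. 0 < fst p} (\<lambda>p. GI (fst p) (fst (snd p)) (snd (snd p)) F)"
  unfolding continuous_on_sequentially o_def
proof (intro allI ballI impI, elim conjE)
  fix p :: "nat \<Rightarrow> real \<times> real \<times> 'a" and q assume q: "q \<in> {p. 0 < fst p}" and lim: "p \<longlonglongrightarrow> q"
  have F': "F \<in> borel_measurable borel" using F by (simp add: borel_measurable_integrable measurable_cong_sets[OF sets_nu refl, symmetric])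
  show "(\<lambda>n. GI (fst (p n)) (fst (snd (p n))) (snd (snd (p n))) F) \<longlonglongrightarrow> GI (fst q) (fst (snd q)) (snd (snd q)) F"
    unfolding GI_def
  proof (rule integral_dominated_convergence)
    show "integrable \<nu> (\<lambda>y. norm (F y))" using F by simp
    show "AE y in \<nu>. (\<lambda>n. gk (fst (p n)) (fst (snd (p n))) (snd (snd (p n))) y *\<^sub>R F y) \<longlonglongrightarrow>
        gk (fst q) (fst (snd q)) (snd (snd q)) y *\<^sub>R F y"
      unfolding gk_def using q lim by (intro AE_I2 tendsto_intros) auto
    show "AE y in \<nu>. norm (gk (fst (p n)) (fst (snd (p n))) (snd (snd (p n))) y *\<^sub>R F y) \<le> norm (F y)" for n
      using gk_pos[THEN less_imp_le] gk_le1 by (auto intro!: AE_I2 mult_left_le_one_le)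
  qed (use F' in measurable)
qed

text \<open>The uniform Lipschitz bound 1/a of the kernel makes |F| / a a dominating function, so
  integrability of \<open>F\<close> alone suffices although the derivative contains y as a
  factor.\<close>

lemma GI_deriv:
  fixes F :: "'a \<Rightarrow> 'c::{banach, second_countable_topology}"
  assumes a: "a > 0" and F: "integrable \<nu> F"
  shows "((\<lambda>x. GI a b x F) has_derivative
      (\<lambda>h. GI a b x (\<lambda>y. (- ((x - b *\<^sub>R y) \<bullet> h) / a\<^sup>2) *\<^sub>R F y))) (at x)"
proof -
  have F': "F \<in> borel_measurable borel" using F by (simp add: borel_measurable_integrable measurable_cong_sets[OF sets_nu refl, symmetric])
  have "((\<lambda>x. \<integral>y. gk a b x y *\<^sub>R F y \<partial>\<nu>) has_derivative
      (\<lambda>h. \<integral>y. (- ((x - b *\<^sub>R y) \<bullet> h) / a\<^sup>2 * gk a b x y) *\<^sub>R F y \<partial>\<nu>)) (at x)"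
  proof (rule has_derivative_lebesgue_integral[where \<delta> = 1 and B = "\<lambda>y. 1 / a * norm (F y)"])
    show "((\<lambda>z. gk a b z y *\<^sub>R F y) has_derivative
        (\<lambda>h. (- ((x - b *\<^sub>R y) \<bullet> h) / a\<^sup>2 * gk a b x y) *\<^sub>R F y)) (at x)" for y
      by (rule bounded_linear.has_derivative[OF bounded_linear_scaleR_left gk_deriv[OF a]])
    fix y z
    have "norm (gk a b z y *\<^sub>R F y - gk a b x y *\<^sub>R F y) = norm (gk a b z y - gk a b x y) * norm (F y)"
      by (simp add: scaleR_diff_left[symmetric])
    also have "\<dots> \<le> (1 / a * norm (z - x)) * norm (F y)"
      by (intro mult_right_mono gk_lipschitz a) auto
    finally show "norm (gk a b z y *\<^sub>R F y - gk a b x y *\<^sub>R F y) \<le> 1 / a * norm (F y) * norm (z - x)"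
      by (simp add: ac_simps)
  next
    show "(\<lambda>y. (- ((x - b *\<^sub>R y) \<bullet> h) / a\<^sup>2 * gk a b x y) *\<^sub>R F y) \<in> borel_measurable \<nu>" for h
      using F' by measurable
  qed (use integrable_gk[OF F] F in auto)
  then show ?thesis by (simp add: GI_def mult.commute)
qed

lemma GN_pos: "0 < GN a b x"
proof -
  have "integrable \<nu> (\<lambda>y. gk a b x y)" using integrable_gk[of "\<lambda>_. 1::real" a b x] by simp
  then show ?thesis unfolding GI_def
    using integral_less_AE_space[of "\<lambda>_. 0" "\<lambda>y. gk a b x y"] gk_pos[of a b x] emeasure_space_1 by simp
qed

text \<open>Bayes' formula: the posterior law of y under the prior \<nu> and the observation
  x.\<close>

definition post :: "real \<Rightarrow> real \<Rightarrow> 'a \<Rightarrow> 'a measure" where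
  "post a b x = density \<nu> (\<lambda>y. ennreal (gk a b x y / GN a b x))"

lemma sets_post [measurable_cong, simp]: "sets (post a b x) = sets borel"
  and space_post [simp]: "space (post a b x) = UNIV"
  by (simp_all add: post_def)

lemma post_integral:
  fixes F :: "'a \<Rightarrow> 'c::{banach, second_countable_topology}"
  assumes "F \<in> borel_measurable borel"
  shows "(\<integral>y. F y \<partial>post a b x) = GI a b x F /\<^sub>R GN a b x"
proof -
  have "(\<integral>y. F y \<partial>post a b x) = (\<integral>y. (gk a b x y / GN a b x) *\<^sub>R F y \<partial>\<nu>)"
    unfolding post_def using assms gk_pos[of a b x] GN_pos[of a b x]
    by (intro integral_density) (auto intro!: AE_I2 divide_nonneg_pos less_imp_le)
  also have "\<dots> = (\<integral>y. (1 / GN a b x) *\<^sub>R (gk a b x y *\<^sub>R F y) \<partial>\<nu>)" by simp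
  also have "\<dots> = (1 / GN a b x) *\<^sub>R GI a b x F"
    unfolding GI_def by (rule integral_scaleR_right)
  finally show ?thesis by (simp add: divide_inverse)
qed

lemma post_integrable:
  fixes F :: "'a \<Rightarrow> 'c::{banach, second_countable_topology}"
  assumes F: "integrable \<nu> F"
  shows "integrable (post a b x) F"
proof -
  have F': "F \<in> borel_measurable borel" using F by (simp add: borel_measurable_integrable measurable_cong_sets[OF sets_nu refl, symmetric])
  have "integrable \<nu> (\<lambda>y. (1 / GN a b x) *\<^sub>R (gk a b x y *\<^sub>R F y))"
    by (intro integrable_scaleR_right integrable_gk F)
  then show ?thesis
    unfolding post_def using F' gk_pos[of a b x] GN_pos[of a b x]
    by (subst integrable_density) (auto intro!: AE_I2 divide_nonneg_pos less_imp_le)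
qed

lemma prob_space_post: "prob_space (post a b x)"
proof (rule prob_spaceI)
  have i: "integrable \<nu> (\<lambda>y. gk a b x y / GN a b x)"
    using integrable_gk[of "\<lambda>_. 1::real" a b x] by simp
  have "emeasure (post a b x) UNIV = (\<integral>\<^sup>+y. ennreal (gk a b x y / GN a b x) \<partial>\<nu>)"
    unfolding post_def by (subst emeasure_density) auto
  also have "\<dots> = ennreal (\<integral>y. gk a b x y / GN a b x \<partial>\<nu>)"
    using gk_pos[of a b x] GN_pos[of a b x]
    by (intro nn_integral_eq_integral i) (auto intro!: AE_I2 divide_nonneg_pos less_imp_le)
  also have "(\<integral>y. gk a b x y / GN a b x \<partial>\<nu>) = 1"
    using GN_pos[of a b x] by (simp add: GI_def)
  finally show "emeasure (post a b x) (space (post a b x)) = 1" by simp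
qed

definition pmean where "pmean a b x = (\<integral>y. y \<partial>post a b x)"

lemma pmean_GI: "pmean a b x = GI a b x (\<lambda>y. y) /\<^sub>R GN a b x"
  unfolding pmean_def by (rule post_integral) simp

lemma integral_gk_inner: "(\<integral>y. gk a b x y * (y \<bullet> h) \<partial>\<nu>) = GN a b x * (pmean a b x \<bullet> h)"
proof -
  have "GN a b x * (pmean a b x \<bullet> h) = GI a b x (\<lambda>y. y) \<bullet> h"
    unfolding pmean_GI using GN_pos[of a b x] by simp
  also have "\<dots> = (\<integral>y. (gk a b x y *\<^sub>R y) \<bullet> h \<partial>\<nu>)"
    unfolding GI_def using integrable_gk[OF integrable_id] by (subst integral_inner_left) auto
  finally show ?thesis by simp
qed

definition pcov where "pcov a b x h = (\<integral>y. (y \<bullet> h) *\<^sub>R y \<partial>post a b x) - (pmean a b x \<bullet> h) *\<^sub>R pmean a b x"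

text \<open>This is the trace of the covariance operator \<open>pcov\<close> (see
  \<open>pvar_eq\<close>) and serves as a bound for its norm.\<close>

definition pvar where "pvar a b x = (\<integral>y. (norm (y - pmean a b x))\<^sup>2 \<partial>post a b x)"

text \<open>Differentiating the kernel brings down - (x - b y) \<bullet> h / a^2, and the quotient
  rule subtracts the posterior mean of this factor. The part with x cancels, which leaves b/a^2
  times the posterior covariance of y \<bullet> h and F.\<close>

lemma post_integral_deriv:
  fixes F :: "'a \<Rightarrow> 'c::{banach, second_countable_topology}"
  assumes a: "a > 0" and F: "integrable \<nu> F" and yF: "\<And>h. integrable \<nu> (\<lambda>y. (y \<bullet> h) *\<^sub>R F y)"
  shows "((\<lambda>x. \<integral>y. F y \<partial>post a b x) has_derivative
      (\<lambda>h. (b / a\<^sup>2) *\<^sub>R ((\<integral>y. (y \<bullet> h) *\<^sub>R F y \<partial>post a b x) - (pmean a b x \<bullet> h) *\<^sub>R (\<integral>y. F y \<partial>post a b x)))) (at x)"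
proof -
  have F': "F \<in> borel_measurable borel" using F by (simp add: borel_measurable_integrable measurable_cong_sets[OF sets_nu refl, symmetric])
  have N: "GN a b x \<noteq> 0" using GN_pos[of a b x] by simp
  have split: "GI a b x (\<lambda>y. (- ((x - b *\<^sub>R y) \<bullet> h) / a\<^sup>2) *\<^sub>R H y)
      = (b / a\<^sup>2) *\<^sub>R GI a b x (\<lambda>y. (y \<bullet> h) *\<^sub>R H y) - ((x \<bullet> h) / a\<^sup>2) *\<^sub>R GI a b x H"
    if H: "integrable \<nu> H" "integrable \<nu> (\<lambda>y. (y \<bullet> h) *\<^sub>R H y)" for h and H :: "'a \<Rightarrow> 'd::{banach, second_countable_topology}"
  proof -
    have "GI a b x (\<lambda>y. (- ((x - b *\<^sub>R y) \<bullet> h) / a\<^sup>2) *\<^sub>R H y)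
      = (\<integral>y. (b / a\<^sup>2) *\<^sub>R (gk a b x y *\<^sub>R ((y \<bullet> h) *\<^sub>R H y)) - ((x \<bullet> h) / a\<^sup>2) *\<^sub>R (gk a b x y *\<^sub>R H y) \<partial>\<nu>)"
      unfolding GI_def
      by (intro Bochner_Integration.integral_cong)
         (auto simp: inner_diff_left diff_divide_distrib scaleR_diff_left algebra_simps)
    also have "\<dots> = (b / a\<^sup>2) *\<^sub>R GI a b x (\<lambda>y. (y \<bullet> h) *\<^sub>R H y) - ((x \<bullet> h) / a\<^sup>2) *\<^sub>R GI a b x H"
      unfolding GI_def using integrable_gk[OF H(1)] integrable_gk[OF H(2)]
      by (subst Bochner_Integration.integral_diff)
         (auto intro!: integrable_scaleR_right simp del: scaleR_scaleR)
    finally show ?thesis .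
  qed
  have y1: "integrable \<nu> (\<lambda>y. (y \<bullet> h) *\<^sub>R (1::real))" for h
    using integrable_id by (simp add: integrable_inner_left)
  have m: "GI a b x (\<lambda>y. (y \<bullet> h) *\<^sub>R (1::real)) = GN a b x * (pmean a b x \<bullet> h)" for h
    using integral_gk_inner[of a b x h] by (simp add: GI_def)
  have pF: "(\<lambda>x. \<integral>y. F y \<partial>post a b x) = (\<lambda>x. GI a b x F /\<^sub>R GN a b x)"
    using post_integral[OF F'] by simp
  have pyF: "(\<integral>y. (y \<bullet> h) *\<^sub>R F y \<partial>post a b x) = GI a b x (\<lambda>y. (y \<bullet> h) *\<^sub>R F y) /\<^sub>R GN a b x" for h
    by (rule post_integral) (use F' in measurable)
  have d1: "((\<lambda>x. GI a b x F) has_derivative (\<lambda>h. (b / a\<^sup>2) *\<^sub>R GI a b x (\<lambda>y. (y \<bullet> h) *\<^sub>R F y) - ((x \<bullet> h) / a\<^sup>2) *\<^sub>R GI a b x F)) (at x)"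
    using GI_deriv[OF a F, of b x] split[OF F yF] by simp
  have d2: "((\<lambda>x. GN a b x) has_derivative (\<lambda>h. (b / a\<^sup>2) * (GN a b x * (pmean a b x \<bullet> h)) - ((x \<bullet> h) / a\<^sup>2) * GN a b x)) (at x)"
    using GI_deriv[OF a, of "\<lambda>_. 1::real" b x] split[OF _ y1, of] m by simp
  have "((\<lambda>x. GI a b x F /\<^sub>R GN a b x) has_derivative
     (\<lambda>h. inverse (GN a b x) *\<^sub>R ((b / a\<^sup>2) *\<^sub>R GI a b x (\<lambda>y. (y \<bullet> h) *\<^sub>R F y) - ((x \<bullet> h) / a\<^sup>2) *\<^sub>R GI a b x F)
       + (- (inverse (GN a b x) * ((b / a\<^sup>2) * (GN a b x * (pmean a b x \<bullet> h)) - ((x \<bullet> h) / a\<^sup>2) * GN a b x) * inverse (GN a b x))) *\<^sub>R GI a b x F)) (at x)"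
    by (rule has_derivative_scaleR[OF Deriv.has_derivative_inverse[OF N d2] d1])
  then have "((\<lambda>x. \<integral>y. F y \<partial>post a b x) has_derivative
     (\<lambda>h. inverse (GN a b x) *\<^sub>R ((b / a\<^sup>2) *\<^sub>R GI a b x (\<lambda>y. (y \<bullet> h) *\<^sub>R F y) - ((x \<bullet> h) / a\<^sup>2) *\<^sub>R GI a b x F)
       + (- (inverse (GN a b x) * ((b / a\<^sup>2) * (GN a b x * (pmean a b x \<bullet> h)) - ((x \<bullet> h) / a\<^sup>2) * GN a b x) * inverse (GN a b x))) *\<^sub>R GI a b x F)) (at x)"
    unfolding pF .
  then show ?thesis
  proof (rule has_derivative_eq_rhs, intro ext)
    fix h
    have e: "inverse (GN a b x) * ((b / a\<^sup>2) * (GN a b x * (pmean a b x \<bullet> h)) - ((x \<bullet> h) / a\<^sup>2) * GN a b x) * inverse (GN a b x)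
      = inverse (GN a b x) * ((b / a\<^sup>2) * (pmean a b x \<bullet> h) - (x \<bullet> h) / a\<^sup>2)"
      using N by (simp add: field_simps)
    show "inverse (GN a b x) *\<^sub>R ((b / a\<^sup>2) *\<^sub>R GI a b x (\<lambda>y. (y \<bullet> h) *\<^sub>R F y) - ((x \<bullet> h) / a\<^sup>2) *\<^sub>R GI a b x F)
       + (- (inverse (GN a b x) * ((b / a\<^sup>2) * (GN a b x * (pmean a b x \<bullet> h)) - ((x \<bullet> h) / a\<^sup>2) * GN a b x) * inverse (GN a b x))) *\<^sub>R GI a b x F
      = (b / a\<^sup>2) *\<^sub>R ((\<integral>y. (y \<bullet> h) *\<^sub>R F y \<partial>post a b x) - (pmean a b x \<bullet> h) *\<^sub>R (\<integral>y. F y \<partial>post a b x))"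
      unfolding e pyF post_integral[OF F']
      by (simp add: scaleR_diff_right scaleR_diff_left algebra_simps)
  qed
qed

lemma pmean_deriv: "a > 0 \<Longrightarrow> (pmean a b has_derivative (\<lambda>h. (b / a\<^sup>2) *\<^sub>R pcov a b x h)) (at x)"
  unfolding pmean_def[abs_def] pcov_def
  using post_integral_deriv[OF _ integrable_id integrable_inner_scaleR_id, of a b x]
  by (simp add: pmean_def)

text \<open>Tweedie's formula for the score of the smoothed density. It supplies the gradient of the
  potential of a Gaussian mixture.\<close>

lemma ln_GN_deriv:
  assumes a: "a > 0"
  shows "((\<lambda>x. ln (GN a b x)) has_derivative (\<lambda>h. - ((x - b *\<^sub>R pmean a b x) \<bullet> h) / a\<^sup>2)) (at x)"
proof -
  have i: "integrable \<nu> (\<lambda>y. gk a b x y * (y \<bullet> h))" "integrable \<nu> (\<lambda>y. gk a b x y)" for h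
    using integrable_gk[of "\<lambda>y. y \<bullet> h"] integrable_gk[of "\<lambda>_. 1::real" a b x] integrable_id
    by (auto simp: integrable_inner_left)
  have N: "GN a b x > 0" by (rule GN_pos)
  note m = integral_gk_inner[of a b x]
  have "GI a b x (\<lambda>y. (- ((x - b *\<^sub>R y) \<bullet> h) / a\<^sup>2) *\<^sub>R (1::real))
      = (\<integral>y. (b / a\<^sup>2) * (gk a b x y * (y \<bullet> h)) - ((x \<bullet> h) / a\<^sup>2) * gk a b x y \<partial>\<nu>)" for h
    unfolding GI_def
    by (intro Bochner_Integration.integral_cong) (auto simp: inner_diff_left diff_divide_distrib algebra_simps)
  also have "\<dots> h = (b / a\<^sup>2) * (GN a b x * (pmean a b x \<bullet> h)) - ((x \<bullet> h) / a\<^sup>2) * GN a b x" for h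
    using i by (subst Bochner_Integration.integral_diff) (auto simp: m, simp add: GI_def)
  finally have d: "(GN a b has_derivative (\<lambda>h. (b / a\<^sup>2) * (GN a b x * (pmean a b x \<bullet> h)) - ((x \<bullet> h) / a\<^sup>2) * GN a b x)) (at x)"
    using GI_deriv[OF a, of "\<lambda>_. 1::real" b x] by simp
  show ?thesis
    by (rule has_derivative_eq_rhs[OF has_derivative_ln[OF N d]])
       (use N a in \<open>auto simp: field_simps inner_diff_left fun_eq_iff\<close>)
qed

end

section \<open>Measures with a smooth potential\<close>

lemma integrable_exp_neg_norm_sq:
  assumes c: "c > 0"
  shows "integrable lborel (\<lambda>y::'a::euclidean_space. exp (- c * (norm y)\<^sup>2))"
proof (rule integrableI_nonneg)
  define s where "s = sqrt (1 / (2 * c))"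
  have s: "s > 0" "2 * s\<^sup>2 = 1 / c" using c by (simp_all add: s_def)
  have e: "exp (- c * r\<^sup>2) = sqrt (2 * pi * s\<^sup>2) * normal_density 0 s r" for r
    using s c by (simp add: normal_density_def)
  have i: "integrable lborel (\<lambda>r::real. exp (- c * r\<^sup>2))"
    unfolding e using integrable_normal_density[OF s(1)] by simp
  have "(norm y)\<^sup>2 = (\<Sum>b\<in>Basis. (y \<bullet> b)\<^sup>2)" for y :: 'a
    unfolding power2_norm_eq_inner by (subst euclidean_inner) (simp add: power2_eq_square)
  then have p: "exp (- c * (norm y)\<^sup>2) = (\<Prod>b\<in>Basis. exp (- c * (y \<bullet> b)\<^sup>2))" for y :: 'a
    by (simp add: exp_sum[symmetric] sum_distrib_left sum_negf)
  have "(\<integral>\<^sup>+y. ennreal (exp (- c * (norm (y :: 'a))\<^sup>2)) \<partial>lborel)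
      = (\<integral>\<^sup>+y. (\<Prod>b\<in>Basis. ennreal (exp (- c * ((y :: 'a) \<bullet> b)\<^sup>2))) \<partial>lborel)"
    unfolding p by (simp add: prod_ennreal)
  also have "\<dots> = (\<Prod>b\<in>(Basis::'a set). (\<integral>\<^sup>+r. ennreal (exp (- c * r\<^sup>2)) \<partial>lborel))"
    by (rule nn_integral_lborel_prod) auto
  also have "\<dots> = (\<Prod>b\<in>(Basis::'a set). ennreal (\<integral>r. exp (- c * r\<^sup>2) \<partial>lborel))"
    by (subst nn_integral_eq_integral[OF i]) auto
  also have "\<dots> < \<infinity>" by (simp add: power_eq_top_ennreal less_top[symmetric])
  finally show "(\<integral>\<^sup>+y. ennreal (exp (- c * (norm (y :: 'a))\<^sup>2)) \<partial>lborel) < \<infinity>" .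
qed auto

text \<open>Half of the Gaussian decay is spent on the quadratic factor, using 1 + z <= exp z with z
  = c r^2 / 2; the constant 1 + 2/c makes (1 + 2/c)(1 + c r^2 / 2) dominate 1 + r^2.\<close>

lemma quadratic_times_exp_le:
  fixes c r :: real
  assumes "c > 0"
  shows "(1 + r\<^sup>2) * exp (- c * r\<^sup>2) \<le> (1 + 2 / c) * exp (- (c / 2) * r\<^sup>2)"
proof -
  have "1 + r\<^sup>2 \<le> (1 + 2 / c) * (1 + c / 2 * r\<^sup>2)"
    using assms by (simp add: field_simps)
  also have "\<dots> \<le> (1 + 2 / c) * exp (c / 2 * r\<^sup>2)"
    using assms by (intro mult_left_mono exp_ge_add_one_self) auto
  finally have "(1 + r\<^sup>2) * exp (- c * r\<^sup>2) \<le> (1 + 2 / c) * exp (c / 2 * r\<^sup>2) * exp (- c * r\<^sup>2)"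
    by (intro mult_right_mono) auto
  also have "\<dots> = (1 + 2 / c) * exp (- (c / 2) * r\<^sup>2)"
    by (simp add: mult.assoc mult_exp_exp algebra_simps)
  finally show ?thesis .
qed

lemma linear_growth_times: 
  fixes p q r s t :: real
  assumes "0 \<le> p" "0 \<le> q" "0 \<le> r" "t \<le> p + q * r" 
  shows "t \<le> (p + q) * (1 + r\<^sup>2)" "t * r \<le> (p + q) * (1 + r\<^sup>2)"
proof -
  have r: "r \<le> 1 + r\<^sup>2" "0 \<le> r\<^sup>2"
    using sum_squares_bound[of r 1] by (auto simp: power2_eq_square) (use assms in linarith)
  have "p * 1 + q * r \<le> p * (1 + r\<^sup>2) + q * (1 + r\<^sup>2)"
    using assms r by (intro add_mono mult_left_mono) auto
  then show "t \<le> (p + q) * (1 + r\<^sup>2)" using assms by (simp add: algebra_simps)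
  have "t * r \<le> (p + q * r) * r" using assms by (intro mult_right_mono) auto
  also have "\<dots> = p * r + q * r\<^sup>2" by (simp add: power2_eq_square algebra_simps)
  also have "\<dots> \<le> p * (1 + r\<^sup>2) + q * (1 + r\<^sup>2)"
    using assms r by (intro add_mono mult_left_mono) auto
  finally show "t * r \<le> (p + q) * (1 + r\<^sup>2)" by (simp add: algebra_simps)
qed

text \<open>Integration by parts: the integral of a translate of \<open>f\<close> does not depend on the translation.\<close>

lemma integral_derivative_eq_0:
  fixes f :: "'a::euclidean_space \<Rightarrow> real"
  assumes c: "c > 0"
    and f': "\<And>y. (f has_derivative f' y) (at y)"
    and bnd: "\<And>y h. \<bar>f' y h\<bar> \<le> C * exp (- c * (norm y)\<^sup>2) * norm h"
    and int: "integrable lborel f"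
    and meas: "\<And>h. (\<lambda>y. f' y h) \<in> borel_measurable borel"
  shows "(\<integral>y. f' y h \<partial>lborel) = 0"
proof -
  \<comment> \<open>If |y - w| <= 1 then |y|^2 <= 2|w|^2 + 2, hence exp (- c|w|^2) <= exp c * exp (-
    (c/2)|y|^2). So a bound on the derivative at all points w near y costs half the decay rate and a
    factor exp c.\<close>
  define C' where "C' = \<bar>C\<bar> * exp c"
  have tr: "integrable lborel (\<lambda>y. f (y + z))" "(\<integral>y. f (y + z) \<partial>lborel) = (\<integral>y. f y \<partial>lborel)" for z
  proof -
    have m: "f \<in> borel_measurable borel" using int by auto
    have "integrable (distr lborel borel ((+) z)) f" using int by (simp add: lborel_distr_plus)
    then show "integrable lborel (\<lambda>y. f (y + z))" by (subst (asm) integrable_distr_eq) (auto simp: m add.commute)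
    have "(\<integral>y. f y \<partial>lborel) = (\<integral>y. f y \<partial>distr lborel borel ((+) z))" by (simp add: lborel_distr_plus)
    also have "\<dots> = (\<integral>y. f (y + z) \<partial>lborel)" by (subst integral_distr) (auto simp: m add.commute)
    finally show "(\<integral>y. f (y + z) \<partial>lborel) = (\<integral>y. f y \<partial>lborel)" by simp
  qed
  have "((\<lambda>z. \<integral>y. f (y + z) \<partial>lborel) has_derivative (\<lambda>h. \<integral>y. f' y h \<partial>lborel)) (at 0)"
  proof (rule has_derivative_lebesgue_integral[where \<delta> = 1 and B = "\<lambda>y. C' * exp (- (c / 2) * (norm y)\<^sup>2)"])
    show "((\<lambda>z. f (y + z)) has_derivative f' y) (at 0)" for y
      by (rule has_derivative_compose[where f = "\<lambda>z. y + z" and g = f and f' = "\<lambda>h. h", simplified])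
         (auto intro!: derivative_eq_intros f')
    fix y z :: 'a assume z: "norm (z - 0) < 1"
    have "norm (f (y + z) - f y) \<le> C' * exp (- (c / 2) * (norm y)\<^sup>2) * norm (y + z - y)"
    proof (rule differentiable_bound[where S = "cball y 1" and f' = f'])
      fix w assume "w \<in> cball y 1"
      then have "norm (y - w) \<le> 1" by (simp add: dist_norm)
      then have "norm y \<le> norm w + 1" using norm_triangle_ineq2[of y w] by simp
      then have "(norm y)\<^sup>2 \<le> (norm w + 1)\<^sup>2" by (intro power_mono) auto
      also have "\<dots> \<le> 2 * (norm w)\<^sup>2 + 2" using sum_squares_bound[of "norm w" 1] by (simp add: power2_sum)
      finally have "- c * (norm w)\<^sup>2 \<le> - (c / 2) * (norm y)\<^sup>2 + c" using c
        by (simp add: field_simps) (use mult_left_mono[of "(norm y)\<^sup>2" "2 * (norm w)\<^sup>2 + 2" c] in \<open>simp add: algebra_simps\<close>)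
      then have e: "exp (- c * (norm w)\<^sup>2) \<le> exp (- (c / 2) * (norm y)\<^sup>2) * exp c"
        by (simp add: mult_exp_exp)
      have "\<bar>f' w h\<bar> \<le> C' * exp (- (c / 2) * (norm y)\<^sup>2) * norm h" for h
      proof -
        have "\<bar>f' w h\<bar> \<le> C * exp (- c * (norm w)\<^sup>2) * norm h" by (rule bnd)
        also have "\<dots> \<le> \<bar>C\<bar> * (exp (- (c / 2) * (norm y)\<^sup>2) * exp c) * norm h"
          by (intro mult_right_mono mult_mono e) auto
        finally show ?thesis by (simp add: C'_def ac_simps)
      qed
      then show "onorm (f' w) \<le> C' * exp (- (c / 2) * (norm y)\<^sup>2)"
        by (intro onorm_bound) (auto simp: C'_def)
    qed (use z f' in \<open>auto simp: dist_norm intro: has_derivative_at_withinI\<close>)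
    then show "norm (f (y + z) - f (y + 0)) \<le> C' * exp (- (c / 2) * (norm y)\<^sup>2) * norm (z - 0)" by simp
  next
    show "integrable lborel (\<lambda>y::'a. C' * exp (- (c / 2) * (norm y)\<^sup>2))"
      using c by (intro integrable_mult_right integrable_exp_neg_norm_sq) auto
  qed (use tr meas in auto)
  moreover have "((\<lambda>z::'a. \<integral>y. f (y + z) \<partial>lborel) has_derivative (\<lambda>h. 0)) (at 0)"
    unfolding tr by (rule has_derivative_const)
  ultimately have "(\<lambda>h. \<integral>y. f' y h \<partial>lborel) = (\<lambda>h. 0)" by (rule has_derivative_unique)
  then show ?thesis by (rule fun_cong)
qed

text \<open>The loss L |x - y| in \<open>G_mono\<close> is the price of adding a bounded field to a
  strongly monotone gradient. This is the form that Gaussian mixtures and log-Lipschitz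
  perturbations of a Gaussian take; a strongly convex potential has L = 0.\<close>

locale potential_smoothing = gauss_smoothing \<nu> for \<nu> :: "'a::euclidean_space measure" +
  fixes U :: "'a \<Rightarrow> real" and G :: "'a \<Rightarrow> 'a" and B \<kappa> L :: real
  assumes nu_density: "\<nu> = density lborel (\<lambda>x. ennreal (exp (- U x)))"
    and U_deriv: "\<And>x. (U has_derivative (\<lambda>h. G x \<bullet> h)) (at x)"
    and G_lip: "\<And>x y. norm (G x - G y) \<le> B * norm (x - y)"
    and G_mono: "\<And>x y. \<kappa> * (norm (x - y))\<^sup>2 - L * norm (x - y) \<le> (G x - G y) \<bullet> (x - y)"
    and B0: "0 \<le> B" and \<kappa>0: "0 < \<kappa>" and L0: "0 \<le> L"
begin

lemma U_continuous: "continuous_on UNIV U"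
  using U_deriv has_derivative_continuous by (intro continuous_at_imp_continuous_on) blast

lemma G_continuous: "continuous_on UNIV G"
  by (rule lipschitz_on_continuous_on[of B], rule lipschitz_onI) (use G_lip B0 in \<open>auto simp: dist_norm\<close>)

lemma U_measurable [measurable]: "U \<in> borel_measurable borel"
  and G_measurable [measurable]: "G \<in> borel_measurable borel"
  using U_continuous G_continuous by (auto intro: borel_measurable_continuous_onI)

lemma G_growth: "norm (G y) \<le> norm (G 0) + B * norm y"
  using G_lip[of y 0] norm_triangle_ineq[of "G y - G 0" "G 0"] by simp

text \<open>Integrates \<open>G_mono\<close> along the ray from 0 to y. The resulting Gaussian decay
  of the density is what removes boundary terms at infinity when integrating by parts.\<close>

lemma U_growth: "U 0 - (norm (G 0) + L) * norm y + \<kappa> / 2 * (norm y)\<^sup>2 \<le> U y"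
proof -
  define g where "g = (\<lambda>s. U (s *\<^sub>R y) - (G 0 \<bullet> y - L * norm y) * s - \<kappa> / 2 * (norm y)\<^sup>2 * s\<^sup>2)"
  have "g 0 \<le> g 1"
  proof (rule DERIV_nonneg_imp_increasing_open[where f = g and a = 0 and b = 1])
    have d: "(g has_real_derivative (G (s *\<^sub>R y) \<bullet> y - (G 0 \<bullet> y - L * norm y) - \<kappa> * (norm y)\<^sup>2 * s)) (at s)" for s
    proof -
      have "((\<lambda>s. U (s *\<^sub>R y)) has_derivative (\<lambda>h. G (s *\<^sub>R y) \<bullet> (h *\<^sub>R y))) (at s)"
        by (rule has_derivative_compose[OF _ U_deriv]) (auto intro!: derivative_eq_intros)
      then have 1: "((\<lambda>s. U (s *\<^sub>R y)) has_real_derivative G (s *\<^sub>R y) \<bullet> y) (at s)"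
        unfolding has_field_derivative_def by (rule has_derivative_eq_rhs) (auto simp: mult.commute)
      show ?thesis unfolding g_def
        by (auto intro!: derivative_eq_intros 1)
    qed
    show "\<exists>l. (g has_real_derivative l) (at s) \<and> 0 \<le> l" if s: "0 < s" "s < 1" for s
    proof -
      have "\<kappa> * (norm (s *\<^sub>R y - 0))\<^sup>2 - L * norm (s *\<^sub>R y - 0) \<le> (G (s *\<^sub>R y) - G 0) \<bullet> (s *\<^sub>R y - 0)"
        by (rule G_mono)
      then have "s * (\<kappa> * s * (norm y)\<^sup>2 - L * norm y) \<le> s * ((G (s *\<^sub>R y) - G 0) \<bullet> y)"
        using s by (simp add: power2_eq_square algebra_simps)
      then have "\<kappa> * s * (norm y)\<^sup>2 - L * norm y \<le> (G (s *\<^sub>R y) - G 0) \<bullet> y" using s by simp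
      then have "0 \<le> G (s *\<^sub>R y) \<bullet> y - (G 0 \<bullet> y - L * norm y) - \<kappa> * (norm y)\<^sup>2 * s"
        by (simp add: inner_diff_left algebra_simps)
      with d[of s] show ?thesis by blast
    qed
    show "continuous_on {0..1} g" using d by (intro continuous_at_imp_continuous_on) (auto intro: DERIV_isCont)
  qed simp
  moreover have "- (norm (G 0) * norm y) \<le> G 0 \<bullet> y"
    using Cauchy_Schwarz_ineq2[of "G 0" y] by simp
  ultimately show ?thesis by (simp add: g_def algebra_simps)
qed

lemma exp_U_bound: obtains C where "0 < C" "\<And>y. exp (- U y) \<le> C * exp (- (\<kappa> / 4) * (norm y)\<^sup>2)"
proof
  define m where "m = norm (G 0) + L"
  show "0 < exp (- U 0 + m\<^sup>2 / \<kappa>)" by simp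
  fix y :: 'a
  have "m * norm y \<le> m\<^sup>2 / \<kappa> + \<kappa> / 4 * (norm y)\<^sup>2"
    using \<kappa>0 sum_squares_bound[of m "\<kappa> / 2 * norm y"] by (simp add: field_simps power2_eq_square)
  then have "- U y \<le> (- U 0 + m\<^sup>2 / \<kappa>) + (- (\<kappa> / 4) * (norm y)\<^sup>2)"
    using U_growth[of y] by (simp add: m_def algebra_simps)
  then show "exp (- U y) \<le> exp (- U 0 + m\<^sup>2 / \<kappa>) * exp (- (\<kappa> / 4) * (norm y)\<^sup>2)"
    by (simp add: mult_exp_exp)
qed

lemma integrable_quadratic:
  fixes F :: "'a \<Rightarrow> 'c::{banach, second_countable_topology}"
  assumes [measurable]: "F \<in> borel_measurable borel" and le: "\<And>y. norm (F y) \<le> P * (1 + (norm y)\<^sup>2)"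
  shows "integrable \<nu> F"
proof (rule Bochner_Integration.integrable_bound)
  show "integrable \<nu> (\<lambda>y. P * (1 + (norm y)\<^sup>2))" using moment2 by simp
  show "AE y in \<nu>. norm (F y) \<le> norm (P * (1 + (norm y)\<^sup>2))"
    using le by (auto intro!: AE_I2 order_trans[OF _ abs_ge_self])
qed measurable

lemma post_integral_lborel:
  assumes [measurable]: "F \<in> borel_measurable borel"
  shows "(\<integral>y. F y \<partial>post a b x) = (\<integral>y. exp (- U y) * gk a b x y * F y \<partial>lborel) / GN a b x"
proof -
  have "GI a b x F = (\<integral>y. exp (- U y) *\<^sub>R (gk a b x y *\<^sub>R F y) \<partial>lborel)"
    unfolding GI_def by (subst nu_density, subst integral_density) auto
  then show ?thesis using post_integral[OF assms, of a b x] by (simp add: divide_inverse ac_simps)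
qed

text \<open>The score of the posterior: the gradient in y of the log-weight - U y - |x - b y|^2 / (2
  a^2).\<close>

definition W' where "W' a b x y = (b / a\<^sup>2) *\<^sub>R (x - b *\<^sub>R y) - G y"

lemma W'_measurable [measurable]: "W' a b x \<in> borel_measurable borel"
  unfolding W'_def by measurable

lemma W'_growth: obtains p q where "0 \<le> p" "0 \<le> q" "\<And>y. norm (W' a b x y) \<le> p + q * norm y"
proof
  show "0 \<le> \<bar>b / a\<^sup>2\<bar> * norm x + norm (G 0)" "0 \<le> \<bar>b / a\<^sup>2\<bar> * \<bar>b\<bar> + B" using B0 by auto
  fix y
  have "norm (W' a b x y) \<le> \<bar>b / a\<^sup>2\<bar> * norm (x - b *\<^sub>R y) + norm (G y)"
    unfolding W'_def by (rule order_trans[OF norm_triangle_ineq4]) simp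
  also have "\<dots> \<le> \<bar>b / a\<^sup>2\<bar> * (norm x + \<bar>b\<bar> * norm y) + (norm (G 0) + B * norm y)"
    by (intro add_mono mult_left_mono G_growth order_trans[OF norm_triangle_ineq4]) auto
  finally show "norm (W' a b x y) \<le> \<bar>b / a\<^sup>2\<bar> * norm x + norm (G 0) + (\<bar>b / a\<^sup>2\<bar> * \<bar>b\<bar> + B) * norm y"
    by (simp only: algebra_simps)
qed

lemma weight_deriv:
  assumes "a > 0"
  shows "((\<lambda>y. exp (- U y) * gk a b x y) has_derivative
    (\<lambda>h. (W' a b x y \<bullet> h) * (exp (- U y) * gk a b x y))) (at y)"
proof -
  have 1: "((\<lambda>y. - (norm (x - b *\<^sub>R y))\<^sup>2 / (2 * a\<^sup>2)) has_derivative (\<lambda>h. (b / a\<^sup>2) * ((x - b *\<^sub>R y) \<bullet> h))) (at y)"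
    unfolding power2_norm_eq_inner using assms
    by (auto intro!: derivative_eq_intros simp: inner_commute field_simps)
  have "((\<lambda>y. exp (- U y + - (norm (x - b *\<^sub>R y))\<^sup>2 / (2 * a\<^sup>2))) has_derivative
    (\<lambda>h. (- (G y \<bullet> h) + (b / a\<^sup>2) * ((x - b *\<^sub>R y) \<bullet> h)) * exp (- U y + - (norm (x - b *\<^sub>R y))\<^sup>2 / (2 * a\<^sup>2)))) (at y)"
    by (rule has_derivative_eq_rhs[OF has_derivative_exp[OF has_derivative_add[OF has_derivative_minus[OF U_deriv] 1]]])
       (auto simp: mult.commute)
  then show ?thesis by (simp add: W'_def gk_def mult_exp_exp inner_diff_left algebra_simps)
qed

text \<open>Stein's identities. With the weight w = exp (- U) * gk, the derivatives of w and of (y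
  \<bullet> u) w in direction h integrate to zero; dividing by the mass of w gives the mean and the
  covariance of the score.\<close>

lemma post_W':
  assumes a: "a > 0"
  shows post_W'_mean: "(\<integral>y. W' a b x y \<bullet> h \<partial>post a b x) = 0"
    and post_W'_cov: "(\<integral>y. (y \<bullet> u) * (W' a b x y \<bullet> h) \<partial>post a b x) = - (u \<bullet> h)"
proof -
  define w where "w = (\<lambda>y. exp (- U y) * gk a b x y)"
  have [measurable]: "w \<in> borel_measurable borel" unfolding w_def by measurable
  obtain C where C: "0 < C" "\<And>y. exp (- U y) \<le> C * exp (- (\<kappa> / 4) * (norm y)\<^sup>2)" using exp_U_bound by blast
  define c where "c = \<kappa> / 4"
  have c: "c > 0" using \<kappa>0 by (simp add: c_def)
  have w: "0 < w y" "w y \<le> C * exp (- c * (norm y)\<^sup>2)" for y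
  proof -
    show "0 < w y" by (simp add: w_def gk_pos)
    have "w y \<le> exp (- U y) * 1" unfolding w_def by (intro mult_left_mono gk_le1) auto
    then show "w y \<le> C * exp (- c * (norm y)\<^sup>2)" using C(2)[of y] by (simp add: c_def)
  qed
  obtain p q where pq: "0 \<le> p" "0 \<le> q" "\<And>y. norm (W' a b x y) \<le> p + q * norm y" using W'_growth by blast
  have d: "(w has_derivative (\<lambda>h. (W' a b x y \<bullet> h) * w y)) (at y)" for y
    unfolding w_def by (rule weight_deriv[OF a])
  \<comment> \<open>A factor of quadratic growth reduces the decay rate of the weight from c to c /
    2; this is why the integrations by parts below run with c / 2.\<close>
  have absorb: "t * w y \<le> P * C * (1 + 2 / c) * exp (- (c / 2) * (norm y)\<^sup>2)"
    if t: "t \<le> P * (1 + (norm y)\<^sup>2)" "0 \<le> P" for t P y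
  proof -
    have "t * w y \<le> (P * (1 + (norm y)\<^sup>2)) * (C * exp (- c * (norm y)\<^sup>2))"
      using t w[of y] by (intro mult_mono) (auto simp: less_imp_le)
    also have "\<dots> = P * C * ((1 + (norm y)\<^sup>2) * exp (- c * (norm y)\<^sup>2))" by (simp add: ac_simps)
    also have "\<dots> \<le> P * C * ((1 + 2 / c) * exp (- (c / 2) * (norm y)\<^sup>2))"
      using t C by (intro mult_left_mono quadratic_times_exp_le[OF c]) auto
    finally show ?thesis by (simp add: ac_simps)
  qed
  have int: "integrable lborel (\<lambda>y. F y * w y)"
    if [measurable]: "F \<in> borel_measurable borel" and F: "\<And>y. \<bar>F y\<bar> \<le> P * (1 + (norm y)\<^sup>2)" "0 \<le> P" for F P
  proof (rule Bochner_Integration.integrable_bound)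
    show "integrable lborel (\<lambda>y::'a. P * C * (1 + 2 / c) * exp (- (c / 2) * (norm y)\<^sup>2))"
      using c by (intro integrable_mult_right integrable_exp_neg_norm_sq) auto
    have "norm (F y * w y) \<le> norm (P * C * (1 + 2 / c) * exp (- (c / 2) * (norm y)\<^sup>2))" for y
    proof -
      have "norm (F y * w y) = \<bar>F y\<bar> * w y" using w(1)[of y] by (simp add: abs_mult)
      also have "\<dots> \<le> P * C * (1 + 2 / c) * exp (- (c / 2) * (norm y)\<^sup>2)" by (rule absorb[OF F])
      finally show ?thesis unfolding real_norm_def by (rule order_trans[OF _ abs_ge_self])
    qed
    then show "AE y in lborel. norm (F y * w y) \<le> norm (P * C * (1 + 2 / c) * exp (- (c / 2) * (norm y)\<^sup>2))"
      by (rule AE_I2)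
  qed measurable
  have W'_le: "norm (W' a b x y) \<le> (p + q) * (1 + (norm y)\<^sup>2)"
      "norm (W' a b x y) * norm y \<le> (p + q) * (1 + (norm y)\<^sup>2)" for y
    using linear_growth_times[OF pq(1,2) norm_ge_zero pq(3)] by blast+
  have "(\<integral>y. (W' a b x y \<bullet> h) * w y \<partial>lborel) = 0"
  proof (rule integral_derivative_eq_0[where c = "c / 2" and C = "(p + q) * C * (1 + 2 / c)"
      and f = w and f' = "\<lambda>y h. (W' a b x y \<bullet> h) * w y", OF _ d])
    show "\<bar>(W' a b x y \<bullet> h) * w y\<bar> \<le> (p + q) * C * (1 + 2 / c) * exp (- (c / 2) * (norm y)\<^sup>2) * norm h" for y h
    proof -
      have "\<bar>(W' a b x y \<bullet> h) * w y\<bar> \<le> (norm (W' a b x y) * norm h) * w y"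
        using w[of y] by (simp add: abs_mult less_imp_le Cauchy_Schwarz_ineq2 mult_right_mono)
      also have "\<dots> = (norm (W' a b x y) * w y) * norm h" by simp
      also have "\<dots> \<le> ((p + q) * C * (1 + 2 / c) * exp (- (c / 2) * (norm y)\<^sup>2)) * norm h"
        using W'_le(1) pq by (intro mult_right_mono absorb) auto
      finally show ?thesis .
    qed
    show "integrable lborel w" using int[of "\<lambda>_. 1" 1] by simp
  qed (use c in auto)
  then show "(\<integral>y. W' a b x y \<bullet> h \<partial>post a b x) = 0"
    by (subst post_integral_lborel) (auto simp: w_def ac_simps)
  have yu: "\<bar>y \<bullet> u\<bar> \<le> norm u * norm y" for y using Cauchy_Schwarz_ineq2[of y u] by (simp add: mult.commute)
  have yu2: "\<bar>y \<bullet> u\<bar> \<le> norm u * (1 + (norm y)\<^sup>2)" for y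
    using linear_growth_times(1)[of 0 "norm u" "norm y" "\<bar>y \<bullet> u\<bar>"] yu[of y] by simp
  have W'u: "\<bar>y \<bullet> u\<bar> * norm (W' a b x y) \<le> (norm u * (p + q)) * (1 + (norm y)\<^sup>2)" for y
  proof -
    have "\<bar>y \<bullet> u\<bar> * norm (W' a b x y) \<le> (norm u * norm y) * norm (W' a b x y)"
      by (intro mult_right_mono yu) auto
    also have "\<dots> = norm u * (norm (W' a b x y) * norm y)" by simp
    also have "\<dots> \<le> norm u * ((p + q) * (1 + (norm y)\<^sup>2))" by (intro mult_left_mono W'_le) auto
    finally show ?thesis by simp
  qed
  have d2: "((\<lambda>y. (y \<bullet> u) * w y) has_derivative (\<lambda>h. (y \<bullet> u) * ((W' a b x y \<bullet> h) * w y) + (h \<bullet> u) * w y)) (at y)" for y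
    by (rule has_derivative_mult[OF _ d]) (auto intro!: derivative_eq_intros)
  have "(\<integral>y. (y \<bullet> u) * ((W' a b x y \<bullet> h) * w y) + (h \<bullet> u) * w y \<partial>lborel) = 0"
  proof (rule integral_derivative_eq_0[where c = "c / 2" and C = "(norm u * (p + q) + norm u) * C * (1 + 2 / c)"
      and f = "\<lambda>y. (y \<bullet> u) * w y" and f' = "\<lambda>y h. (y \<bullet> u) * ((W' a b x y \<bullet> h) * w y) + (h \<bullet> u) * w y", OF _ d2])
    show "\<bar>(y \<bullet> u) * ((W' a b x y \<bullet> h) * w y) + (h \<bullet> u) * w y\<bar>
       \<le> (norm u * (p + q) + norm u) * C * (1 + 2 / c) * exp (- (c / 2) * (norm y)\<^sup>2) * norm h" for y h
    proof -
      have "\<bar>(y \<bullet> u) * ((W' a b x y \<bullet> h) * w y) + (h \<bullet> u) * w y\<bar>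
         = \<bar>((y \<bullet> u) * (W' a b x y \<bullet> h) + h \<bullet> u) * w y\<bar>"
        by (simp add: algebra_simps)
      also have "\<dots> = \<bar>(y \<bullet> u) * (W' a b x y \<bullet> h) + h \<bullet> u\<bar> * w y"
        using w(1)[of y] by (simp add: abs_mult)
      also have "\<dots> \<le> (\<bar>y \<bullet> u\<bar> * (norm (W' a b x y) * norm h) + norm u * norm h) * w y"
        using w(1)[of y] Cauchy_Schwarz_ineq2[of h u]
        by (intro mult_right_mono order_trans[OF abs_triangle_ineq] add_mono)
           (auto simp: abs_mult mult.commute[of "norm u"] intro!: mult_left_mono Cauchy_Schwarz_ineq2)
      also have "\<dots> = ((\<bar>y \<bullet> u\<bar> * norm (W' a b x y) + norm u) * w y) * norm h"
        by (simp add: algebra_simps)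
      also have "\<dots> \<le> ((norm u * (p + q) + norm u) * C * (1 + 2 / c) * exp (- (c / 2) * (norm y)\<^sup>2)) * norm h"
      proof (intro mult_right_mono absorb)
        have nu: "norm u \<le> norm u * (1 + (norm y)\<^sup>2)" by (simp add: algebra_simps)
        show "\<bar>y \<bullet> u\<bar> * norm (W' a b x y) + norm u \<le> (norm u * (p + q) + norm u) * (1 + (norm y)\<^sup>2)"
          using add_mono[OF W'u[of y] nu] by (simp only: distrib_right)
      qed (use pq in auto)
      finally show ?thesis .
    qed
    show "integrable lborel (\<lambda>y. (y \<bullet> u) * w y)" by (rule int[of _ "norm u"]) (use yu2 in auto)
  qed (use c in auto)
  moreover have "integrable lborel (\<lambda>y. ((y \<bullet> u) * (W' a b x y \<bullet> h)) * w y)"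
  proof (rule int)
    show "\<bar>(y \<bullet> u) * (W' a b x y \<bullet> h)\<bar> \<le> (norm u * (p + q) * norm h) * (1 + (norm y)\<^sup>2)" for y
    proof -
      have "\<bar>(y \<bullet> u) * (W' a b x y \<bullet> h)\<bar> \<le> \<bar>y \<bullet> u\<bar> * (norm (W' a b x y) * norm h)"
        unfolding abs_mult by (intro mult_left_mono Cauchy_Schwarz_ineq2) auto
      also have "\<dots> \<le> ((norm u * (p + q)) * (1 + (norm y)\<^sup>2)) * norm h"
        unfolding mult.assoc[symmetric] by (intro mult_right_mono W'u) auto
      finally show ?thesis by (simp add: ac_simps)
    qed
  qed (use pq in auto)
  moreover have "integrable lborel w" using int[of "\<lambda>_. 1" 1] by simp
  ultimately have "(\<integral>y. ((y \<bullet> u) * (W' a b x y \<bullet> h)) * w y \<partial>lborel) = - (h \<bullet> u) * (\<integral>y. w y \<partial>lborel)"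
    by (simp add: mult.assoc)
  moreover have "(\<integral>y. w y \<partial>lborel) = GN a b x"
  proof -
    have "GN a b x = (\<integral>y. exp (- U y) *\<^sub>R (gk a b x y *\<^sub>R 1) \<partial>lborel)"
      unfolding GI_def by (subst nu_density, subst integral_density) auto
    then show ?thesis by (simp add: w_def)
  qed
  ultimately show "(\<integral>y. (y \<bullet> u) * (W' a b x y \<bullet> h) \<partial>post a b x) = - (u \<bullet> h)"
    using GN_pos[of a b x]
    by (subst post_integral_lborel) (auto simp: w_def ac_simps inner_commute)
qed

end

text \<open>For nonzero z the test vector is z itself. For z = 0 the hypothesis at a basis vector
  yields 0 <= c.\<close>

lemma norm_le_if_inner_le:
  fixes z :: "'a::euclidean_space"
  assumes "\<And>u. z \<bullet> u \<le> c * norm u"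
  shows "norm z \<le> c"
  using assms[of z] by (cases "z = 0") (use assms[of "SOME b. b \<in> Basis"] in \<open>auto simp: dot_square_norm power2_eq_square some_in_eq\<close>)

lemma le_half_sum_square_div: "s > 0 \<Longrightarrow> r \<le> (s + r\<^sup>2 / s) / 2" for r s :: real
  using sum_squares_bound[of r s] by (simp add: field_simps power2_eq_square)

section \<open>Covariance and variance of the posterior\<close>

context gauss_smoothing
begin

lemma prob_post [simp]: "measure (post a b x) UNIV = 1"
  using prob_space.prob_space[OF prob_space_post, of a b x] by simp

lemma integrable_inner_mult_id: "integrable \<nu> (\<lambda>y. (y \<bullet> u) * (y \<bullet> h))"
  using integrable_inner_left[OF integrable_inner_scaleR_id[of u], of h] by simp

lemma pcov_inner:
  "pcov a b x h \<bullet> u = (\<integral>y. ((y - pmean a b x) \<bullet> h) * ((y - pmean a b x) \<bullet> u) \<partial>post a b x)"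
proof -
  interpret P: prob_space "post a b x" by (rule prob_space_post)
  define m where "m = pmean a b x"
  have i1: "integrable (post a b x) (\<lambda>y. y)" by (rule post_integrable[OF integrable_id])
  have i2: "integrable (post a b x) (\<lambda>y. (y \<bullet> h) * (y \<bullet> u))" by (rule post_integrable[OF integrable_inner_mult_id])
  have i3: "integrable (post a b x) (\<lambda>y. (y \<bullet> h) *\<^sub>R y)" by (rule post_integrable[OF integrable_inner_scaleR_id])
  have m: "(\<integral>y. y \<bullet> k \<partial>post a b x) = m \<bullet> k" for k
    using i1 by (simp add: m_def pmean_def)
  have "(\<integral>y. ((y - m) \<bullet> h) * ((y - m) \<bullet> u) \<partial>post a b x) =
     (\<integral>y. (y \<bullet> h) * (y \<bullet> u) - (m \<bullet> u) * (y \<bullet> h) - (m \<bullet> h) * (y \<bullet> u) + (m \<bullet> h) * (m \<bullet> u) \<partial>post a b x)"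
    by (intro Bochner_Integration.integral_cong) (auto simp: inner_diff_left algebra_simps)
  also have "\<dots> = (\<integral>y. (y \<bullet> h) * (y \<bullet> u) \<partial>post a b x) - (m \<bullet> h) * (m \<bullet> u)"
    using i1 i2 by (simp add: m)
  also have "(\<integral>y. (y \<bullet> h) * (y \<bullet> u) \<partial>post a b x) = (\<integral>y. (y \<bullet> h) *\<^sub>R y \<partial>post a b x) \<bullet> u"
    using i3 by (subst integral_inner_left[symmetric]) auto
  finally show ?thesis by (simp add: pcov_def m_def inner_diff_left)
qed

lemma integrable_centred_sq: "integrable (post a b x) (\<lambda>y. (norm (y - c))\<^sup>2)"
proof (rule post_integrable)
  have "(norm (y - c))\<^sup>2 = (norm y)\<^sup>2 - 2 * (y \<bullet> c) + (norm c)\<^sup>2" for y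
    by (simp add: power2_norm_eq_inner inner_diff_left inner_diff_right inner_commute)
  then show "integrable \<nu> (\<lambda>y. (norm (y - c))\<^sup>2)"
    using moment2 integrable_id by simp
qed

lemma integrable_centred: "integrable (post a b x) (\<lambda>y. norm (y - c))"
  using moment1 by (intro post_integrable integrable_norm Bochner_Integration.integrable_diff integrable_id) auto

lemma pvar_eq: "pvar a b x = (\<Sum>e\<in>Basis. pcov a b x e \<bullet> e)"
proof -
  have i: "integrable (post a b x) (\<lambda>y. ((y - pmean a b x) \<bullet> e) * ((y - pmean a b x) \<bullet> e))" for e
  proof (rule Bochner_Integration.integrable_bound)
    show "integrable (post a b x) (\<lambda>y. (norm e)\<^sup>2 * (norm (y - pmean a b x))\<^sup>2)"
      by (intro integrable_mult_right integrable_centred_sq)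
    have "\<bar>z \<bullet> e\<bar> * \<bar>z \<bullet> e\<bar> \<le> (norm z * norm e) * (norm z * norm e)" for z :: 'a
      by (intro mult_mono Cauchy_Schwarz_ineq2) auto
    note z = this
    have "norm (((y - pmean a b x) \<bullet> e) * ((y - pmean a b x) \<bullet> e))
        \<le> norm ((norm e)\<^sup>2 * (norm (y - pmean a b x))\<^sup>2)" for y
      using z[of "y - pmean a b x"] by (simp add: abs_mult power2_eq_square ac_simps)
    then show "AE y in post a b x. norm (((y - pmean a b x) \<bullet> e) * ((y - pmean a b x) \<bullet> e))
        \<le> norm ((norm e)\<^sup>2 * (norm (y - pmean a b x))\<^sup>2)" by (rule AE_I2)
  qed measurable
  have "pvar a b x = (\<integral>y. (\<Sum>e\<in>Basis. ((y - pmean a b x) \<bullet> e) * ((y - pmean a b x) \<bullet> e)) \<partial>post a b x)"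
    unfolding pvar_def power2_norm_eq_inner
    by (intro Bochner_Integration.integral_cong refl) (rule euclidean_inner)
  also have "\<dots> = (\<Sum>e\<in>Basis. pcov a b x e \<bullet> e)"
    unfolding pcov_inner by (rule Bochner_Integration.integral_sum[OF i])
  finally show ?thesis .
qed

text \<open>Used with both factors equal to the centred y, where C = 1, and with one factor G y - G
  (pmean a b x), where C = B. Both covariances are thereby controlled by the same quantity
  \<open>pvar\<close>.\<close>

lemma bilinear_post_bound:
  fixes \<phi> \<psi> :: "'a \<Rightarrow> 'a"
  assumes [measurable]: "\<phi> \<in> borel_measurable borel" "\<psi> \<in> borel_measurable borel"
    and C: "0 \<le> C" and le: "\<And>y. norm (\<phi> y) \<le> C * norm (y - pmean a b x)" "\<And>y. norm (\<psi> y) \<le> norm (y - pmean a b x)"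
  shows "\<bar>\<integral>y. (\<phi> y \<bullet> h) * (\<psi> y \<bullet> u) \<partial>post a b x\<bar> \<le> C * pvar a b x * norm h * norm u"
proof -
  have "\<bar>(\<phi> y \<bullet> h) * (\<psi> y \<bullet> u)\<bar> \<le> (C * norm h * norm u) * (norm (y - pmean a b x))\<^sup>2" for y
  proof -
    have "\<bar>(\<phi> y \<bullet> h) * (\<psi> y \<bullet> u)\<bar> \<le> (norm (\<phi> y) * norm h) * (norm (\<psi> y) * norm u)"
      unfolding abs_mult by (intro mult_mono Cauchy_Schwarz_ineq2) auto
    also have "\<dots> \<le> (C * norm (y - pmean a b x) * norm h) * (norm (y - pmean a b x) * norm u)"
      by (intro mult_mono le) (auto simp: C)
    finally show ?thesis by (simp add: power2_eq_square ac_simps)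
  qed
  note b = this
  have I: "integrable (post a b x) (\<lambda>y. (C * norm h * norm u) * (norm (y - pmean a b x))\<^sup>2)"
    by (intro integrable_mult_right integrable_centred_sq)
  have "integrable (post a b x) (\<lambda>y. (\<phi> y \<bullet> h) * (\<psi> y \<bullet> u))"
  proof (rule Bochner_Integration.integrable_bound[OF I])
    have "(\<lambda>y. (\<phi> y \<bullet> h) * (\<psi> y \<bullet> u)) \<in> borel_measurable borel" by measurable
    then show "(\<lambda>y. (\<phi> y \<bullet> h) * (\<psi> y \<bullet> u)) \<in> borel_measurable (post a b x)"
      by (simp add: measurable_cong_sets[OF sets_post refl])
    show "AE y in post a b x. norm ((\<phi> y \<bullet> h) * (\<psi> y \<bullet> u)) \<le> norm ((C * norm h * norm u) * (norm (y - pmean a b x))\<^sup>2)"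
      unfolding real_norm_def by (intro AE_I2 order_trans[OF b abs_ge_self])
  qed
  then have "norm (\<integral>y. (\<phi> y \<bullet> h) * (\<psi> y \<bullet> u) \<partial>post a b x)
      \<le> (\<integral>y. (C * norm h * norm u) * (norm (y - pmean a b x))\<^sup>2 \<partial>post a b x)"
    by (rule Bochner_Integration.integral_norm_bound_integral[OF _ I]) (unfold real_norm_def, rule b)
  then show ?thesis by (simp add: pvar_def ac_simps)
qed

lemma pcov_bound: "norm (pcov a b x h) \<le> pvar a b x * norm h"
proof (rule norm_le_if_inner_le)
  fix u
  have "\<bar>pcov a b x h \<bullet> u\<bar> \<le> 1 * pvar a b x * norm h * norm u"
    unfolding pcov_inner by (rule bilinear_post_bound) auto
  then show "pcov a b x h \<bullet> u \<le> pvar a b x * norm h * norm u" by simp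
qed

end

section \<open>Covariance identities for the gradient and the variance bound\<close>

context potential_smoothing
begin

lemma integrable_G: "integrable \<nu> G"
  by (rule integrable_quadratic[where P = "norm (G 0) + B"], measurable)
     (rule linear_growth_times(1)[OF norm_ge_zero B0 norm_ge_zero G_growth])

lemma integrable_inner_scaleR_G: "integrable \<nu> (\<lambda>y. (y \<bullet> u) *\<^sub>R G y)"
proof (rule integrable_quadratic[where P = "norm u * (norm (G 0) + B)"])
  fix y
  have "\<bar>y \<bullet> u\<bar> * norm (G y) \<le> (norm y * norm u) * norm (G y)"
    by (intro mult_right_mono Cauchy_Schwarz_ineq2) auto
  also have "\<dots> = norm u * (norm (G y) * norm y)" by simp
  also have "\<dots> \<le> norm u * ((norm (G 0) + B) * (1 + (norm y)\<^sup>2))"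
    by (intro mult_left_mono linear_growth_times(2)[OF norm_ge_zero B0 norm_ge_zero G_growth]) auto
  finally show "norm ((y \<bullet> u) *\<^sub>R G y) \<le> norm u * (norm (G 0) + B) * (1 + (norm y)\<^sup>2)" by simp
qed measurable

text \<open>The score has mean zero. As a tends to 0 this trades the singular expression (b/a^2)(x -
  b m) for an average of \<open>G\<close>.\<close>

lemma post_G_mean:
  assumes a: "a > 0"
  shows "(\<integral>y. G y \<partial>post a b x) = (b / a\<^sup>2) *\<^sub>R (x - b *\<^sub>R pmean a b x)"
proof -
  interpret P: prob_space "post a b x" by (rule prob_space_post)
  have i: "integrable (post a b x) (\<lambda>y. y)" "integrable (post a b x) G"
    by (rule post_integrable[OF integrable_id], rule post_integrable[OF integrable_G])
  define z where "z = (b / a\<^sup>2) *\<^sub>R (x - b *\<^sub>R pmean a b x) - (\<integral>y. G y \<partial>post a b x)"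
  have "(\<integral>y. W' a b x y \<partial>post a b x) = z"
    unfolding W'_def z_def pmean_def using i by (simp add:)
  moreover have "integrable (post a b x) (W' a b x)" unfolding W'_def using i by simp
  then have "(\<integral>y. W' a b x y \<bullet> z \<partial>post a b x) = (\<integral>y. W' a b x y \<partial>post a b x) \<bullet> z"
    by (subst integral_inner_left) auto
  ultimately have "z \<bullet> z = 0" using post_W'_mean[OF a, of b x z] by simp
  then show ?thesis by (simp add: z_def)
qed

text \<open>Stein's identity with the score written out. Since y - m has mean zero, the mean of
  \<open>G\<close> may be replaced by the constant \<open>G m\<close>; this makes the Lipschitz
  bound on \<open>G\<close> directly applicable.\<close>

lemma post_G_cov:
  fixes a b :: real and x u h :: 'a
  assumes a: "a > 0"
  defines "m \<equiv> pmean a b x"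
  shows "(\<integral>y. ((y - m) \<bullet> u) * ((G y - G m) \<bullet> h) \<partial>post a b x) = u \<bullet> h - (b\<^sup>2 / a\<^sup>2) * (pcov a b x h \<bullet> u)"
proof -
  interpret P: prob_space "post a b x" by (rule prob_space_post)
  let ?E = "\<lambda>F :: 'a \<Rightarrow> real. \<integral>y. F y \<partial>post a b x"
  have i: "integrable (post a b x) (\<lambda>y. y)" "integrable (post a b x) G"
    by (rule post_integrable[OF integrable_id], rule post_integrable[OF integrable_G])
  have i2: "integrable (post a b x) (\<lambda>y. (y \<bullet> u) * (y \<bullet> h))" by (rule post_integrable[OF integrable_inner_mult_id])
  have i3: "integrable (post a b x) (\<lambda>y. (y \<bullet> u) * (G y \<bullet> h))"
    using post_integrable[OF integrable_inner_left[OF integrable_inner_scaleR_G[of u], of h]] by simp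
  have m: "?E (\<lambda>y. y \<bullet> k) = m \<bullet> k" for k using i by (simp add: m_def pmean_def)
  have EG: "?E (\<lambda>y. G y \<bullet> h) = (b / a\<^sup>2) * (x \<bullet> h - b * (m \<bullet> h))"
    using i post_G_mean[OF a, of b x] by (simp add: m_def inner_diff_left)
  have "- (u \<bullet> h) = ?E (\<lambda>y. (y \<bullet> u) * (W' a b x y \<bullet> h))" by (rule post_W'_cov[OF a, symmetric])
  also have "\<dots> = ?E (\<lambda>y. (b / a\<^sup>2) * (x \<bullet> h) * (y \<bullet> u) - (b\<^sup>2 / a\<^sup>2) * ((y \<bullet> u) * (y \<bullet> h)) - (y \<bullet> u) * (G y \<bullet> h))"
    by (intro Bochner_Integration.integral_cong)
       (auto simp: W'_def inner_diff_left power2_eq_square algebra_simps)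
  also have "\<dots> = (b / a\<^sup>2) * (x \<bullet> h) * (m \<bullet> u) - (b\<^sup>2 / a\<^sup>2) * ?E (\<lambda>y. (y \<bullet> u) * (y \<bullet> h)) - ?E (\<lambda>y. (y \<bullet> u) * (G y \<bullet> h))"
    using i i2 i3 by (simp add: m)
  finally have yG: "?E (\<lambda>y. (y \<bullet> u) * (G y \<bullet> h)) = u \<bullet> h + (b / a\<^sup>2) * (x \<bullet> h) * (m \<bullet> u)
      - (b\<^sup>2 / a\<^sup>2) * ?E (\<lambda>y. (y \<bullet> u) * (y \<bullet> h))" by simp
  have i4: "integrable (post a b x) (\<lambda>y. (y \<bullet> h) *\<^sub>R y)" by (rule post_integrable[OF integrable_inner_scaleR_id])
  have c: "pcov a b x h \<bullet> u = ?E (\<lambda>y. (y \<bullet> u) * (y \<bullet> h)) - (m \<bullet> h) * (m \<bullet> u)"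
    unfolding pcov_def inner_diff_left using i4
    by (subst integral_inner_left[symmetric]) (auto simp: m_def mult.commute)
  have "?E (\<lambda>y. ((y - m) \<bullet> u) * ((G y - G m) \<bullet> h)) =
      ?E (\<lambda>y. (y \<bullet> u) * (G y \<bullet> h) - (m \<bullet> u) * (G y \<bullet> h) - (G m \<bullet> h) * (y \<bullet> u) + (m \<bullet> u) * (G m \<bullet> h))"
    by (intro Bochner_Integration.integral_cong) (auto simp: inner_diff_left algebra_simps)
  also have "\<dots> = ?E (\<lambda>y. (y \<bullet> u) * (G y \<bullet> h)) - (m \<bullet> u) * ?E (\<lambda>y. G y \<bullet> h)"
    using i i3 by (simp add: m)
  also have "\<dots> = u \<bullet> h - (b\<^sup>2 / a\<^sup>2) * (pcov a b x h \<bullet> u)"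
    unfolding yG EG c by (simp add: algebra_simps power2_eq_square diff_divide_distrib add_divide_distrib)
  finally show ?thesis .
qed

text \<open>The left-hand operator is the covariance of \<open>G\<close> and y, which the Lipschitz
  constant of \<open>G\<close> bounds. Thus (b^2/a^2) Cov y is close to the identity whenever the
  variance is small, and this compensates the singular a'/a.\<close>

lemma pcov_near_identity:
  assumes a: "a > 0"
  shows "norm (h - (b\<^sup>2 / a\<^sup>2) *\<^sub>R pcov a b x h) \<le> B * pvar a b x * norm h"
proof (rule norm_le_if_inner_le)
  fix u
  have "\<bar>\<integral>y. ((G y - G (pmean a b x)) \<bullet> h) * ((y - pmean a b x) \<bullet> u) \<partial>post a b x\<bar> \<le> B * pvar a b x * norm h * norm u"
    by (rule bilinear_post_bound) (use G_lip B0 in auto)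
  moreover have "(h - (b\<^sup>2 / a\<^sup>2) *\<^sub>R pcov a b x h) \<bullet> u
      = (\<integral>y. ((G y - G (pmean a b x)) \<bullet> h) * ((y - pmean a b x) \<bullet> u) \<partial>post a b x)"
    using post_G_cov[OF a, of b x u h] by (simp add: inner_diff_left inner_commute[of u h] mult.commute)
  ultimately show "(h - (b\<^sup>2 / a\<^sup>2) *\<^sub>R pcov a b x h) \<bullet> u \<le> B * pvar a b x * norm h * norm u" by simp
qed

definition Cvar where "Cvar = 2 * real DIM('a) + L\<^sup>2 / \<kappa>"

text \<open>The trace of \<open>post_G_cov\<close> gives E[(y - m) \<bullet> (G y - G m)] = d -
  (b^2/a^2) pvar, while \<open>G_mono\<close> bounds the same expectation below by \<kappa> pvar - L
  E|y - m|. With k = \<kappa> + b^2/a^2 the linear term is split as L r <= L^2/(2k) + (k/2) r^2, so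
  half of k pvar survives; twice the remaining constant is \<open>Cvar\<close>.\<close>

lemma pvar_bound:
  assumes a: "a > 0"
  shows "pvar a b x \<le> Cvar / (\<kappa> + b\<^sup>2 / a\<^sup>2)"
proof -
  interpret P: prob_space "post a b x" by (rule prob_space_post)
  define k where "k = \<kappa> + b\<^sup>2 / a\<^sup>2"
  have k: "k > 0" "k \<ge> \<kappa>" using \<kappa>0 by (auto simp: k_def add_pos_nonneg)
  define m where "m = pmean a b x"
  let ?f = "\<lambda>e y. ((y - m) \<bullet> e) * ((G y - G m) \<bullet> e)"
  have i: "integrable (post a b x) (?f e)" for e
  proof (rule Bochner_Integration.integrable_bound)
    show "integrable (post a b x) (\<lambda>y. B * (norm e)\<^sup>2 * (norm (y - m))\<^sup>2)"
      by (intro integrable_mult_right integrable_centred_sq)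
    have "\<bar>(y - m) \<bullet> e\<bar> * \<bar>(G y - G m) \<bullet> e\<bar> \<le> (norm (y - m) * norm e) * ((B * norm (y - m)) * norm e)" for y
      by (intro mult_mono Cauchy_Schwarz_ineq2 order_trans[OF Cauchy_Schwarz_ineq2 mult_right_mono[OF G_lip]])
         (auto simp: B0)
    then show "AE y in post a b x. norm (?f e y) \<le> norm (B * (norm e)\<^sup>2 * (norm (y - m))\<^sup>2)"
      using B0 by (simp add: abs_mult power2_eq_square ac_simps)
  qed measurable
  have s: "(\<Sum>e\<in>Basis. ?f e y) = (y - m) \<bullet> (G y - G m)" for y by (rule euclidean_inner[symmetric])
  have ii: "integrable (post a b x) (\<lambda>y. (y - m) \<bullet> (G y - G m))"
    unfolding s[symmetric] by (rule Bochner_Integration.integrable_sum[OF i])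
  have "(\<integral>y. (y - m) \<bullet> (G y - G m) \<partial>post a b x) = (\<Sum>e\<in>Basis. \<integral>y. ?f e y \<partial>post a b x)"
    unfolding s[symmetric] by (rule Bochner_Integration.integral_sum[OF i])
  also have "\<dots> = (\<Sum>e\<in>(Basis::'a set). 1 - (b\<^sup>2 / a\<^sup>2) * (pcov a b x e \<bullet> e))"
    by (intro sum.cong refl) (simp add: post_G_cov[OF a, of b x, folded m_def])
  also have "\<dots> = real DIM('a) - (b\<^sup>2 / a\<^sup>2) * pvar a b x"
    by (simp add: sum_subtractf pvar_eq sum_distrib_left)
  finally have 1: "(\<integral>y. (y - m) \<bullet> (G y - G m) \<partial>post a b x) = real DIM('a) - (b\<^sup>2 / a\<^sup>2) * pvar a b x" .
  have "(\<integral>y. (\<kappa> - k / 2) * (norm (y - m))\<^sup>2 - L\<^sup>2 / (2 * \<kappa>) \<partial>post a b x) \<le> (\<integral>y. (y - m) \<bullet> (G y - G m) \<partial>post a b x)"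
  proof (rule integral_mono[OF _ ii])
    show "integrable (post a b x) (\<lambda>y. (\<kappa> - k / 2) * (norm (y - m))\<^sup>2 - L\<^sup>2 / (2 * \<kappa>))"
      using integrable_centred_sq by simp
    fix y
    have "L * norm (y - m) \<le> L\<^sup>2 / (2 * k) + k / 2 * (norm (y - m))\<^sup>2"
      using sum_squares_bound[of L "k * norm (y - m)"] k by (simp add: field_simps power2_eq_square)
    also have "L\<^sup>2 / (2 * k) \<le> L\<^sup>2 / (2 * \<kappa>)" using k \<kappa>0 by (intro divide_left_mono) auto
    finally show "(\<kappa> - k / 2) * (norm (y - m))\<^sup>2 - L\<^sup>2 / (2 * \<kappa>) \<le> (y - m) \<bullet> (G y - G m)"
      using G_mono[of y m] by (simp add: inner_commute algebra_simps)
  qed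
  also have "(\<integral>y. (\<kappa> - k / 2) * (norm (y - m))\<^sup>2 - L\<^sup>2 / (2 * \<kappa>) \<partial>post a b x) = (\<kappa> - k / 2) * pvar a b x - L\<^sup>2 / (2 * \<kappa>)"
    using integrable_centred_sq by (simp add: pvar_def m_def)
  finally have "(\<kappa> - k / 2) * pvar a b x - L\<^sup>2 / (2 * \<kappa>) \<le> real DIM('a) - (k - \<kappa>) * pvar a b x"
    unfolding 1 by (simp add: k_def)
  then have "2 * (k / 2 * pvar a b x) \<le> 2 * (real DIM('a) + L\<^sup>2 / (2 * \<kappa>))"
    by (simp add: algebra_simps)
  then have "pvar a b x * k \<le> Cvar" by (simp add: Cvar_def mult.commute)
  then show ?thesis using k by (simp add: k_def[symmetric] pos_le_divide_eq)
qed

lemma pvar_bound': "a > 0 \<Longrightarrow> pvar a b x \<le> Cvar * a\<^sup>2 / (\<kappa> * a\<^sup>2 + b\<^sup>2)"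
  using pvar_bound[of a b x] by (simp add: field_simps)

lemma Cvar_nonneg: "0 \<le> Cvar" using \<kappa>0 by (simp add: Cvar_def)

section \<open>Concentration of the posterior as a tends to 0\<close>

text \<open>The two limits depend on each other: the mean of \<open>G\<close> is near G x if the
  posterior mean is near x, and the posterior mean is expressed through the mean of \<open>G\<close>
  by \<open>post_G_mean\<close>. The circle closes because the latter dependence carries the factor
  \<open>q\<close>, which tends to 0.\<close>

lemma post_limits:
  fixes \<alpha> \<beta> :: "'p \<Rightarrow> real"
  assumes pos: "eventually (\<lambda>t. 0 < \<alpha> t) F" and \<alpha>: "(\<alpha> \<longlongrightarrow> 0) F" and \<beta>: "(\<beta> \<longlongrightarrow> 1) F"
  shows pmean_limit: "((\<lambda>t. pmean (\<alpha> t) (\<beta> t) x) \<longlongrightarrow> x) F"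
    and post_G_limit: "((\<lambda>t. \<integral>y. G y \<partial>post (\<alpha> t) (\<beta> t) x) \<longlongrightarrow> G x) F"
proof -
  define EG where "EG = (\<lambda>t. \<integral>y. G y \<partial>post (\<alpha> t) (\<beta> t) x)"
  define m where "m = (\<lambda>t. pmean (\<alpha> t) (\<beta> t) x)"
  \<comment> \<open>Bounds E|y - m| through r <= (\<alpha> + r^2 / \<alpha>) / 2. The weight
    \<alpha> is balanced against the variance, which is O(\<alpha>^2), so both terms vanish in the
    limit.\<close>
  define \<eta> where "\<eta> = (\<lambda>t. (\<alpha> t + Cvar * \<alpha> t / (\<kappa> * (\<alpha> t)\<^sup>2 + (\<beta> t)\<^sup>2)) / 2)"
  define q where "q = (\<lambda>t. (\<alpha> t)\<^sup>2 / (\<beta> t)\<^sup>2)"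
  define \<zeta> where "\<zeta> = (\<lambda>t. 2 * B * (\<eta> t + \<bar>1 / \<beta> t - 1\<bar> * norm x + q t * norm (G x)))"
  have qlim: "(q \<longlongrightarrow> 0) F" unfolding q_def by (auto intro!: tendsto_eq_intros \<alpha> \<beta>)
  have \<eta>lim: "(\<eta> \<longlongrightarrow> 0) F" unfolding \<eta>_def by (auto intro!: tendsto_eq_intros \<alpha> \<beta>)
  have \<zeta>lim: "(\<zeta> \<longlongrightarrow> 0) F" unfolding \<zeta>_def by (auto intro!: tendsto_eq_intros \<eta>lim qlim \<beta>)
  have "((\<lambda>t. B * q t) \<longlongrightarrow> 0) F" by (auto intro!: tendsto_eq_intros qlim)
  then have ev1: "eventually (\<lambda>t. B * q t < 1 / 2) F" by (rule order_tendstoD) simp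
  have ev2: "eventually (\<lambda>t. 0 < \<beta> t) F" using \<beta> by (rule order_tendstoD) simp
  have m_eq: "m t = (1 / \<beta> t) *\<^sub>R x - q t *\<^sub>R EG t" if "0 < \<alpha> t" "0 < \<beta> t" for t
    unfolding EG_def m_def q_def using that post_G_mean[OF that(1), of "\<beta> t" x]
    by (simp add: scaleR_diff_right power2_eq_square)
  have "eventually (\<lambda>t. norm (EG t - G x) \<le> \<zeta> t) F"
    using pos ev1 ev2
  proof eventually_elim
    case (elim t)
    interpret P: prob_space "post (\<alpha> t) (\<beta> t) x" by (rule prob_space_post)
    have iG: "integrable (post (\<alpha> t) (\<beta> t) x) G" by (rule post_integrable[OF integrable_G])
    have ic: "integrable (post (\<alpha> t) (\<beta> t) x) (\<lambda>y. norm (y - m t))" by (rule integrable_centred)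
    define \<delta> where "\<delta> = norm (EG t - G x)"
    have "EG t - G x = (\<integral>y. G y - G x \<partial>post (\<alpha> t) (\<beta> t) x)"
      using iG by (simp add: EG_def)
    then have "\<delta> \<le> (\<integral>y. B * (norm (y - m t) + norm (m t - x)) \<partial>post (\<alpha> t) (\<beta> t) x)"
      unfolding \<delta>_def
    proof (simp only:, intro Bochner_Integration.integral_norm_bound_integral)
      fix y
      have "norm (y - x) \<le> norm (y - m t) + norm (m t - x)"
        using norm_triangle_ineq[of "y - m t" "m t - x"] by simp
      then show "norm (G y - G x) \<le> B * (norm (y - m t) + norm (m t - x))"
        by (intro order_trans[OF G_lip] mult_left_mono B0)
    qed (use iG ic in auto)
    also have "\<dots> = B * ((\<integral>y. norm (y - m t) \<partial>post (\<alpha> t) (\<beta> t) x) + norm (m t - x))"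
      using ic by (simp add:)
    also have "(\<integral>y. norm (y - m t) \<partial>post (\<alpha> t) (\<beta> t) x)
        \<le> (\<integral>y. (\<alpha> t + (norm (y - m t))\<^sup>2 / \<alpha> t) / 2 \<partial>post (\<alpha> t) (\<beta> t) x)"
      by (intro integral_mono ic) (use elim integrable_centred_sq le_half_sum_square_div in auto)
    also have "\<dots> = (\<alpha> t + pvar (\<alpha> t) (\<beta> t) x / \<alpha> t) / 2"
      using integrable_centred_sq by (simp add: pvar_def m_def)
    also have "\<dots> \<le> \<eta> t"
    proof -
      have "pvar (\<alpha> t) (\<beta> t) x / \<alpha> t \<le> (Cvar * (\<alpha> t)\<^sup>2 / (\<kappa> * (\<alpha> t)\<^sup>2 + (\<beta> t)\<^sup>2)) / \<alpha> t"
        using elim pvar_bound'[of "\<alpha> t" "\<beta> t" x] by (intro divide_right_mono) auto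
      also have "\<dots> = Cvar * \<alpha> t / (\<kappa> * (\<alpha> t)\<^sup>2 + (\<beta> t)\<^sup>2)" using elim by (simp add: power2_eq_square)
      finally show ?thesis unfolding \<eta>_def by (intro divide_right_mono add_left_mono) auto
    qed
    finally have 1: "\<delta> \<le> B * (\<eta> t + norm (m t - x))" using B0 by (simp add: mult_left_mono)
    have q0: "0 \<le> q t" by (simp add: q_def)
    have "m t - x = (1 / \<beta> t - 1) *\<^sub>R x - q t *\<^sub>R EG t"
      using m_eq elim by (simp add: scaleR_diff_left)
    then have "norm (m t - x) \<le> \<bar>1 / \<beta> t - 1\<bar> * norm x + q t * norm (EG t)"
      using norm_triangle_ineq4[of "(1 / \<beta> t - 1) *\<^sub>R x" "q t *\<^sub>R EG t"] q0 by simp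
    also have "norm (EG t) \<le> norm (G x) + \<delta>"
      unfolding \<delta>_def using norm_triangle_ineq[of "EG t - G x" "G x"] by simp
    finally have 2: "norm (m t - x) \<le> \<bar>1 / \<beta> t - 1\<bar> * norm x + q t * (norm (G x) + \<delta>)"
      using q0 by (simp add: mult_left_mono)
    have "\<delta> \<le> B * (\<eta> t + (\<bar>1 / \<beta> t - 1\<bar> * norm x + q t * (norm (G x) + \<delta>)))"
      using 1 2 B0 by (meson add_left_mono mult_left_mono order_trans)
    also have "\<dots> = \<zeta> t / 2 + (B * q t) * \<delta>" by (simp add: \<zeta>_def algebra_simps)
    \<comment> \<open>Eventually B q < 1/2, so the error \<delta> on the right is absorbed by the
      left-hand side.\<close>
    also have "\<dots> \<le> \<zeta> t / 2 + 1 / 2 * \<delta>"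
      using elim by (intro add_left_mono mult_right_mono) (auto simp: \<delta>_def)
    finally show ?case by (simp add: \<delta>_def)
  qed
  then have "((\<lambda>t. EG t - G x) \<longlongrightarrow> 0) F" by (rule Lim_null_comparison[OF _ \<zeta>lim])
  then have EGlim: "(EG \<longlongrightarrow> G x) F" by (simp add: LIM_zero_iff)
  then show "((\<lambda>t. \<integral>y. G y \<partial>post (\<alpha> t) (\<beta> t) x) \<longlongrightarrow> G x) F" by (simp add: EG_def)
  have "((\<lambda>t. (1 / \<beta> t) *\<^sub>R x - q t *\<^sub>R EG t) \<longlongrightarrow> (1 / 1) *\<^sub>R x - 0 *\<^sub>R G x) F"
    by (intro tendsto_intros \<beta> qlim EGlim) auto
  moreover have "eventually (\<lambda>t. (1 / \<beta> t) *\<^sub>R x - q t *\<^sub>R EG t = m t) F"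
    using pos ev2 by eventually_elim (simp add: m_eq)
  ultimately have "(m \<longlongrightarrow> (1 / 1) *\<^sub>R x - 0 *\<^sub>R G x) F" by (rule Lim_transform_eventually)
  then show "((\<lambda>t. pmean (\<alpha> t) (\<beta> t) x) \<longlongrightarrow> x) F" by (simp add: m_def)
qed

end

section \<open>The velocity field\<close>

lemma continuous_AE_lborel_eq:
  fixes f g :: "'a::euclidean_space \<Rightarrow> 'b::real_normed_vector"
  assumes f: "continuous_on UNIV f" and g: "continuous_on UNIV g" and ae: "AE x in lborel. f x = g x"
  shows "f = g"
proof -
  have "closed {x. f x = g x}" using f g by (rule closed_Collect_eq)
  then have op: "open (- {x. f x = g x})" by blast
  have "- {x. f x = g x} \<in> null_sets lborel"
    using op ae by (subst AE_iff_null_sets) auto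
  then have "negligible (- {x. f x = g x})" by (simp add: negligible_iff_null_sets null_sets_completionI)
  then have "- {x. f x = g x} = {}" using open_not_negligible[OF op] by blast
  then show ?thesis by auto
qed

context gauss_smoothing
begin

text \<open>Substituting Z = (x - b X1) / a into a' Z + b' X1 leaves the posterior mean of X1 as the
  only unknown.\<close>

definition vel :: "real \<Rightarrow> real \<Rightarrow> real \<Rightarrow> real \<Rightarrow> 'a \<Rightarrow> 'a" where
  "vel a b a' b' x = (a' / a) *\<^sub>R x + (b' - a' * b / a) *\<^sub>R pmean a b x"

definition Dvel :: "real \<Rightarrow> real \<Rightarrow> real \<Rightarrow> real \<Rightarrow> 'a \<Rightarrow> 'a \<Rightarrow> 'a" where
  "Dvel a b a' b' x h = (a' / a) *\<^sub>R h + (b' - a' * b / a) *\<^sub>R ((b / a\<^sup>2) *\<^sub>R pcov a b x h)"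

lemma vel_deriv: "a > 0 \<Longrightarrow> (vel a b a' b' has_derivative Dvel a b a' b' x) (at x)"
  unfolding vel_def[abs_def] Dvel_def[abs_def]
  by (intro has_derivative_add has_derivative_scaleR_right has_derivative_ident pmean_deriv)

lemma pmean_continuous: "continuous_on {p. 0 < fst p} (\<lambda>p. pmean (fst p) (fst (snd p)) (snd (snd p)))"
  unfolding pmean_GI
  by (intro continuous_intros GI_continuous integrable_id) (use GN_pos in \<open>auto simp: less_imp_neq[symmetric]\<close>)

lemma pcov_continuous: "continuous_on {p. 0 < fst p} (\<lambda>p. pcov (fst p) (fst (snd p)) (snd (snd p)) h)"
proof -
  have "(\<integral>y. (y \<bullet> h) *\<^sub>R y \<partial>post a b x) = GI a b x (\<lambda>y. (y \<bullet> h) *\<^sub>R y) /\<^sub>R GN a b x" for a b x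
    by (rule post_integral) simp
  then show ?thesis unfolding pcov_def
    by (auto intro!: continuous_intros GI_continuous integrable_inner_scaleR_id pmean_continuous
        simp: GN_pos less_imp_neq[symmetric])
qed

lemma vel_path_continuous:
  fixes \<alpha> \<beta> \<alpha>' \<beta>' :: "real \<Rightarrow> real"
  assumes c: "continuous_on S \<alpha>" "continuous_on S \<beta>" "continuous_on S \<alpha>'" "continuous_on S \<beta>'"
    and pos: "\<And>t. t \<in> S \<Longrightarrow> 0 < \<alpha> t"
  shows "continuous_on (S \<times> UNIV) (\<lambda>(t, x). vel (\<alpha> t) (\<beta> t) (\<alpha>' t) (\<beta>' t) x)"
    and "continuous_on (S \<times> UNIV) (\<lambda>(t, x). Dvel (\<alpha> t) (\<beta> t) (\<alpha>' t) (\<beta>' t) x h)"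
proof -
  have c': "continuous_on (S \<times> (UNIV :: 'a set)) (\<lambda>p. f (fst p))" if "continuous_on S f" for f :: "real \<Rightarrow> real"
    by (rule continuous_on_compose2[OF that]) (auto intro!: continuous_intros)
  have p: "continuous_on (S \<times> (UNIV :: 'a set)) (\<lambda>p. (\<alpha> (fst p), \<beta> (fst p), snd p))"
    by (intro continuous_intros c' c)
  have m: "continuous_on (S \<times> UNIV) (\<lambda>p. pmean (\<alpha> (fst p)) (\<beta> (fst p)) (snd p))"
    using continuous_on_compose2[OF pmean_continuous p] pos by (auto simp: image_subset_iff)
  have q: "continuous_on (S \<times> UNIV) (\<lambda>p. pcov (\<alpha> (fst p)) (\<beta> (fst p)) (snd p) h)"
    using continuous_on_compose2[OF pcov_continuous p] pos by (auto simp: image_subset_iff)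
  have nz: "\<forall>p\<in>S \<times> (UNIV :: 'a set). \<alpha> (fst p) \<noteq> 0" using pos by force
  show "continuous_on (S \<times> UNIV) (\<lambda>(t, x). vel (\<alpha> t) (\<beta> t) (\<alpha>' t) (\<beta>' t) x)"
    unfolding vel_def case_prod_unfold using nz by (intro continuous_intros m c' c) auto
  show "continuous_on (S \<times> UNIV) (\<lambda>(t, x). Dvel (\<alpha> t) (\<beta> t) (\<alpha>' t) (\<beta>' t) x h)"
    unfolding Dvel_def case_prod_unfold using nz by (intro continuous_intros q c' c) auto
qed

section \<open>Identification of the velocity field\<close>

text \<open>For fixed X1 = y the substitution x = a z + b y turns the Gaussian density into
  \<open>gk\<close>, up to the Jacobian factor. Expressing the joint law as a density over Lebesgue
  times \<nu> lets Fubini take the part of a disintegration.\<close>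

lemma interpolant_law:
  fixes M :: "'w measure"
  assumes M: "prob_space M" and Z: "Z \<in> borel_measurable M" and X1: "X1 \<in> borel_measurable M"
    and Zlaw: "distr M borel Z = density lborel (\<lambda>z. ennreal (c * exp (- (norm z)\<^sup>2 / 2)))" and c: "0 \<le> c"
    and X1law: "distr M borel X1 = \<nu>" and ind: "prob_space.indep_var M borel Z borel X1" and a: "a > 0"
  shows "distr M (borel \<Otimes>\<^sub>M borel) (\<lambda>w. (a *\<^sub>R Z w + b *\<^sub>R X1 w, X1 w)) =
    density (lborel \<Otimes>\<^sub>M \<nu>) (\<lambda>(x, y). ennreal (c / a ^ DIM('a) * gk a b x y))" (is "?L = ?R")
proof (rule measure_eqI)
  interpret M: prob_space M by fact
  note [measurable] = Z X1
  let ?\<gamma> = "density lborel (\<lambda>z::'a. ennreal (c * exp (- (norm z)\<^sup>2 / 2)))"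
  have gk2[measurable]: "(\<lambda>(x, y). gk a b x y) \<in> borel_measurable (borel \<Otimes>\<^sub>M borel)"
    unfolding gk_def by measurable
  interpret g: prob_space ?\<gamma> unfolding Zlaw[symmetric] by (rule M.prob_space_distr) measurable
  interpret P: pair_sigma_finite ?\<gamma> \<nu> ..
  interpret P2: pair_sigma_finite "lborel :: 'a measure" \<nu> ..
  have J: "distr M (borel \<Otimes>\<^sub>M borel) (\<lambda>w. (Z w, X1 w)) = ?\<gamma> \<Otimes>\<^sub>M \<nu>"
    using ind unfolding M.indep_var_distribution_eq Zlaw X1law by simp
  have sets_R: "sets (lborel \<Otimes>\<^sub>M \<nu>) = sets (borel \<Otimes>\<^sub>M borel)" by (rule sets_pair_measure_cong) auto
  show "sets ?L = sets ?R" by (simp add: sets_R)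
  fix A assume "A \<in> sets ?L"
  then have A[measurable]: "A \<in> sets (borel \<Otimes>\<^sub>M borel)" by simp
  have T: "(\<lambda>(z, y). (a *\<^sub>R z + b *\<^sub>R y, y)) \<in> borel \<Otimes>\<^sub>M borel \<rightarrow>\<^sub>M (borel :: 'a measure) \<Otimes>\<^sub>M (borel :: 'a measure)" by measurable
  have sub: "(\<integral>\<^sup>+z. ennreal (c * exp (- (norm z)\<^sup>2 / 2)) * indicator A (a *\<^sub>R z + b *\<^sub>R y, y) \<partial>lborel)
      = (\<integral>\<^sup>+x. ennreal (c / a ^ DIM('a) * gk a b x y) * indicator A (x, y) \<partial>lborel)" for y
  proof -
    have e: "gk a b (b *\<^sub>R y + a *\<^sub>R z) y = exp (- (norm z)\<^sup>2 / 2)" for z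
      using a by (simp add: gk_def power_mult_distrib)
    have "(\<integral>\<^sup>+x. ennreal (c / a ^ DIM('a) * gk a b x y) * indicator A (x, y) \<partial>lborel)
      = (\<integral>\<^sup>+x. ennreal (c / a ^ DIM('a) * gk a b x y) * indicator A (x, y)
           \<partial>density (distr lborel borel (\<lambda>z. b *\<^sub>R y + a *\<^sub>R z)) (\<lambda>_. \<bar>a\<bar>^DIM('a)))"
      using lborel_affine[of a "b *\<^sub>R y"] a by simp
    also have "\<dots> = (\<integral>\<^sup>+z. ennreal (a ^ DIM('a)) * (ennreal (c / a ^ DIM('a) * exp (- (norm z)\<^sup>2 / 2)) * indicator A (b *\<^sub>R y + a *\<^sub>R z, y)) \<partial>lborel)"
      using a by (simp add: nn_integral_density nn_integral_distr e ennreal_power)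
    also have "\<dots> = (\<integral>\<^sup>+z. ennreal (c * exp (- (norm z)\<^sup>2 / 2)) * indicator A (a *\<^sub>R z + b *\<^sub>R y, y) \<partial>lborel)"
      unfolding mult.assoc[symmetric] using a c
      by (intro nn_integral_cong) (simp add: ennreal_mult[symmetric] add.commute)
    finally show ?thesis by simp
  qed
  have "emeasure ?L A = (\<integral>\<^sup>+p. indicator A p \<partial>?L)" by simp
  also have "\<dots> = (\<integral>\<^sup>+w. indicator A (a *\<^sub>R Z w + b *\<^sub>R X1 w, X1 w) \<partial>M)"
    by (rule nn_integral_distr) auto
  also have "\<dots> = (\<integral>\<^sup>+p. indicator A (a *\<^sub>R fst p + b *\<^sub>R snd p, snd p) \<partial>distr M (borel \<Otimes>\<^sub>M borel) (\<lambda>w. (Z w, X1 w)))"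
    by (subst nn_integral_distr) auto
  also have "\<dots> = (\<integral>\<^sup>+y. \<integral>\<^sup>+z. indicator A (a *\<^sub>R z + b *\<^sub>R y, y) \<partial>?\<gamma> \<partial>\<nu>)"
    unfolding J by (subst P.nn_integral_snd[symmetric]) auto
  also have "\<dots> = (\<integral>\<^sup>+y. \<integral>\<^sup>+z. ennreal (c * exp (- (norm z)\<^sup>2 / 2)) * indicator A (a *\<^sub>R z + b *\<^sub>R y, y) \<partial>lborel \<partial>\<nu>)"
    by (intro nn_integral_cong nn_integral_density) auto
  also have "\<dots> = (\<integral>\<^sup>+y. \<integral>\<^sup>+x. ennreal (c / a ^ DIM('a) * gk a b x y) * indicator A (x, y) \<partial>lborel \<partial>\<nu>)"
    unfolding sub ..
  also have "\<dots> = (\<integral>\<^sup>+p. (case p of (x, y) \<Rightarrow> ennreal (c / a ^ DIM('a) * gk a b x y)) * indicator A p \<partial>(lborel \<Otimes>\<^sub>M \<nu>))"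
    by (subst P2.nn_integral_snd[symmetric]) auto
  also have "\<dots> = emeasure ?R A"
    by (subst emeasure_density) (auto simp: sets_R)
  finally show "emeasure ?L A = emeasure ?R A" .
qed

text \<open>The orthogonality in \<open>tower\<close>, written with the joint density and integrated
  over y first, tests vel - V against an arbitrary bounded q with the positive weight GN. This
  forces equality almost everywhere, and continuity upgrades it to equality everywhere.\<close>

lemma velocity_unique:
  fixes M :: "'w measure" and V :: "'a \<Rightarrow> 'a"
  assumes M: "prob_space M" and Z: "Z \<in> borel_measurable M" and X1: "X1 \<in> borel_measurable M"
    and Zlaw: "distr M borel Z = density lborel (\<lambda>z. ennreal (c * exp (- (norm z)\<^sup>2 / 2)))" and c: "0 < c"
    and X1law: "distr M borel X1 = \<nu>" and ind: "prob_space.indep_var M borel Z borel X1" and a: "a > 0"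
    and V: "continuous_on UNIV V"
    and tower: "\<And>q u. q \<in> borel_measurable borel \<Longrightarrow> (\<And>x. \<bar>q x\<bar> \<le> 1) \<Longrightarrow>
      integrable M (\<lambda>w. q (a *\<^sub>R Z w + b *\<^sub>R X1 w) * ((a' *\<^sub>R Z w + b' *\<^sub>R X1 w - V (a *\<^sub>R Z w + b *\<^sub>R X1 w)) \<bullet> u)) \<and>
      (\<integral>w. q (a *\<^sub>R Z w + b *\<^sub>R X1 w) * ((a' *\<^sub>R Z w + b' *\<^sub>R X1 w - V (a *\<^sub>R Z w + b *\<^sub>R X1 w)) \<bullet> u) \<partial>M) = 0"
  shows "V = vel a b a' b'"
proof -
  interpret M: prob_space M by fact
  note [measurable] = Z X1
  have Vm[measurable]: "V \<in> borel_measurable borel" by (rule borel_measurable_continuous_onI[OF V])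
  have gk2[measurable]: "(\<lambda>(x, y). gk a b x y) \<in> borel_measurable (borel \<Otimes>\<^sub>M borel)"
    unfolding gk_def by measurable
  interpret P2: pair_sigma_finite "lborel :: 'a measure" \<nu> ..
  define C where "C = c / a ^ DIM('a)"
  have C: "0 < C" using c a by (simp add: C_def)
  have sets_R: "sets (lborel \<Otimes>\<^sub>M \<nu>) = sets (borel \<Otimes>\<^sub>M borel)" by (rule sets_pair_measure_cong) auto
  have velc: "continuous_on UNIV (vel a b a' b')"
    using has_derivative_continuous[OF vel_deriv[OF a]] by (intro continuous_at_imp_continuous_on) blast
  have velm[measurable]: "vel a b a' b' \<in> borel_measurable borel" by (rule borel_measurable_continuous_onI[OF velc])
  have GNc: "continuous_on UNIV (GN a b)"
    using has_derivative_continuous[OF GI_deriv[OF a, of "\<lambda>_. 1::real"]]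
    by (intro continuous_at_imp_continuous_on) blast
  have inner_eq: "vel a b a' b' x \<bullet> u = V x \<bullet> u" for u x
  proof -
    \<comment> \<open>The sign of the difference is an admissible bounded test function and makes
      the integrand nonnegative, so the vanishing integral kills the difference itself.\<close>
    define q where "q = (\<lambda>x. sgn ((vel a b a' b' x - V x) \<bullet> u))"
    have q[measurable]: "q \<in> borel_measurable borel" unfolding q_def by measurable
    have q1: "\<bar>q x\<bar> \<le> 1" for x by (simp add: q_def abs_sgn_eq)
    define k where "k = (\<lambda>(x, y). q x * (((a' / a) *\<^sub>R (x - b *\<^sub>R y) + b' *\<^sub>R y - V x) \<bullet> u))"
    have k[measurable]: "k \<in> borel_measurable (borel \<Otimes>\<^sub>M borel)" unfolding k_def by measurable
    have keq: "k (a *\<^sub>R Z w + b *\<^sub>R X1 w, X1 w) =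
        q (a *\<^sub>R Z w + b *\<^sub>R X1 w) * ((a' *\<^sub>R Z w + b' *\<^sub>R X1 w - V (a *\<^sub>R Z w + b *\<^sub>R X1 w)) \<bullet> u)" for w
      using a by (simp add: k_def)
    let ?J = "distr M (borel \<Otimes>\<^sub>M borel) (\<lambda>w. (a *\<^sub>R Z w + b *\<^sub>R X1 w, X1 w))"
    have Jeq: "?J = density (lborel \<Otimes>\<^sub>M \<nu>) (\<lambda>p. ennreal (C * gk a b (fst p) (snd p)))"
      using interpolant_law[OF M Z X1 Zlaw _ X1law ind a, of b] c by (simp add: C_def case_prod_unfold)
    have iJ: "integrable ?J k" "(\<integral>p. k p \<partial>?J) = 0"
      using tower[OF q q1, of u] by (auto simp: integrable_distr_eq integral_distr keq)
    have nn: "AE p in lborel \<Otimes>\<^sub>M \<nu>. 0 \<le> C * gk a b (fst p) (snd p)"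
      using C gk_pos[of a b] by (auto intro!: AE_I2 less_imp_le[OF mult_pos_pos])
    have gkm: "(\<lambda>p. C * gk a b (fst p) (snd p)) \<in> borel_measurable (lborel \<Otimes>\<^sub>M \<nu>)"
      using gk2 by (simp add: measurable_cong_sets[OF sets_R refl] case_prod_unfold)
    have km: "k \<in> borel_measurable (lborel \<Otimes>\<^sub>M \<nu>)" using k by (simp add: measurable_cong_sets[OF sets_R refl])
    let ?f = "\<lambda>p. (C * gk a b (fst p) (snd p)) *\<^sub>R k p"
    have ip: "integrable (lborel \<Otimes>\<^sub>M \<nu>) ?f" and zero: "(\<integral>p. ?f p \<partial>(lborel \<Otimes>\<^sub>M \<nu>)) = 0"
      using iJ unfolding Jeq integrable_density[OF km gkm nn] integral_density[OF km gkm nn] by auto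
    have in_eq: "(\<integral>y. ?f (x, y) \<partial>\<nu>) = C * GN a b x * \<bar>(vel a b a' b' x - V x) \<bullet> u\<bar>" for x
    proof -
      have i1: "integrable \<nu> (\<lambda>y. gk a b x y * (y \<bullet> u))" "integrable \<nu> (\<lambda>y. gk a b x y)"
        using integrable_gk[of "\<lambda>y. y \<bullet> u"] integrable_gk[of "\<lambda>_. 1::real" a b x] integrable_id
        by (auto simp: integrable_inner_left)
      note yu = integral_gk_inner[of a b x u]
      have "(\<integral>y. ?f (x, y) \<partial>\<nu>) = (\<integral>y. (C * q x * ((a' / a) * (x \<bullet> u) - V x \<bullet> u)) * gk a b x y
          + (C * q x * (b' - a' * b / a)) * (gk a b x y * (y \<bullet> u)) \<partial>\<nu>)"
        using a by (intro Bochner_Integration.integral_cong)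
          (auto simp: k_def inner_diff_left inner_add_left algebra_simps diff_divide_distrib add_divide_distrib)
      also have "\<dots> = (C * q x * ((a' / a) * (x \<bullet> u) - V x \<bullet> u)) * GN a b x
          + (C * q x * (b' - a' * b / a)) * (GN a b x * (pmean a b x \<bullet> u))"
        using i1 by (simp add: yu) (simp add: GI_def)
      also have "\<dots> = C * GN a b x * (q x * ((vel a b a' b' x - V x) \<bullet> u))"
        by (simp add: vel_def inner_diff_left inner_add_left algebra_simps)
      also have "q x * ((vel a b a' b' x - V x) \<bullet> u) = \<bar>(vel a b a' b' x - V x) \<bullet> u\<bar>"
        by (simp add: q_def abs_sgn mult.commute)
      finally show ?thesis .
    qed
    have 1: "integrable lborel (\<lambda>x. C * GN a b x * \<bar>(vel a b a' b' x - V x) \<bullet> u\<bar>)"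
      using P2.integrable_fst'[OF ip] unfolding in_eq .
    have 2: "(\<integral>x. C * GN a b x * \<bar>(vel a b a' b' x - V x) \<bullet> u\<bar> \<partial>lborel) = 0"
      using P2.integral_fst'[OF ip] unfolding in_eq zero .
    have 3: "0 \<le> C * GN a b x * \<bar>(vel a b a' b' x - V x) \<bullet> u\<bar>" for x
      using C GN_pos[of a b x] by simp
    have "AE x in lborel. C * GN a b x * \<bar>(vel a b a' b' x - V x) \<bullet> u\<bar> = 0"
      using integral_nonneg_eq_0_iff_AE[OF 1 AE_I2[OF 3]] 2 by blast
    then have "AE x in lborel. vel a b a' b' x \<bullet> u = V x \<bullet> u"
      by eventually_elim (use C GN_pos[of a b] in \<open>auto simp: inner_diff_left less_imp_neq[symmetric]\<close>)
    then have "(\<lambda>x. vel a b a' b' x \<bullet> u) = (\<lambda>x. V x \<bullet> u)"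
      by (rule continuous_AE_lborel_eq[rotated 2]) (intro continuous_intros velc V)+
    then show ?thesis by (rule fun_cong)
  qed
  show ?thesis
  proof
    show "V x = vel a b a' b' x" for x
      using inner_eq[of x] by (metis vector_eq_rdot)
  qed
qed

end

context potential_smoothing
begin

text \<open>Regrouped as (a'/a)(h - (b^2/a^2) Cov h) + (b' b/a^2) Cov h, both terms are bounded by
  the variance, which is O(a^2): a'/a becomes a' a and the second a^2 cancels.\<close>

lemma Dvel_bound:
  assumes a: "a > 0"
  shows "norm (Dvel a b a' b' x h) \<le> (\<bar>a' * a\<bar> * B + \<bar>b' * b\<bar>) * (Cvar / (\<kappa> * a\<^sup>2 + b\<^sup>2)) * norm h"
proof -
  have d: "0 < \<kappa> * a\<^sup>2 + b\<^sup>2" using a \<kappa>0 by (simp add: add_pos_nonneg)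
  define w where "w = Cvar / (\<kappa> * a\<^sup>2 + b\<^sup>2) * norm h"
  have pv: "pvar a b x * norm h \<le> a\<^sup>2 * w"
    using mult_right_mono[OF pvar_bound'[OF a, of b x], of "norm h"] by (simp add: w_def ac_simps)
  have "Dvel a b a' b' x h = (a' / a) *\<^sub>R (h - (b\<^sup>2 / a\<^sup>2) *\<^sub>R pcov a b x h) + (b' * b / a\<^sup>2) *\<^sub>R pcov a b x h"
    unfolding Dvel_def by (simp add: scaleR_diff_left scaleR_diff_right power2_eq_square left_diff_distrib diff_divide_distrib)
  also have "norm \<dots> \<le> \<bar>a' / a\<bar> * norm (h - (b\<^sup>2 / a\<^sup>2) *\<^sub>R pcov a b x h) + \<bar>b' * b / a\<^sup>2\<bar> * norm (pcov a b x h)"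
    by (rule order_trans[OF norm_triangle_ineq]) simp
  also have "\<dots> \<le> \<bar>a' / a\<bar> * (B * (a\<^sup>2 * w)) + \<bar>b' * b / a\<^sup>2\<bar> * (a\<^sup>2 * w)"
  proof (intro add_mono mult_left_mono)
    show "norm (h - (b\<^sup>2 / a\<^sup>2) *\<^sub>R pcov a b x h) \<le> B * (a\<^sup>2 * w)"
      using pcov_near_identity[OF a, of h b x] mult_left_mono[OF pv B0] by (simp add: ac_simps)
    show "norm (pcov a b x h) \<le> a\<^sup>2 * w" using pcov_bound[of a b x h] pv by linarith
  qed auto
  also have "\<dots> = (\<bar>a' * a\<bar> * B + \<bar>b' * b\<bar>) * w"
    using a by (simp add: abs_mult power2_eq_square algebra_simps)
  finally show ?thesis by (simp add: w_def ac_simps)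
qed

text \<open>In this form a' occurs only in the product a' a and nothing is divided by a, so the
  limit at time 1 can be read off.\<close>

lemma vel_alt:
  assumes "a > 0" "b > 0"
  shows "vel a b a' b' x = (a' * a / b) *\<^sub>R (\<integral>y. G y \<partial>post a b x) + b' *\<^sub>R pmean a b x"
  unfolding post_G_mean[OF assms(1)] vel_def using assms
  by (simp add: scaleR_diff_right scaleR_diff_left scaleR_add_left power2_eq_square algebra_simps)

end

section \<open>Transport of laws by the flow\<close>

text \<open>A smooth step that tends pointwise to the indicator of \<open>t > 0\<close>; the shift by \<open>n\<close> makes
  the limit vanish at \<open>t = 0\<close>.\<close>

definition smooth_step :: "nat \<Rightarrow> real \<Rightarrow> real" where
  "smooth_step n t = 1 / (1 + exp (real n - (real n)\<^sup>2 * t))"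

lemma smooth_step_01: "0 \<le> smooth_step n t" "smooth_step n t \<le> 1"
proof -
  have "0 < 1 + exp (real n - (real n)\<^sup>2 * t)" by (simp add: add_pos_pos)
  then show "0 \<le> smooth_step n t" "smooth_step n t \<le> 1"
    by (auto simp: smooth_step_def)
qed

lemma smooth_step_deriv:
  "(smooth_step n has_real_derivative
     (real n)\<^sup>2 * exp (real n - (real n)\<^sup>2 * t) / (1 + exp (real n - (real n)\<^sup>2 * t))\<^sup>2) (at t)"
proof -
  have "1 + exp (real n - (real n)\<^sup>2 * t) \<noteq> 0" using exp_gt_zero[of "real n - (real n)\<^sup>2 * t"] by linarith
  then show ?thesis unfolding smooth_step_def[abs_def]
    by (auto intro!: derivative_eq_intros simp: power2_eq_square)
qed

lemma smooth_step_lipschitz: "\<bar>smooth_step n s - smooth_step n t\<bar> \<le> (real n)\<^sup>2 * \<bar>s - t\<bar>"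
proof -
  have "norm (smooth_step n s - smooth_step n t) \<le> (real n)\<^sup>2 * norm (s - t)"
  proof (rule field_differentiable_bound[where S = UNIV])
    fix t
    define e where "e = exp (real n - (real n)\<^sup>2 * t)"
    have e: "e > 0" by (simp add: e_def)
    show "(smooth_step n has_field_derivative (real n)\<^sup>2 * e / (1 + e)\<^sup>2) (at t within UNIV)"
      using smooth_step_deriv[of n t] by (simp add: e_def)
    have "e \<le> (1 + e)\<^sup>2" using e by (simp add: power2_sum)
    then have "e / (1 + e)\<^sup>2 \<le> 1" using e by (simp add: divide_le_eq)
    then have "(real n)\<^sup>2 * (e / (1 + e)\<^sup>2) \<le> (real n)\<^sup>2 * 1" by (intro mult_left_mono) auto
    then show "norm ((real n)\<^sup>2 * e / (1 + e)\<^sup>2) \<le> (real n)\<^sup>2" using e by simp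
  qed auto
  then show ?thesis by simp
qed

lemma smooth_step_tendsto: "(\<lambda>n. smooth_step n t) \<longlonglongrightarrow> (if t > 0 then 1 else 0)"
proof -
  have e0: "(\<lambda>n. exp (- real n)) \<longlonglongrightarrow> 0"
    by (rule filterlim_compose[OF exp_at_bot])
       (rule filterlim_compose[OF filterlim_uminus_at_bot_at_top filterlim_real_sequentially])
  show ?thesis
  proof (cases "t > 0")
    case True
    have "(\<lambda>n. smooth_step n t - 1) \<longlonglongrightarrow> 0"
    proof (rule Lim_null_comparison[OF _ e0])
      \<comment> \<open>From this index on n t >= 2, so the exponent n - n^2 t is at most
        -n.\<close>
      obtain N :: nat where N: "2 / t < real N" using reals_Archimedean2 by blast
      show "\<forall>\<^sub>F n in sequentially. norm (smooth_step n t - 1) \<le> exp (- real n)"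
        using eventually_ge_at_top[of N]
      proof eventually_elim
        case (elim n)
        have "2 \<le> real n * t" using N elim True by (simp add: divide_less_eq) (smt (verit, best) mult_right_mono of_nat_le_iff)
        then have "real n * 2 \<le> real n * (real n * t)" by (intro mult_left_mono) auto
        then have le: "real n - (real n)\<^sup>2 * t \<le> - real n" by (simp add: power2_eq_square)
        define e where "e = exp (real n - (real n)\<^sup>2 * t)"
        have e: "0 < e" "e \<le> exp (- real n)" using le by (auto simp: e_def)
        have "smooth_step n t - 1 = - (e / (1 + e))"
          using e(1) unfolding smooth_step_def e_def[symmetric] by (simp add: field_simps)
        then have "norm (smooth_step n t - 1) = e / (1 + e)" using e(1) by simp
        also have "\<dots> \<le> e" using e(1) by (simp add: divide_le_eq)
        finally show ?case using e by simp
      qed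
    qed
    then show ?thesis using True by (simp add: LIM_zero_iff)
  next
    case False
    have "(\<lambda>n. smooth_step n t) \<longlonglongrightarrow> 0"
    proof (rule Lim_null_comparison[OF always_eventually e0], rule allI)
      fix n
      have "(real n)\<^sup>2 * t \<le> 0" using False by (intro mult_nonneg_nonpos) auto
      then have "exp (real n) \<le> exp (real n - (real n)\<^sup>2 * t)" by simp
      also have "\<dots> \<le> 1 + exp (real n - (real n)\<^sup>2 * t)" by simp
      finally have "exp (real n) \<le> 1 + exp (real n - (real n)\<^sup>2 * t)" .
      then have "1 / (1 + exp (real n - (real n)\<^sup>2 * t)) \<le> 1 / exp (real n)" by (intro divide_left_mono) (auto intro!: mult_pos_pos add_pos_pos)
      then show "norm (smooth_step n t) \<le> exp (- real n)"
        using smooth_step_01[of n t] by (simp add: smooth_step_def exp_minus inverse_eq_divide)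
    qed
    then show ?thesis using False by simp
  qed
qed

text \<open>Open boxes form an intersection-stable generator, and the indicator of an open box is a
  pointwise limit of products of smooth steps, two per coordinate. These products are
  differentiable, Lipschitz and [0,1]-valued, which is the class of test functions the flow argument
  can handle.\<close>

lemma measure_eq_if_smooth_integrals_eq:
  fixes \<mu> \<mu>' :: "'a::euclidean_space measure"
  assumes p: "prob_space \<mu>" "prob_space \<mu>'" and s: "sets \<mu> = sets borel" "sets \<mu>' = sets borel"
    and eq: "\<And>f L. (\<And>x. \<exists>f'. (f has_derivative f') (at x)) \<Longrightarrow> (\<And>x. 0 \<le> f x \<and> f x \<le> (1::real)) \<Longrightarrow>
      0 \<le> L \<Longrightarrow> (\<And>x y. \<bar>f x - f y\<bar> \<le> L * norm (x - y)) \<Longrightarrow> (\<integral>x. f x \<partial>\<mu>) = (\<integral>x. f x \<partial>\<mu>')"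
  shows "\<mu> = \<mu>'"
proof -
  interpret p: prob_space \<mu> by fact
  interpret p': prob_space \<mu>' by fact
  let ?E = "range (\<lambda>(a, b). box a b :: 'a set)"
  have box: "emeasure \<mu> (box l u) = emeasure \<mu>' (box l u)" for l u :: 'a
  proof -
    define \<sigma> where "\<sigma> = (\<lambda>n x b. smooth_step n ((x - l) \<bullet> b) * smooth_step n ((u - x) \<bullet> b))"
    define f where "f = (\<lambda>n (x::'a). \<Prod>b\<in>Basis. \<sigma> n x b)"
    have \<sigma>01: "0 \<le> \<sigma> n x b" "\<sigma> n x b \<le> 1" for n x b
      unfolding \<sigma>_def using smooth_step_01 by (auto intro!: mult_le_one)
    have f01: "0 \<le> f n x \<and> f n x \<le> 1" for n x
      unfolding f_def using \<sigma>01 by (auto intro!: prod_nonneg prod_le_1)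
    have \<sigma>lip: "\<bar>\<sigma> n x b - \<sigma> n y b\<bar> \<le> 2 * (real n)\<^sup>2 * norm (x - y)" if "b \<in> Basis" for n x y and b :: 'a
    proof -
      define s t where "s = (\<lambda>x. smooth_step n ((x - l) \<bullet> b))" and "t = (\<lambda>x. smooth_step n ((u - x) \<bullet> b))"
      have xy: "\<bar>(x - y) \<bullet> b\<bar> \<le> norm (x - y)" by (rule Basis_le_norm[OF that])
      have "(real n)\<^sup>2 * \<bar>(x - y) \<bullet> b\<bar> \<le> (real n)\<^sup>2 * norm (x - y)" by (intro mult_left_mono xy) auto
      then have d: "\<bar>s x - s y\<bar> \<le> (real n)\<^sup>2 * norm (x - y)" "\<bar>t x - t y\<bar> \<le> (real n)\<^sup>2 * norm (x - y)"
        using smooth_step_lipschitz[of n "(x - l) \<bullet> b" "(y - l) \<bullet> b"] smooth_step_lipschitz[of n "(u - x) \<bullet> b" "(u - y) \<bullet> b"]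
        by (auto simp: s_def t_def inner_diff_left abs_minus_commute)
      have "\<bar>s x * t x - s y * t y\<bar> = \<bar>(s x - s y) * t x + s y * (t x - t y)\<bar>" by (simp add: algebra_simps)
      also have "\<dots> \<le> \<bar>s x - s y\<bar> * \<bar>t x\<bar> + \<bar>s y\<bar> * \<bar>t x - t y\<bar>"
        by (rule order_trans[OF abs_triangle_ineq]) (simp add: abs_mult)
      also have "\<dots> \<le> \<bar>s x - s y\<bar> * 1 + 1 * \<bar>t x - t y\<bar>"
        using smooth_step_01 by (intro add_mono mult_left_mono mult_right_mono) (auto simp: s_def t_def)
      finally show ?thesis using d by (simp add: \<sigma>_def s_def t_def)
    qed
    have int: "(\<integral>x. f n x \<partial>\<mu>) = (\<integral>x. f n x \<partial>\<mu>')" for n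
    proof (rule eq)
      show "\<exists>f'. (f n has_derivative f') (at x)" for x
      proof -
        have S: "\<exists>D. ((\<lambda>x. smooth_step n (h x)) has_derivative D) (at x)" if "(h has_derivative h') (at x)" for h h'
          using has_derivative_compose[OF that smooth_step_deriv[unfolded has_field_derivative_def]] by blast
        have "\<exists>D. ((\<lambda>x. \<sigma> n x b) has_derivative D) (at x)" for b
        proof -
          have 1: "((\<lambda>x. (x - l) \<bullet> b) has_derivative (\<lambda>h. h \<bullet> b)) (at x)"
            and 2: "((\<lambda>x. (u - x) \<bullet> b) has_derivative (\<lambda>h. - (h \<bullet> b))) (at x)"
            by (auto intro!: derivative_eq_intros)
          show ?thesis unfolding \<sigma>_def using S[OF 1] S[OF 2] has_derivative_mult by blast
        qed
        then obtain D where "\<And>b. ((\<lambda>x. \<sigma> n x b) has_derivative D b) (at x)" by metis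
        then show ?thesis unfolding f_def using has_derivative_prod[of Basis "\<lambda>b x. \<sigma> n x b" D x UNIV] by blast
      qed
      show "\<bar>f n x - f n y\<bar> \<le> (real DIM('a) * (2 * (real n)\<^sup>2)) * norm (x - y)" for x y
      proof -
        have "norm (f n x - f n y) \<le> (\<Sum>b\<in>Basis. norm (\<sigma> n x b - \<sigma> n y b))"
          unfolding f_def by (rule norm_prod_diff) (use \<sigma>01 in auto)
        also have "\<dots> \<le> (\<Sum>b\<in>(Basis::'a set). 2 * (real n)\<^sup>2 * norm (x - y))"
          by (intro sum_mono) (use \<sigma>lip in auto)
        finally show ?thesis by simp
      qed
    qed (use f01 in auto)
    have fm: "f n \<in> borel_measurable borel" for n
      unfolding f_def \<sigma>_def smooth_step_def by measurable
    have \<sigma>lim: "(\<lambda>n. \<sigma> n x b) \<longlonglongrightarrow> (if l \<bullet> b < x \<bullet> b \<and> x \<bullet> b < u \<bullet> b then 1 else 0)" for x b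
    proof -
      have "(\<lambda>n. \<sigma> n x b) \<longlonglongrightarrow> (if (x - l) \<bullet> b > 0 then 1 else 0) * (if (u - x) \<bullet> b > 0 then 1 else 0)"
        unfolding \<sigma>_def by (intro tendsto_mult smooth_step_tendsto)
      then show ?thesis by (rule back_subst[where P = "\<lambda>z. _ \<longlonglongrightarrow> z"]) (auto simp: inner_diff_left)
    qed
    have flim: "(\<lambda>n. f n x) \<longlonglongrightarrow> indicator (box l u) x" for x
    proof -
      have "(\<lambda>n. f n x) \<longlonglongrightarrow> (\<Prod>b\<in>Basis. if l \<bullet> b < x \<bullet> b \<and> x \<bullet> b < u \<bullet> b then 1 else 0)"
        unfolding f_def by (intro tendsto_prod \<sigma>lim)
      also have "(\<Prod>b\<in>Basis. if l \<bullet> b < x \<bullet> b \<and> x \<bullet> b < u \<bullet> b then 1 else 0) = (indicator (box l u) x :: real)"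
        by (auto simp: indicator_def mem_box intro!: prod.neutral)
      finally show ?thesis .
    qed
    have lim: "(\<lambda>n. \<integral>x. f n x \<partial>N) \<longlonglongrightarrow> measure N (box l u)" if N: "prob_space N" "sets N = sets borel" for N
    proof -
      interpret N: prob_space N by fact
      have sp: "space N = UNIV" using sets_eq_imp_space_eq[OF N(2)] by simp
      have "(\<lambda>n. \<integral>x. f n x \<partial>N) \<longlonglongrightarrow> (\<integral>x. indicator (box l u) x \<partial>N)"
      proof (rule integral_dominated_convergence)
        show "integrable N (\<lambda>_. 1 :: real)" by simp
        show "f n \<in> borel_measurable N" for n using fm by (simp add: measurable_cong_sets[OF N(2) refl])
        show "indicator (box l u) \<in> borel_measurable N" using N(2) by (intro borel_measurable_indicator) auto
        show "AE x in N. norm (f n x) \<le> 1" for n using f01 by (intro AE_I2) auto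
      qed (use flim in auto)
      then show ?thesis by (simp add: sp)
    qed
    have "measure \<mu> (box l u) = measure \<mu>' (box l u)"
      using lim[OF p(1) s(1)] lim[OF p(2) s(2)] unfolding int by (rule LIMSEQ_unique)
    then show ?thesis by (simp add: p.emeasure_eq_measure p'.emeasure_eq_measure)
  qed
  show ?thesis
  proof (rule measure_eqI_generator_eq)
    show "Int_stable ?E" by (auto simp: Int_stable_def box_Int_box)
    show "?E \<subseteq> Pow UNIV" "sets \<mu> = sigma_sets UNIV ?E" "sets \<mu>' = sigma_sets UNIV ?E"
      by (simp_all add: borel_eq_box s)
    let ?A = "\<lambda>n::nat. box (- (real n *\<^sub>R One)) (real n *\<^sub>R One) :: 'a set"
    show "range ?A \<subseteq> ?E" "(\<Union>i. ?A i) = UNIV" unfolding UN_box_eq_UNIV by auto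
    show "emeasure \<mu> (?A i) \<noteq> \<infinity>" for i by simp
    show "emeasure \<mu> A = emeasure \<mu>' A" if "A \<in> ?E" for A using that box by auto
  qed
qed

context bounded_flow
begin

text \<open>For a smooth test function the expectation along the pulled-back path has derivative
  \<open>E[D\<phi>(Y\<^sub>s) (Y'\<^sub>s - v s Y\<^sub>s)]\<close>, which vanishes since \<open>v s Y\<^sub>s\<close> is the conditional expectation of \<open>Y'\<^sub>s\<close>.\<close>

lemma flow_transports_law:
  fixes M :: "'w measure" and Y Y' :: "real \<Rightarrow> 'w \<Rightarrow> 'a" and R :: "'w \<Rightarrow> real"
  assumes M: "prob_space M"
    and Ym: "\<And>t. t \<in> {0..1} \<Longrightarrow> Y t \<in> borel_measurable M"
    and Yd: "\<And>t w. t \<in> {0<..<1} \<Longrightarrow> ((\<lambda>r. Y r w) has_vector_derivative Y' t w) (at t)"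
    and R: "integrable M R" "\<And>w. 0 \<le> R w"
    and Yb: "\<And>T. 0 \<le> T \<Longrightarrow> T < 1 \<Longrightarrow> \<exists>C\<ge>0. \<forall>w. \<forall>r\<in>{0..T}. \<forall>s\<in>{0..T}.
      norm (Y r w - Y s w) \<le> C * R w * \<bar>r - s\<bar> \<and> norm (Y s w) \<le> C * R w"
    and Ylim: "\<And>w. ((\<lambda>t. Y t w) \<longlongrightarrow> Y 1 w) (at 1 within {0..1})"
    and tower: "\<And>s q u C. s \<in> {0<..<1} \<Longrightarrow> q \<in> borel_measurable borel \<Longrightarrow> (\<And>x. \<bar>q x\<bar> \<le> C) \<Longrightarrow>
      integrable M (\<lambda>w. q (Y s w) * ((Y' s w - v s (Y s w)) \<bullet> u)) \<and>
      (\<integral>w. q (Y s w) * ((Y' s w - v s (Y s w)) \<bullet> u) \<partial>M) = 0"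
  shows "distr M borel (\<lambda>w. X 1 (Y 0 w)) = distr M borel (Y 1)"
proof -
  interpret M: prob_space M by fact
  have Xm: "X t \<in> borel_measurable borel" if "t \<in> {0..1}" for t
    by (rule borel_measurable_continuous_onI[OF X_continuous[OF that]])
  have Xim: "Xi t \<in> borel_measurable borel" if "t \<in> {0..1}" for t
    by (rule borel_measurable_continuous_onI[OF Xi_continuous[OF that]])
  \<comment> \<open>With g = f o X T and m r = E[g (Xi r (Y r))], the two sides are m 0 and m T, so
    it suffices that m is constant on [0, T]. T stays below 1 because the time-Lipschitz bounds hold
    only there; the case T = 1 follows by dominated convergence.\<close>
  have key: "(\<integral>w. f (X T (Y 0 w)) \<partial>M) = (\<integral>w. f (Y T w) \<partial>M)"
    if T: "T \<in> {0<..<1}" and fd: "\<And>x. \<exists>f'. (f has_derivative f') (at x)"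
      and f01: "\<And>x. 0 \<le> f x \<and> f x \<le> (1::real)" and Lf: "0 \<le> Lf"
      and flip: "\<And>x y. \<bar>f x - f y\<bar> \<le> Lf * norm (x - y)" for f T Lf
  proof -
    have T': "0 \<le> T" "T < 1" "T \<in> {0..1}" using T by auto
    define g where "g = (\<lambda>x. f (X T x))"
    define Lg where "Lg = Lf * E"
    have Lg: "0 \<le> Lg" using Lf E_pos by (simp add: Lg_def)
    have glip: "\<bar>g x - g y\<bar> \<le> Lg * norm (x - y)" for x y
    proof -
      have "\<bar>g x - g y\<bar> \<le> Lf * norm (X T x - X T y)" unfolding g_def by (rule flip)
      also have "\<dots> \<le> Lf * (E * norm (x - y))" by (intro mult_left_mono X_upper T' Lf)
      finally show ?thesis by (simp add: Lg_def)
    qed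
    have gd: "\<exists>g'. (g has_derivative g') (at x)" for x
    proof -
      obtain f' X' where "(f has_derivative f') (at (X T x))" "(X T has_derivative X') (at x)"
        using fd X_differentiable[OF T'(3)] by meson
      then show ?thesis unfolding g_def using has_derivative_compose by blast
    qed
    have gc: "continuous_on UNIV g" using gd has_derivative_continuous by (intro continuous_at_imp_continuous_on) blast
    have gm: "g \<in> borel_measurable borel" by (rule borel_measurable_continuous_onI[OF gc])
    define \<phi> where "\<phi> = (\<lambda>r w. g (Xi r (Y r w)))"
    have \<phi>m: "\<phi> r \<in> borel_measurable M" if "r \<in> {0..1}" for r
      unfolding \<phi>_def using gm Xim[OF that] Ym[OF that] by measurable
    have \<phi>i: "integrable M (\<phi> r)" if "r \<in> {0..1}" for r
      by (rule M.integrable_const_bound[where B = 1, OF _ \<phi>m[OF that]]) (use f01 in \<open>auto simp: \<phi>_def g_def\<close>)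
    obtain C1 where C1: "0 \<le> C1" "\<And>w r s. r \<in> {0..T} \<Longrightarrow> s \<in> {0..T} \<Longrightarrow>
      norm (Y r w - Y s w) \<le> C1 * R w * \<bar>r - s\<bar> \<and> norm (Y s w) \<le> C1 * R w" using Yb[OF T'(1,2)] by blast
    obtain C where C: "0 \<le> C"
      "\<And>r s I. r \<in> {0..T} \<Longrightarrow> s \<in> {0..T} \<Longrightarrow>
        norm (Xi r (I r) - Xi s (I s)) \<le> E * norm (I r - I s) + C * (1 + norm (I s)) * \<bar>r - s\<bar>"
      using pulled_back_path_lipschitz[OF T'(1,2)] by blast
    \<comment> \<open>An integrable Lipschitz constant in time of the random path
      \<open>\<phi>\<close>; it yields the continuity of the expectation and dominates its
      difference quotients.\<close>
    define Q where "Q = (\<lambda>w. Lg * (E * (C1 * R w) + C * (1 + C1 * R w)))"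
    have Qi: "integrable M Q" unfolding Q_def using R(1) by simp
    have \<phi>lip: "norm (\<phi> r w - \<phi> s w) \<le> Q w * norm (r - s)" if rs: "r \<in> {0..T}" "s \<in> {0..T}" for r s w
    proof -
      have "norm (\<phi> r w - \<phi> s w) \<le> Lg * norm (Xi r (Y r w) - Xi s (Y s w))" unfolding \<phi>_def real_norm_def by (rule glip)
      also have "\<dots> \<le> Lg * (E * norm (Y r w - Y s w) + C * (1 + norm (Y s w)) * \<bar>r - s\<bar>)"
        using C(2)[OF rs, of "\<lambda>r. Y r w"] by (intro mult_left_mono Lg) auto
      also have "\<dots> \<le> Lg * (E * (C1 * R w * \<bar>r - s\<bar>) + C * (1 + C1 * R w) * \<bar>r - s\<bar>)"
        using C1(2)[OF rs, of w] E_pos C(1) by (intro mult_left_mono Lg add_mono mult_right_mono) auto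
      finally show ?thesis by (simp add: Q_def algebra_simps)
    qed
    define m where "m = (\<lambda>r. \<integral>w. \<phi> r w \<partial>M)"
    have mlip: "norm (m r - m s) \<le> (\<integral>w. Q w \<partial>M) * norm (r - s)" if rs: "r \<in> {0..T}" "s \<in> {0..T}" for r s
    proof -
      have rs': "r \<in> {0..1}" "s \<in> {0..1}" using rs T' by auto
      have "m r - m s = (\<integral>w. \<phi> r w - \<phi> s w \<partial>M)" unfolding m_def using \<phi>i rs' by simp
      also have "norm \<dots> \<le> (\<integral>w. Q w * norm (r - s) \<partial>M)"
        by (rule order_trans[OF integral_norm_bound], rule integral_mono)
           (use Qi \<phi>i rs' \<phi>lip[OF rs] in auto)
      finally show ?thesis by simp
    qed
    have Q0: "0 \<le> (\<integral>w. Q w \<partial>M)"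
      using Lg E_pos C1(1) C(1) R(2) by (intro Bochner_Integration.integral_nonneg) (auto simp: Q_def)
    have mcont: "continuous_on {0..T} m"
      by (rule lipschitz_on_continuous_on[of "\<integral>w. Q w \<partial>M"], rule lipschitz_onI)
         (use mlip Q0 in \<open>auto simp: dist_norm\<close>)
    have mder: "(m has_real_derivative 0) (at s)" if s: "0 < s" "s < T" for s
    proof -
      have s1: "s \<in> {0<..<1}" "s \<in> {0..1}" "0 < s" "s < 1" using s T' by auto
      define p where "p = (\<lambda>z. g (Xi s z))"
      have pd: "\<exists>p'. (p has_derivative p') (at z)" for z
      proof -
        obtain g' X' where "(g has_derivative g') (at (Xi s z))" "(Xi s has_derivative X') (at z)"
          using gd Xi_differentiable[OF s1(2)] by meson
        then show ?thesis unfolding p_def using has_derivative_compose by blast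
      qed
      define Dp where "Dp = (\<lambda>z. frechet_derivative p (at z))"
      have Dp: "(p has_derivative Dp z) (at z)" for z
        unfolding Dp_def frechet_derivative_works[symmetric] differentiable_def by (rule pd)
      have plin: "linear (Dp z)" for z by (rule has_derivative_linear[OF Dp])
      have pc: "continuous_on UNIV p" using pd has_derivative_continuous by (intro continuous_at_imp_continuous_on) blast
      have pm: "p \<in> borel_measurable borel" by (rule borel_measurable_continuous_onI[OF pc])
      have plip: "\<bar>p x - p y\<bar> \<le> Lg * E * norm (x - y)" for x y
      proof -
        have "\<bar>p x - p y\<bar> \<le> Lg * norm (Xi s x - Xi s y)" unfolding p_def by (rule glip)
        also have "\<dots> \<le> Lg * (E * norm (x - y))" by (intro mult_left_mono Xi_lip s1 Lg)
        finally show ?thesis by simp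
      qed
      have Dpb: "\<bar>Dp z b\<bar> \<le> Lg * E * norm b" for z b
        using has_derivative_norm_le[OF Dp always_eventually, of z "Lg * E" b] plip by simp
      \<comment> \<open>\<open>p\<close> is differentiable but its derivative need not be
        continuous; measurability comes from writing it as a limit of difference quotients along
        1/(n+1).\<close>
      have Dpm: "(\<lambda>z. Dp z b) \<in> borel_measurable borel" for b
      proof (rule borel_measurable_LIMSEQ_real)
        show "(\<lambda>n. (p (z + (1 / real (Suc n)) *\<^sub>R b) - p z) / (1 / real (Suc n))) \<longlonglongrightarrow> Dp z b" for z
        proof -
          have "((\<lambda>t. p (z + t *\<^sub>R b)) has_derivative (\<lambda>h. Dp z (h *\<^sub>R b))) (at 0)"
            by (rule has_derivative_compose[where g = p and f = "\<lambda>t. z + t *\<^sub>R b"])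
               (use Dp[of z] in \<open>auto intro!: derivative_eq_intros\<close>)
          then have "((\<lambda>t. p (z + t *\<^sub>R b)) has_real_derivative Dp z b) (at 0)"
            unfolding has_field_derivative_def
            by (rule has_derivative_eq_rhs) (auto simp: linear_scale[OF plin])
          then have "((\<lambda>h. (p (z + h *\<^sub>R b) - p z) / h) \<longlongrightarrow> Dp z b) (at 0)"
            unfolding DERIV_def by simp
          moreover have "filterlim (\<lambda>n. 1 / real (Suc n)) (at 0) sequentially"
            unfolding filterlim_at using LIMSEQ_inverse_real_of_nat by (auto simp: inverse_eq_divide)
          ultimately show ?thesis by (rule filterlim_compose)
        qed
        show "(\<lambda>z. (p (z + (1 / real (Suc n)) *\<^sub>R b) - p z) / (1 / real (Suc n))) \<in> borel_measurable borel" for n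
          using pm by measurable
      qed
      define W where "W = (\<lambda>w. Y' s w - v s (Y s w))"
      \<comment> \<open>The conditional expectation is tested in fixed directions only. In a basis
        expansion each coefficient is a bounded measurable function of \<open>Y s\<close>, which is
        an admissible test function.\<close>
      have DW: "Dp (Y s w) (W w) = (\<Sum>b\<in>Basis. Dp (Y s w) b * (W w \<bullet> b))" for w
        by (subst linear_sum_Basis[OF plin]) (simp add: mult.commute)
      have tw: "integrable M (\<lambda>w. Dp (Y s w) b * (W w \<bullet> b)) \<and> (\<integral>w. Dp (Y s w) b * (W w \<bullet> b) \<partial>M) = 0" for b
        unfolding W_def by (rule tower[OF s1(1) Dpm Dpb])
      have zero: "(\<integral>w. Dp (Y s w) (W w) \<partial>M) = 0"
        unfolding DW using tw by (subst Bochner_Integration.integral_sum) auto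
      have Wm: "(\<lambda>w. Dp (Y s w) (W w)) \<in> borel_measurable M"
        unfolding DW using tw by (intro borel_measurable_sum) (auto dest: borel_measurable_integrable)
      define \<delta> where "\<delta> = min s (T - s)"
      have \<delta>: "\<delta> > 0" using s by (simp add: \<delta>_def)
      have near: "z \<in> {0..T}" if "norm (z - s) < \<delta>" for z using that by (auto simp: \<delta>_def)
      have "((\<lambda>r. \<integral>w. \<phi> r w \<partial>M) has_derivative (\<lambda>h. \<integral>w. h *\<^sub>R Dp (Y s w) (W w) \<partial>M)) (at s)"
      proof (rule has_derivative_lebesgue_integral[where \<delta> = \<delta> and B = Q])
        show "integrable M (\<phi> z)" if "norm (z - s) < \<delta>" for z using near[OF that] T' by (intro \<phi>i) auto
        show "((\<lambda>z. \<phi> z w) has_derivative (\<lambda>h. h *\<^sub>R Dp (Y s w) (W w))) (at s)" for w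
        proof -
          have "((\<lambda>z. g (Xi s z)) has_derivative Dp (Y s w)) (at (Y s w))" using Dp[of "Y s w"] by (simp add: p_def)
          from pulled_back_path[OF s1(3,4) Yd[OF s1(1), of w] this]
          show ?thesis by (simp add: has_vector_derivative_def \<phi>_def W_def)
        qed
        show "norm (\<phi> z w - \<phi> s w) \<le> Q w * norm (z - s)" if "norm (z - s) < \<delta>" for w z
          using s by (intro \<phi>lip near[OF that]) auto
        show "(\<lambda>w. h *\<^sub>R Dp (Y s w) (W w)) \<in> borel_measurable M" for h using Wm by measurable
      qed (use \<delta> Qi in auto)
      then show ?thesis unfolding has_field_derivative_def m_def
        by (rule has_derivative_eq_rhs) (auto simp: zero)
    qed
    have "m T = m 0" by (rule DERIV_isconst_end[OF _ mcont mder]) (use T in auto)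
    moreover have "Xi 0 z = z" for z using Xi_X[of 0 z] by (simp add: X_0)
    ultimately show ?thesis using T' by (simp add: m_def \<phi>_def g_def)
  qed
  show ?thesis
  proof (rule measure_eq_if_smooth_integrals_eq)
    have m1: "(\<lambda>w. X t (Y 0 w)) \<in> borel_measurable M" if "t \<in> {0..1}" for t
      using Xm[OF that] Ym[of 0] by simp
    show "prob_space (distr M borel (\<lambda>w. X 1 (Y 0 w)))" "prob_space (distr M borel (Y 1))"
      using m1[of 1] Ym[of 1] by (auto intro!: M.prob_space_distr)
    fix f :: "'a \<Rightarrow> real" and Lf
    assume f: "\<And>x. \<exists>f'. (f has_derivative f') (at x)" "\<And>x. 0 \<le> f x \<and> f x \<le> 1" "0 \<le> Lf"
      "\<And>x y. \<bar>f x - f y\<bar> \<le> Lf * norm (x - y)"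
    have fc: "continuous_on UNIV f" using f(1) has_derivative_continuous by (intro continuous_at_imp_continuous_on) blast
    have fm: "f \<in> borel_measurable borel" by (rule borel_measurable_continuous_onI[OF fc])
    \<comment> \<open>Two successors make the sequence start at 1/2, so that every term lies
      strictly between 0 and 1, as \<open>key\<close> requires.\<close>
    define \<tau> where "\<tau> = (\<lambda>n. 1 - 1 / real (Suc (Suc n)))"
    have \<tau>: "\<tau> n \<in> {0<..<1}" "\<tau> n \<in> {0..1}" for n by (simp_all add: \<tau>_def)
    have \<tau>lim: "\<tau> \<longlonglongrightarrow> 1"
      unfolding \<tau>_def using tendsto_diff[OF tendsto_const[of 1] LIMSEQ_Suc[OF LIMSEQ_inverse_real_of_nat]]
      by (simp add: inverse_eq_divide)
    have \<tau>f: "filterlim \<tau> (at 1 within {0..1}) sequentially"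
      unfolding filterlim_at using \<tau> \<tau>lim by (auto intro!: always_eventually simp: less_imp_neq)
    have conv: "(\<lambda>n. \<integral>w. f (h (\<tau> n) w) \<partial>M) \<longlonglongrightarrow> (\<integral>w. f (h 1 w) \<partial>M)"
      if hm: "\<And>t. t \<in> {0..1} \<Longrightarrow> h t \<in> borel_measurable M"
        and hl: "\<And>w. ((\<lambda>t. h t w) \<longlongrightarrow> h 1 w) (at 1 within {0..1})" for h :: "real \<Rightarrow> 'w \<Rightarrow> 'a"
    proof (rule integral_dominated_convergence)
      show "AE w in M. (\<lambda>n. f (h (\<tau> n) w)) \<longlonglongrightarrow> f (h 1 w)"
        by (intro AE_I2 continuous_on_tendsto_compose[OF fc] filterlim_compose[OF hl \<tau>f]) auto
      show "(\<lambda>w. f (h (\<tau> n) w)) \<in> borel_measurable M" for n using fm hm[OF \<tau>(2)] by measurable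
      show "(\<lambda>w. f (h 1 w)) \<in> borel_measurable M" using fm hm[of 1] by simp
      show "AE w in M. norm (f (h (\<tau> n) w)) \<le> 1" for n using f(2) by (intro AE_I2) auto
    qed simp
    have 1: "(\<lambda>n. \<integral>w. f (X (\<tau> n) (Y 0 w)) \<partial>M) \<longlonglongrightarrow> (\<integral>w. f (X 1 (Y 0 w)) \<partial>M)"
    proof (rule conv[OF m1])
      show "((\<lambda>t. X t (Y 0 w)) \<longlongrightarrow> X 1 (Y 0 w)) (at 1 within {0..1})" for w
        using X_cont[of "Y 0 w"] by (simp add: continuous_on_def)
    qed
    have 2: "(\<lambda>n. \<integral>w. f (Y (\<tau> n) w) \<partial>M) \<longlonglongrightarrow> (\<integral>w. f (Y 1 w) \<partial>M)"
      by (rule conv[OF Ym Ylim])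
    have "(\<lambda>n. \<integral>w. f (X (\<tau> n) (Y 0 w)) \<partial>M) = (\<lambda>n. \<integral>w. f (Y (\<tau> n) w) \<partial>M)"
      using key[OF \<tau>(1) f] by blast
    with 1 2 have "(\<integral>w. f (X 1 (Y 0 w)) \<partial>M) = (\<integral>w. f (Y 1 w) \<partial>M)" using LIMSEQ_unique by metis
    then show "(\<integral>x. f x \<partial>distr M borel (\<lambda>w. X 1 (Y 0 w))) = (\<integral>x. f x \<partial>distr M borel (Y 1))"
      using fm m1[of 1] Ym[of 1] by (simp add: integral_distr)
  qed simp_all
qed

end

section \<open>The three classes of target measures\<close>

lemma first_order_upper:
  fixes U :: "'a::real_inner \<Rightarrow> real"
  assumes U: "\<And>x. (U has_derivative (\<lambda>h. G x \<bullet> h)) (at x)"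
    and mono: "\<And>z. (G z - G x) \<bullet> (z - x) \<le> c * (norm (z - x))\<^sup>2"
  shows "U y \<le> U x + G x \<bullet> (y - x) + c / 2 * (norm (y - x))\<^sup>2"
proof -
  define d where "d = y - x"
  define g where "g = (\<lambda>s. U (x + s *\<^sub>R d) - (G x \<bullet> d) * s - c / 2 * (norm d)\<^sup>2 * s\<^sup>2)"
  have dg: "(g has_real_derivative (G (x + s *\<^sub>R d) \<bullet> d - G x \<bullet> d - c * (norm d)\<^sup>2 * s)) (at s)" for s
  proof -
    have "((\<lambda>s. U (x + s *\<^sub>R d)) has_derivative (\<lambda>h. G (x + s *\<^sub>R d) \<bullet> (h *\<^sub>R d))) (at s)"
      by (rule has_derivative_compose[OF _ U]) (auto intro!: derivative_eq_intros)
    then have 1: "((\<lambda>s. U (x + s *\<^sub>R d)) has_real_derivative G (x + s *\<^sub>R d) \<bullet> d) (at s)"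
      unfolding has_field_derivative_def by (rule has_derivative_eq_rhs) (auto simp: mult.commute)
    show ?thesis unfolding g_def by (auto intro!: derivative_eq_intros 1)
  qed
  have "g 1 \<le> g 0"
  proof (rule DERIV_nonpos_imp_decreasing_open[where f = g and a = 0 and b = 1])
    show "\<exists>l. (g has_real_derivative l) (at s) \<and> l \<le> 0" if s: "0 < s" "s < 1" for s
    proof -
      have "s * ((G (x + s *\<^sub>R d) - G x) \<bullet> d) \<le> s * (c * (norm d)\<^sup>2 * s)"
        using mono[of "x + s *\<^sub>R d"] s by (simp add: power2_eq_square ac_simps)
      then have "(G (x + s *\<^sub>R d) - G x) \<bullet> d \<le> c * (norm d)\<^sup>2 * s" using s by simp
      then have "G (x + s *\<^sub>R d) \<bullet> d - G x \<bullet> d - c * (norm d)\<^sup>2 * s \<le> 0" by (simp add: inner_diff_left)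
      with dg[of s] show ?thesis by blast
    qed
    show "continuous_on {0..1} g" using dg by (intro continuous_at_imp_continuous_on) (auto intro: DERIV_isCont)
  qed simp
  then show ?thesis by (simp add: g_def d_def)
qed

lemma gradient_monotone_of_hessian:
  fixes G :: "'a::real_inner \<Rightarrow> 'a"
  assumes G: "\<And>x. (G has_derivative D x) (at x)" and D: "\<And>x h. h \<bullet> D x h \<le> c * (h \<bullet> h)"
  shows "(G y - G x) \<bullet> (y - x) \<le> c * (norm (y - x))\<^sup>2"
proof -
  define d where "d = y - x"
  define g where "g = (\<lambda>s. G (x + s *\<^sub>R d) \<bullet> d - c * (norm d)\<^sup>2 * s)"
  have dg: "(g has_real_derivative (D (x + s *\<^sub>R d) d \<bullet> d - c * (norm d)\<^sup>2)) (at s)" for s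
  proof -
    have "((\<lambda>s. G (x + s *\<^sub>R d)) has_derivative (\<lambda>h. D (x + s *\<^sub>R d) (h *\<^sub>R d))) (at s)"
      by (rule has_derivative_compose[OF _ G]) (auto intro!: derivative_eq_intros)
    then have "((\<lambda>s. G (x + s *\<^sub>R d) \<bullet> d) has_derivative (\<lambda>h. D (x + s *\<^sub>R d) (h *\<^sub>R d) \<bullet> d)) (at s)"
      by (rule has_derivative_inner_left)
    then have 1: "((\<lambda>s. G (x + s *\<^sub>R d) \<bullet> d) has_real_derivative D (x + s *\<^sub>R d) d \<bullet> d) (at s)"
      unfolding has_field_derivative_def
      by (rule has_derivative_eq_rhs) (auto simp: linear_scale[OF has_derivative_linear[OF G]] mult.commute)
    show ?thesis unfolding g_def by (auto intro!: derivative_eq_intros 1)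
  qed
  have "g 1 \<le> g 0"
  proof (rule DERIV_nonpos_imp_nonincreasing[where f = g and a = 0 and b = 1])
    fix s
    have "D (x + s *\<^sub>R d) d \<bullet> d - c * (norm d)\<^sup>2 \<le> 0"
      using D[of d "x + s *\<^sub>R d"] by (simp add: inner_commute power2_norm_eq_inner)
    with dg[of s] show "\<exists>l. (g has_real_derivative l) (at s) \<and> l \<le> 0" by blast
  qed simp
  then show ?thesis by (simp add: g_def d_def inner_diff_left)
qed

text \<open>The gradient of a function with \<open>\<kappa> \<le> \<nabla>\<^sup>2U \<le> \<beta>\<close> is co-coercive after subtracting \<open>\<kappa>x\<close>;
  this avoids the symmetry of the Hessian.\<close>

lemma gradient_lipschitz:
  fixes U :: "'a::real_inner \<Rightarrow> real"
  assumes U: "\<And>x. (U has_derivative (\<lambda>h. G x \<bullet> h)) (at x)"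
    and up: "\<And>x y. (G y - G x) \<bullet> (y - x) \<le> \<beta> * (norm (y - x))\<^sup>2"
    and lo: "\<And>x y. \<kappa> * (norm (y - x))\<^sup>2 \<le> (G y - G x) \<bullet> (y - x)" and l: "\<kappa> < \<beta>"
  shows "norm (G x - G y) \<le> (\<beta> - \<kappa> + \<bar>\<kappa>\<bar>) * norm (x - y)"
proof -
  define l where "l = \<beta> - \<kappa>"
  have l0: "l > 0" using l by (simp add: l_def)
  define V where "V = (\<lambda>x. U x - \<kappa> / 2 * (norm x)\<^sup>2)"
  define g where "g = (\<lambda>x. G x - \<kappa> *\<^sub>R x)"
  have V: "(V has_derivative (\<lambda>h. g x \<bullet> h)) (at x)" for x
    unfolding V_def g_def power2_norm_eq_inner
    by (auto intro!: derivative_eq_intros U simp: inner_diff_right inner_commute fun_eq_iff)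
  have g: "(g y - g x) \<bullet> (y - x) \<le> l * (norm (y - x))\<^sup>2" "0 \<le> (g y - g x) \<bullet> (y - x)" for x y
  proof -
    have "(g y - g x) \<bullet> (y - x) = (G y - G x) \<bullet> (y - x) - \<kappa> * (norm (y - x))\<^sup>2"
      by (simp add: g_def power2_norm_eq_inner inner_diff_left inner_diff_right algebra_simps)
    then show "(g y - g x) \<bullet> (y - x) \<le> l * (norm (y - x))\<^sup>2" "0 \<le> (g y - g x) \<bullet> (y - x)"
      using up[of y x] lo[of y x] by (auto simp: l_def algebra_simps)
  qed
  have V_up: "V z \<le> V y + g y \<bullet> (z - y) + l / 2 * (norm (z - y))\<^sup>2" for y z
    by (rule first_order_upper[OF V g(1)])
  have V_lo: "V x + g x \<bullet> (z - x) \<le> V z" for x z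
  proof -
    have "- V z \<le> - V x + - g x \<bullet> (z - x) + 0 / 2 * (norm (z - x))\<^sup>2"
    proof (rule first_order_upper[where U = "\<lambda>x. - V x" and G = "\<lambda>x. - g x"])
      show "((\<lambda>x. - V x) has_derivative (\<lambda>h. - g x \<bullet> h)) (at x)" for x
        using has_derivative_minus[OF V[of x]] by simp
      show "(- g z - - g x) \<bullet> (z - x) \<le> 0 * (norm (z - x))\<^sup>2" for z
        using g(2)[of z x] by (simp add: inner_diff_left)
    qed
    then show ?thesis by simp
  qed
  have coco: "V x - V y + g x \<bullet> (y - x) + (norm (g x - g y))\<^sup>2 / (2 * l) \<le> 0" for x y
  proof -
    define p where "p = g x - g y"
    \<comment> \<open>This z minimises the quadratic upper bound of \<open>V\<close> at y minus the
      tangent of \<open>V\<close> at x; comparing the two bounds there gives the sharpest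
      inequality.\<close>
    define z where "z = y + (1 / l) *\<^sub>R p"
    have "V x + g x \<bullet> (z - x) \<le> V y + g y \<bullet> (z - y) + l / 2 * (norm (z - y))\<^sup>2"
      using V_lo[of x z] V_up[of z y] by linarith
    moreover have "g x \<bullet> (z - x) = g x \<bullet> (y - x) + g x \<bullet> p / l"
      by (simp add: z_def inner_diff_right inner_add_right)
    moreover have "g y \<bullet> (z - y) = g y \<bullet> p / l" by (simp add: z_def)
    moreover have "l / 2 * (norm (z - y))\<^sup>2 = (norm p)\<^sup>2 / (2 * l)"
      using l0 by (simp add: z_def power_mult_distrib power_divide power2_eq_square)
    moreover have "g x \<bullet> p / l - g y \<bullet> p / l = (norm p)\<^sup>2 / l"
      by (simp add: p_def power2_norm_eq_inner inner_diff_left diff_divide_distrib)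
    moreover have "(norm p)\<^sup>2 / l = (norm p)\<^sup>2 / (2 * l) + (norm p)\<^sup>2 / (2 * l)" by simp
    ultimately show ?thesis unfolding p_def[symmetric] by linarith
  qed
  define p where "p = g x - g y"
  have "(norm p)\<^sup>2 / l \<le> p \<bullet> (x - y)"
  proof -
    have "(norm p)\<^sup>2 / l = (norm p)\<^sup>2 / (2 * l) + (norm p)\<^sup>2 / (2 * l)" by simp
    moreover have "norm (g y - g x) = norm p" by (simp add: p_def norm_minus_commute)
    moreover have "g x \<bullet> (y - x) + g y \<bullet> (x - y) = - (p \<bullet> (x - y))"
      by (simp add: p_def inner_diff_left inner_diff_right)
    ultimately show ?thesis using coco[of x y] coco[of y x] unfolding p_def[symmetric] by simp
  qed
  also have "\<dots> \<le> norm p * norm (x - y)" by (rule norm_cauchy_schwarz)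
  finally have "norm p * norm p \<le> norm p * (l * norm (x - y))"
    using l0 by (simp add: divide_le_eq power2_eq_square ac_simps)
  then have p: "norm p \<le> l * norm (x - y)" using l0 by (cases "norm p = 0") auto
  have "G x - G y = p + \<kappa> *\<^sub>R (x - y)" by (simp add: p_def g_def scaleR_diff_right)
  then have "norm (G x - G y) \<le> norm p + \<bar>\<kappa>\<bar> * norm (x - y)"
    using norm_triangle_ineq[of p "\<kappa> *\<^sub>R (x - y)"] by simp
  then show ?thesis using p by (simp add: l_def algebra_simps)
qed

lemma mat_vector_mult: "mat k *v (x :: real^'n) = k *\<^sub>R x"
  by (simp add: vec_eq_iff matrix_vector_mult_def mat_def if_distrib[where f = "\<lambda>z. z * _"] cong: if_cong)

definition gauss_const :: "real \<Rightarrow> nat \<Rightarrow> real" where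
  "gauss_const s n = (1 / sqrt (2 * pi * s\<^sup>2)) ^ n"

lemma gauss_const_pos: "s > 0 \<Longrightarrow> 0 < gauss_const s n"
  by (simp add: gauss_const_def)

lemma prod_normal_density:
  "(\<Prod>i\<in>UNIV. normal_density 0 s ((x :: real^'n) $ i)) = gauss_const s CARD('n) * exp (- (norm x)\<^sup>2 / (2 * s\<^sup>2))"
proof -
  have "(norm x)\<^sup>2 = (\<Sum>i\<in>UNIV. (x $ i)\<^sup>2)"
    unfolding power2_norm_eq_inner inner_vec_def by (simp add: power2_eq_square)
  then have "exp (- (norm x)\<^sup>2 / (2 * s\<^sup>2)) = (\<Prod>i\<in>UNIV. exp (- (x $ i)\<^sup>2 / (2 * s\<^sup>2)))"
    by (simp add: exp_sum[symmetric] sum_negf sum_divide_distrib)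
  then show ?thesis unfolding normal_density_def prod.distrib gauss_const_def by simp
qed

lemma gaussian_eq:
  "gaussian s = density lborel (\<lambda>x :: real^'n. ennreal (gauss_const s CARD('n) * exp (- (norm x)\<^sup>2 / (2 * s\<^sup>2))))"
  unfolding gaussian_def prod_normal_density ..

section \<open>From the three classes of densities to a potential\<close>

lemma potential_unique:
  fixes U U' :: "'a::euclidean_space \<Rightarrow> real"
  assumes c: "continuous_on UNIV U" "continuous_on UNIV U'"
    and eq: "density lborel (\<lambda>x. ennreal (exp (- U x))) = density lborel (\<lambda>x. ennreal (exp (- U' x)))"
  shows "U = U'"
proof (rule continuous_AE_lborel_eq[OF c])
  have m: "U \<in> borel_measurable borel" "U' \<in> borel_measurable borel"
    using c by (auto intro: borel_measurable_continuous_onI)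
  have "AE x in lborel. ennreal (exp (- U x)) = ennreal (exp (- U' x))"
    by (rule sigma_finite_measure.density_unique[OF sigma_finite_lborel _ _ eq]) (use m in measurable)
  then show "AE x in lborel. U x = U' x" by eventually_elim simp
qed

lemma semi_log_cases:
  fixes \<nu> :: "(real^'n) measure"
  assumes cx: "semi_log_convex \<beta> \<nu>" and cc: "semi_log_concave \<kappa> \<nu>" and supp: "msupport \<nu> = UNIV"
  obtains U G B where "\<nu> = density lborel (\<lambda>x. ennreal (exp (- U x)))"
    "\<And>x. (U has_derivative (\<lambda>h. G x \<bullet> h)) (at x)" "\<And>x. \<exists>G'. (G has_derivative G') (at x)"
    "0 \<le> B" "\<And>x y. norm (G x - G y) \<le> B * norm (x - y)"
    "\<And>x y. \<kappa> * (norm (x - y))\<^sup>2 \<le> (G x - G y) \<bullet> (x - y)"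
proof -
  obtain U H where 1: "exp_potential_measure \<nu> U" "C2_with_hessian UNIV U H" "\<And>x. loewner_le (H x) (mat \<beta>)"
    using cx supp unfolding semi_log_convex_def by auto
  obtain U' H' where 2: "exp_potential_measure \<nu> U'" "C2_with_hessian UNIV U' H'" "\<And>x. loewner_le (mat \<kappa>) (H' x)"
    using cc supp unfolding semi_log_concave_def by auto
  obtain G where G: "\<And>x. (U has_derivative (\<lambda>h. G x \<bullet> h)) (at x)" "\<And>x. (G has_derivative (\<lambda>h. H x *v h)) (at x)"
    using 1(2) unfolding C2_with_hessian_def by auto
  obtain G' where G': "\<And>x. (U' has_derivative (\<lambda>h. G' x \<bullet> h)) (at x)" "\<And>x. (G' has_derivative (\<lambda>h. H' x *v h)) (at x)"
    using 2(2) unfolding C2_with_hessian_def by auto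
  have d: "\<nu> = density lborel (\<lambda>x. ennreal (exp (- U x)))" "\<nu> = density lborel (\<lambda>x. ennreal (exp (- U' x)))"
    using 1(1) 2(1) supp unfolding exp_potential_measure_def by simp_all
  \<comment> \<open>Convexity and concavity each come with a potential of their own. Both are
    continuous and give the same density, so the two Hessian bounds can be combined.\<close>
  have "U = U'"
  proof (rule potential_unique)
    show "continuous_on UNIV U" "continuous_on UNIV U'"
      using has_derivative_continuous[OF G(1)] has_derivative_continuous[OF G'(1)]
      by (auto intro!: continuous_at_imp_continuous_on)
    show "density lborel (\<lambda>x. ennreal (exp (- U x))) = density lborel (\<lambda>x. ennreal (exp (- U' x)))"
      using d by metis
  qed
  have GG: "G' = G"
  proof
    fix x
    have "(\<lambda>h. G' x \<bullet> h) = (\<lambda>h. G x \<bullet> h)"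
      using G'(1)[of x] G(1)[of x] \<open>U = U'\<close> has_derivative_unique by blast
    then have "G' x \<bullet> h = G x \<bullet> h" for h by (rule fun_cong)
    then show "G' x = G x" using vector_eq_rdot by blast
  qed
  \<comment> \<open>The maximum with \<kappa> + 1 guarantees the strict gap between the two
    constants in \<open>gradient_lipschitz\<close>.\<close>
  have up: "(G y - G x) \<bullet> (y - x) \<le> (max \<beta> (\<kappa> + 1)) * (norm (y - x))\<^sup>2" for x y
  proof -
    have "(G y - G x) \<bullet> (y - x) \<le> \<beta> * (norm (y - x))\<^sup>2"
      by (rule gradient_monotone_of_hessian[OF G(2)]) (use 1(3) in \<open>simp add: loewner_le_def mat_vector_mult\<close>)
    also have "\<dots> \<le> (max \<beta> (\<kappa> + 1)) * (norm (y - x))\<^sup>2" by (intro mult_right_mono) auto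
    finally show ?thesis .
  qed
  have lo: "\<kappa> * (norm (y - x))\<^sup>2 \<le> (G y - G x) \<bullet> (y - x)" for x y
  proof -
    have "(- G y - - G x) \<bullet> (y - x) \<le> (- \<kappa>) * (norm (y - x))\<^sup>2"
    proof (rule gradient_monotone_of_hessian[where D = "\<lambda>x h. - (H' x *v h)"])
      show "((\<lambda>x. - G x) has_derivative (\<lambda>h. - (H' x *v h))) (at x)" for x
        using has_derivative_minus[OF G'(2)[of x]] by (simp add: GG)
      show "h \<bullet> - (H' x *v h) \<le> - \<kappa> * (h \<bullet> h)" for x h
        using 2(3)[of x] by (simp add: loewner_le_def mat_vector_mult)
    qed
    then show ?thesis by (simp add: inner_diff_left)
  qed
  show thesis
  proof (rule that[OF d(1) G(1)])
    show "\<exists>G'. (G has_derivative G') (at x)" for x using G(2) by blast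
    show "norm (G x - G y) \<le> (max \<beta> (\<kappa> + 1) - \<kappa> + \<bar>\<kappa>\<bar>) * norm (x - y)" for x y
      by (rule gradient_lipschitz[OF G(1) up lo]) auto
    show "\<kappa> * (norm (x - y))\<^sup>2 \<le> (G x - G y) \<bullet> (x - y)" for x y by (rule lo)
    show "0 \<le> max \<beta> (\<kappa> + 1) - \<kappa> + \<bar>\<kappa>\<bar>" by auto
  qed
qed

text \<open>The reference Gaussian has potential |x|^2 / 2, so the gradient of ln f is x - G x, and
  the Lipschitz condition bounds it by L. Hence \<open>G\<close> is the identity up to a bounded
  field: monotone with constant 1 and loss 2L, whatever the sign of the lower Hessian bound.\<close>

lemma potential_log_lipschitz:
  fixes U f :: "real^'n \<Rightarrow> real"
  assumes U: "\<And>x. (U has_derivative (\<lambda>h. G x \<bullet> h)) (at x)"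
    and eq: "density lborel (\<lambda>x. ennreal (exp (- U x))) = density (gaussian 1) (\<lambda>x. ennreal (f x))"
    and f: "log_lipschitz L f" "f \<in> borel_measurable borel"
  shows "norm (x - y)^2 - 2 * L * norm (x - y) \<le> (G x - G y) \<bullet> (x - y)"
proof -
  define C where "C = gauss_const 1 CARD('n)"
  have C: "C > 0" by (simp add: C_def gauss_const_pos)
  have fpos: "0 < f x" for x using f(1) by (simp add: log_lipschitz_def)
  have flip: "\<bar>ln (f x) - ln (f y)\<bar> \<le> L * norm (x - y)" for x y
    using f(1) lipschitz_onD[of L UNIV "\<lambda>x. ln (f x)" x y] by (simp add: log_lipschitz_def dist_norm)
  have L0: "0 \<le> L" using f(1) by (auto simp: log_lipschitz_def dest: lipschitz_on_nonneg)
  have lnc: "continuous_on UNIV (\<lambda>x. ln (f x))" using f(1) by (auto simp: log_lipschitz_def intro: lipschitz_on_continuous_on)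
  define U' where "U' = (\<lambda>x. (norm x)\<^sup>2 / 2 - ln C - ln (f x))"
  have "density (gaussian 1) (\<lambda>x. ennreal (f x)) =
      density lborel (\<lambda>x. ennreal (C * exp (- (norm x)\<^sup>2 / 2)) * ennreal (f x))"
    unfolding gaussian_eq C_def using f(2) by (subst density_density_eq) auto
  also have "(\<lambda>x. ennreal (C * exp (- (norm x)\<^sup>2 / 2)) * ennreal (f x)) = (\<lambda>x. ennreal (exp (- U' x)))"
  proof
    fix x
    have "exp (- U' x) = exp (- (norm x)\<^sup>2 / 2 + ln C + ln (f x))" by (simp add: U'_def)
    also have "\<dots> = C * exp (- (norm x)\<^sup>2 / 2) * f x" unfolding exp_add using C fpos[of x] by simp
    finally show "ennreal (C * exp (- (norm x)\<^sup>2 / 2)) * ennreal (f x) = ennreal (exp (- U' x))"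
      using C fpos[of x] by (simp add: ennreal_mult[symmetric] less_imp_le)
  qed
  finally have "density lborel (\<lambda>x. ennreal (exp (- U x))) = density lborel (\<lambda>x. ennreal (exp (- U' x)))"
    using eq by simp
  then have UU: "U = U'"
    by (rule potential_unique[rotated 2])
       (use has_derivative_continuous[OF U] lnc in
         \<open>auto simp: U'_def intro!: continuous_at_imp_continuous_on[of UNIV U] continuous_intros\<close>)
  have lnf: "ln (f x) = (norm x)\<^sup>2 / 2 - ln C - U x" for x using fun_cong[OF UU, of x] by (simp add: U'_def)
  have small: "norm (x - G x) \<le> L" for x
  proof -
    have "((\<lambda>x. ln (f x)) has_derivative (\<lambda>h. (x - G x) \<bullet> h)) (at x)"
      unfolding lnf power2_norm_eq_inner
      by (auto intro!: derivative_eq_intros U simp: inner_diff_right inner_commute fun_eq_iff)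
    from has_derivative_norm_le[OF this always_eventually, of L "x - G x"]
    have "(norm (x - G x))\<^sup>2 \<le> L * norm (x - G x)"
      using flip by (simp add: power2_norm_eq_inner)
    then show ?thesis using L0 by (cases "norm (x - G x) = 0") (auto simp: power2_eq_square)
  qed
  have "((x - G x) - (y - G y)) \<bullet> (x - y) \<le> norm ((x - G x) - (y - G y)) * norm (x - y)" by (rule norm_cauchy_schwarz)
  also have "\<dots> \<le> (L + L) * norm (x - y)"
    by (intro mult_right_mono order_trans[OF norm_triangle_ineq4 add_mono[OF small small]]) auto
  finally show ?thesis
    by (simp add: power2_norm_eq_inner inner_diff_left inner_diff_right algebra_simps)
qed

section \<open>Gaussian mixtures\<close>

text \<open>The complement of the support is a union of open null sets, which the Lindelof property
  reduces to a countable union.\<close>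

lemma AE_msupport:
  fixes M :: "'a::second_countable_topology measure"
  assumes s: "sets M = sets borel"
  shows "AE x in M. x \<in> msupport M"
proof -
  define \<F> where "\<F> = {S :: 'a set. open S \<and> emeasure M S = 0}"
  obtain \<F>' where F': "\<F>' \<subseteq> \<F>" "countable \<F>'" "\<Union>\<F>' = \<Union>\<F>"
    using Lindelof[of \<F>] by (auto simp: \<F>_def)
  have "\<Union>\<F>' \<in> null_sets M"
    using F' by (intro null_sets_UN' [of \<F>' "\<lambda>S. S", simplified]) (auto simp: null_sets_def s \<F>_def)
  moreover have "- msupport M = \<Union>\<F>" by (auto simp: msupport_def \<F>_def zero_less_iff_neq_zero)
  ultimately have "- msupport M \<in> null_sets M" using F'(3) by simp
  then show ?thesis by (rule AE_I') auto
qed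

text \<open>Identifies the mixture density with the normalising integral \<open>GN\<close> of the
  mixing measure at a = \<sigma>, b = 1, whose logarithmic gradient is already known.\<close>

lemma gaussian_convolution_density:
  fixes \<rho> :: "(real^'n) measure"
  assumes \<rho>: "gauss_smoothing \<rho>" and \<sigma>: "\<sigma> > 0"
  shows "(gaussian \<sigma> \<star> \<rho>) = density lborel (\<lambda>x. ennreal (gauss_const \<sigma> CARD('n) * gauss_smoothing.GI \<rho> \<sigma> 1 x (\<lambda>_. 1 :: real)))"
proof -
  interpret gauss_smoothing \<rho> by fact
  define C where "C = gauss_const \<sigma> CARD('n)"
  have C: "C > 0" using \<sigma> by (simp add: C_def gauss_const_pos)
  define g where "g = (\<lambda>z :: real^'n. ennreal (C * exp (- (norm z)\<^sup>2 / (2 * \<sigma>\<^sup>2))))"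
  have g[measurable]: "g \<in> borel_measurable borel" unfolding g_def by measurable
  have gaus: "gaussian \<sigma> = density lborel g" unfolding gaussian_eq C_def g_def ..
  interpret P: pair_sigma_finite "lborel :: (real^'n) measure" \<rho> ..
  have GNm: "(\<lambda>x. GN \<sigma> 1 x) \<in> borel_measurable borel"
    using has_derivative_continuous[OF GI_deriv[OF \<sigma>, of "\<lambda>_. 1::real"]]
    by (intro borel_measurable_continuous_onI continuous_at_imp_continuous_on) blast
  have in_eq: "(\<integral>\<^sup>+y. g (x - y) \<partial>\<rho>) = ennreal (C * GN \<sigma> 1 x)" for x
  proof -
    have "(\<integral>\<^sup>+y. g (x - y) \<partial>\<rho>) = (\<integral>\<^sup>+y. ennreal (C * gk \<sigma> 1 x y) \<partial>\<rho>)" by (simp add: g_def gk_def)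
    also have "\<dots> = ennreal (\<integral>y. C * gk \<sigma> 1 x y \<partial>\<rho>)"
      using C gk_pos[of \<sigma> 1 x] integrable_gk[of "\<lambda>_. 1::real" \<sigma> 1 x]
      by (intro nn_integral_eq_integral) (auto intro!: AE_I2 less_imp_le[OF mult_pos_pos])
    finally show ?thesis by (simp add: GI_def)
  qed
  have trans: "(\<integral>\<^sup>+z. g z * indicator A (z + y) \<partial>lborel) = (\<integral>\<^sup>+x. g (x - y) * indicator A x \<partial>lborel)"
    if [measurable]: "A \<in> sets borel" for A y
  proof -
    have "(\<integral>\<^sup>+x. g (x - y) * indicator A x \<partial>lborel) = (\<integral>\<^sup>+x. g (x - y) * indicator A x \<partial>distr lborel borel ((+) y))"
      by (simp add: lborel_distr_plus)
    also have "\<dots> = (\<integral>\<^sup>+z. g z * indicator A (z + y) \<partial>lborel)"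
      by (subst nn_integral_distr) (auto simp: add.commute)
    finally show ?thesis by simp
  qed
  show ?thesis
  proof (rule measure_eqI)
    show "sets (gaussian \<sigma> \<star> \<rho>) = sets (density lborel (\<lambda>x. ennreal (gauss_const \<sigma> CARD('n) * GN \<sigma> 1 x)))"
      by (simp add: convolution_def)
    fix A assume "A \<in> sets (gaussian \<sigma> \<star> \<rho>)"
    then have A[measurable]: "A \<in> sets borel" by (simp add: convolution_def)
    have sg: "sets (gaussian \<sigma> :: (real^'n) measure) = sets borel" by (simp add: gaus)
    interpret G: sigma_finite_measure "gaussian \<sigma> :: (real^'n) measure"
      unfolding gaus by (subst sigma_finite_measure.sigma_finite_iff_density_finite[OF sigma_finite_lborel]) (auto simp: g_def)
    interpret PG: pair_sigma_finite "gaussian \<sigma> :: (real^'n) measure" \<rho> ..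
    have sp: "sets ((gaussian \<sigma> :: (real^'n) measure) \<Otimes>\<^sub>M \<rho>) = sets (borel \<Otimes>\<^sub>M borel)" by (rule sets_pair_measure_cong) (auto simp: sg)
    have m: "(\<lambda>(x, y). x + y) \<in> gaussian \<sigma> \<Otimes>\<^sub>M \<rho> \<rightarrow>\<^sub>M (borel :: (real^'n) measure)"
      unfolding measurable_cong_sets[OF sp refl] by measurable
    have m2: "(\<lambda>p. indicator A (fst p + snd p) :: ennreal) \<in> borel_measurable (gaussian \<sigma> \<Otimes>\<^sub>M \<rho>)"
      unfolding measurable_cong_sets[OF sp refl] by measurable
    have "emeasure (gaussian \<sigma> \<star> \<rho>) A = (\<integral>\<^sup>+p. indicator A (fst p + snd p) \<partial>(gaussian \<sigma> \<Otimes>\<^sub>M \<rho>))"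
      using m unfolding convolution_def
      by (subst nn_integral_indicator[symmetric]) (auto simp: nn_integral_distr case_prod_unfold simp del: nn_integral_indicator)
    also have "\<dots> = (\<integral>\<^sup>+y. \<integral>\<^sup>+z. indicator A (z + y) \<partial>gaussian \<sigma> \<partial>\<rho>)"
      using PG.nn_integral_snd[OF m2] by simp
    also have "\<dots> = (\<integral>\<^sup>+y. \<integral>\<^sup>+z. g z * indicator A (z + y) \<partial>lborel \<partial>\<rho>)"
      unfolding gaus by (intro nn_integral_cong nn_integral_density) auto
    also have "\<dots> = (\<integral>\<^sup>+y. \<integral>\<^sup>+x. g (x - y) * indicator A x \<partial>lborel \<partial>\<rho>)" by (simp add: trans[OF A])
    also have "\<dots> = (\<integral>\<^sup>+x. \<integral>\<^sup>+y. g (x - y) * indicator A x \<partial>\<rho> \<partial>lborel)"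
      by (rule P.Fubini') (simp add: measurable_cong_sets[OF sets_pair_measure_cong[OF sets_lborel sets_nu] refl])
    also have "\<dots> = (\<integral>\<^sup>+x. ennreal (C * GN \<sigma> 1 x) * indicator A x \<partial>lborel)"
      by (subst nn_integral_multc) (auto simp: in_eq measurable_cong_sets[OF sets_nu refl])
    also have "\<dots> = emeasure (density lborel (\<lambda>x. ennreal (gauss_const \<sigma> CARD('n) * GN \<sigma> 1 x))) A"
      using GNm by (subst emeasure_density) (auto simp: C_def)
    finally show "emeasure (gaussian \<sigma> \<star> \<rho>) A = emeasure (density lborel (\<lambda>x. ennreal (gauss_const \<sigma> CARD('n) * GN \<sigma> 1 x))) A" .
  qed
qed

text \<open>The posterior calculus is applied to \<rho> itself with a = \<sigma>, b = 1. The
  gradient of the potential is (x - m x) / \<sigma>^2 with m the posterior mean. Since \<rho> lives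
  in a ball, |m| <= r and the posterior variance is at most (2r)^2; the first bound gives the
  monotonicity with loss 2r / \<sigma>^2, the second the Lipschitz constant.\<close>

lemma potential_gaussian_mixture:
  fixes \<rho> :: "(real^'n) measure"
  assumes p: "prob_space \<rho>" and s: "sets \<rho> = sets borel" and supp: "msupport \<rho> \<subseteq> cball c R"
    and \<sigma>: "\<sigma> > 0" and \<nu>: "\<nu> = (gaussian \<sigma> \<star> \<rho>)" and nu: "gauss_smoothing \<nu>"
  shows "\<exists>U G B \<kappa> L. potential_smoothing \<nu> U G B \<kappa> L \<and> (\<forall>x. \<exists>G'. (G has_derivative G') (at x))"
proof -
  \<comment> \<open>Radius of a ball about the origin that contains \<open>cball c R\<close>; the
    absolute value makes it nonnegative for any R.\<close>
  define r where "r = norm c + \<bar>R\<bar>"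
  have r0: "0 \<le> r" by (simp add: r_def)
  have AEr: "AE y in \<rho>. norm y \<le> r"
    using AE_msupport[OF s]
  proof eventually_elim
    case (elim y)
    then have "dist c y \<le> R" using supp by auto
    then show ?case using norm_triangle_ineq2[of y c] by (simp add: r_def dist_norm norm_minus_commute)
  qed
  interpret \<rho>: gauss_smoothing \<rho>
  proof (intro gauss_smoothing.intro gauss_smoothing_axioms.intro p s)
    interpret prob_space \<rho> by fact
    show "integrable \<rho> (\<lambda>y. (norm y)\<^sup>2)"
      by (rule integrable_const_bound[where B = "r\<^sup>2"])
         (use AEr in \<open>auto elim!: eventually_mono intro!: power_mono simp: measurable_cong_sets[OF s refl]\<close>)
  qed
  define m where "m = \<rho>.pmean \<sigma> 1"
  define C where "C = gauss_const \<sigma> CARD('n)"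
  have C: "C > 0" using \<sigma> by (simp add: C_def gauss_const_pos)
  have AEp: "AE y in \<rho>.post \<sigma> 1 x. norm y \<le> r" for x
    unfolding \<rho>.post_def by (subst AE_density) (use AEr in \<open>auto elim!: eventually_mono\<close>)
  have mb: "norm (m x) \<le> r" for x
  proof -
    interpret P: prob_space "\<rho>.post \<sigma> 1 x" by (rule \<rho>.prob_space_post)
    have "norm (m x) \<le> (\<integral>y. norm y \<partial>\<rho>.post \<sigma> 1 x)" unfolding m_def \<rho>.pmean_def by (rule integral_norm_bound)
    also have "\<dots> \<le> (\<integral>y. r \<partial>\<rho>.post \<sigma> 1 x)"
      by (rule integral_mono_AE[OF _ _ AEp]) (use \<rho>.post_integrable[OF \<rho>.moment1] in auto)
    finally show ?thesis by simp
  qed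
  have vb: "\<rho>.pvar \<sigma> 1 x \<le> (2 * r)\<^sup>2" for x
  proof -
    interpret P: prob_space "\<rho>.post \<sigma> 1 x" by (rule \<rho>.prob_space_post)
    have "\<rho>.pvar \<sigma> 1 x \<le> (\<integral>y. (2 * r)\<^sup>2 \<partial>\<rho>.post \<sigma> 1 x)"
      unfolding \<rho>.pvar_def
    proof (rule integral_mono_AE[OF \<rho>.integrable_centred_sq])
      show "AE y in \<rho>.post \<sigma> 1 x. (norm (y - \<rho>.pmean \<sigma> 1 x))\<^sup>2 \<le> (2 * r)\<^sup>2"
        using AEp
      proof eventually_elim
        case (elim y)
        have "norm (y - m x) \<le> 2 * r" using norm_triangle_ineq4[of y "m x"] elim mb[of x] by linarith
        then show ?case by (intro power_mono) (auto simp: m_def)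
      qed
    qed simp
    then show ?thesis by simp
  qed
  define U where "U = (\<lambda>x. - ln C - ln (\<rho>.GN \<sigma> 1 x))"
  define G where "G = (\<lambda>x. (1 / \<sigma>\<^sup>2) *\<^sub>R (x - m x))"
  define DG where "DG = (\<lambda>x h. (1 / \<sigma>\<^sup>2) *\<^sub>R (h - (1 / \<sigma>\<^sup>2) *\<^sub>R \<rho>.pcov \<sigma> 1 x h))"
  have U: "(U has_derivative (\<lambda>h. G x \<bullet> h)) (at x)" for x
    unfolding U_def
    by (rule has_derivative_eq_rhs[OF has_derivative_diff[OF has_derivative_const \<rho>.ln_GN_deriv[OF \<sigma>]]])
       (auto simp: G_def m_def)
  have md: "(m has_derivative (\<lambda>h. (1 / \<sigma>\<^sup>2) *\<^sub>R \<rho>.pcov \<sigma> 1 x h)) (at x)" for x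
    unfolding m_def by (rule \<rho>.pmean_deriv[OF \<sigma>])
  have Gd: "(G has_derivative DG x) (at x)" for x
    unfolding G_def DG_def by (intro has_derivative_scaleR_right has_derivative_diff has_derivative_ident md)
  define B where "B = (1 / \<sigma>\<^sup>2) * (1 + (1 / \<sigma>\<^sup>2) * (2 * r)\<^sup>2)"
  have B0: "0 \<le> B" by (simp add: B_def)
  have DGb: "norm (DG x h) \<le> B * norm h" for x h
  proof -
    have "norm (\<rho>.pcov \<sigma> 1 x h) \<le> (2 * r)\<^sup>2 * norm h"
      by (rule order_trans[OF \<rho>.pcov_bound mult_right_mono[OF vb]]) simp
    then have "(1 / \<sigma>\<^sup>2) * norm (\<rho>.pcov \<sigma> 1 x h) \<le> (1 / \<sigma>\<^sup>2) * ((2 * r)\<^sup>2 * norm h)" by (intro mult_left_mono) auto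
    then have "norm (h - (1 / \<sigma>\<^sup>2) *\<^sub>R \<rho>.pcov \<sigma> 1 x h) \<le> norm h + (1 / \<sigma>\<^sup>2) * ((2 * r)\<^sup>2 * norm h)"
      using norm_triangle_ineq4[of h "(1 / \<sigma>\<^sup>2) *\<^sub>R \<rho>.pcov \<sigma> 1 x h"] by simp
    then have "(1 / \<sigma>\<^sup>2) * norm (h - (1 / \<sigma>\<^sup>2) *\<^sub>R \<rho>.pcov \<sigma> 1 x h)
        \<le> (1 / \<sigma>\<^sup>2) * (norm h + (1 / \<sigma>\<^sup>2) * ((2 * r)\<^sup>2 * norm h))" by (intro mult_left_mono) auto
    moreover have "norm (DG x h) = (1 / \<sigma>\<^sup>2) * norm (h - (1 / \<sigma>\<^sup>2) *\<^sub>R \<rho>.pcov \<sigma> 1 x h)"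
      unfolding DG_def norm_scaleR by simp
    moreover have "(1 / \<sigma>\<^sup>2) * (norm h + (1 / \<sigma>\<^sup>2) * ((2 * r)\<^sup>2 * norm h)) = B * norm h"
      by (simp add: B_def algebra_simps)
    ultimately show ?thesis by simp
  qed
  have Glip: "norm (G x - G y) \<le> B * norm (x - y)" for x y
    by (rule differentiable_bound[where S = UNIV and f' = DG])
       (use DGb B0 Gd in \<open>auto intro!: onorm_bound\<close>)
  have Gmono: "(1 / \<sigma>\<^sup>2) * (norm (x - y))\<^sup>2 - (2 * r / \<sigma>\<^sup>2) * norm (x - y) \<le> (G x - G y) \<bullet> (x - y)" for x y
  proof -
    have "(m x - m y) \<bullet> (x - y) \<le> norm (m x - m y) * norm (x - y)" by (rule norm_cauchy_schwarz)
    also have "\<dots> \<le> (r + r) * norm (x - y)"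
      by (intro mult_right_mono order_trans[OF norm_triangle_ineq4 add_mono[OF mb mb]]) auto
    finally have "(1 / \<sigma>\<^sup>2) * ((norm (x - y))\<^sup>2 - 2 * r * norm (x - y)) \<le> (1 / \<sigma>\<^sup>2) * ((norm (x - y))\<^sup>2 - (m x - m y) \<bullet> (x - y))"
      by (intro mult_left_mono) auto
    also have "\<dots> = (G x - G y) \<bullet> (x - y)"
      by (simp add: G_def power2_norm_eq_inner inner_diff_left inner_diff_right diff_divide_distrib add_divide_distrib)
    finally show ?thesis by (simp add: right_diff_distrib)
  qed
  have "\<nu> = density lborel (\<lambda>x. ennreal (exp (- U x)))"
  proof -
    have "exp (- U x) = C * \<rho>.GN \<sigma> 1 x" for x using C \<rho>.GN_pos[of \<sigma> 1 x] by (simp add: U_def exp_add)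
    then show ?thesis unfolding \<nu> gaussian_convolution_density[OF \<rho>.gauss_smoothing_axioms \<sigma>] C_def[symmetric] by simp
  qed
  then have "potential_smoothing \<nu> U G B (1 / \<sigma>\<^sup>2) (2 * r / \<sigma>\<^sup>2)"
    using nu U Glip Gmono B0 \<sigma> r0
    by (intro potential_smoothing.intro potential_smoothing_axioms.intro) auto
  then show ?thesis using Gd by blast
qed

lemma potential_exists:
  fixes \<nu> :: "(real^'n) measure"
  assumes nu_prob: "prob_space \<nu>" and nu_sets: "sets \<nu> = sets borel"
    and nu_moment: "integrable \<nu> (\<lambda>x. (norm x)\<^sup>2)"
    and nu_cases:
      "(\<exists>\<beta>>0. \<exists>\<kappa>>0. semi_log_convex \<beta> \<nu> \<and> semi_log_concave \<kappa> \<nu> \<and> msupport \<nu> = UNIV) \<or>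
       (\<exists>\<sigma>>0. \<exists>R>0. \<exists>c. \<exists>\<rho>. prob_space \<rho> \<and> sets \<rho> = sets borel \<and> msupport \<rho> \<subseteq> cball c R \<and>
          \<nu> = (gaussian \<sigma> \<star> \<rho>)) \<or>
       (\<exists>\<beta>>0. \<exists>\<kappa>\<le>0. \<exists>L\<ge>0. semi_log_convex \<beta> \<nu> \<and> semi_log_concave \<kappa> \<nu> \<and>
          (\<exists>f\<in>borel_measurable borel. log_lipschitz L f \<and>
             \<nu> = density (gaussian 1) (\<lambda>x. ennreal (f x))) \<and>
          msupport \<nu> = UNIV)"
  shows "\<exists>U G B \<kappa> L. potential_smoothing \<nu> U G B \<kappa> L \<and> (\<forall>x. \<exists>G'. (G has_derivative G') (at x))"
proof -
  have gs: "gauss_smoothing \<nu>"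
    using nu_prob nu_sets nu_moment by (intro gauss_smoothing.intro gauss_smoothing_axioms.intro)
  from nu_cases consider
    (i) \<beta> \<kappa> where "\<kappa> > 0" "semi_log_convex \<beta> \<nu>" "semi_log_concave \<kappa> \<nu>" "msupport \<nu> = UNIV"
    | (iii) \<sigma> R c \<rho> where "\<sigma> > 0" "prob_space \<rho>" "sets \<rho> = sets borel" "msupport \<rho> \<subseteq> cball c R" "\<nu> = (gaussian \<sigma> \<star> \<rho>)"
    | (iv) \<beta> \<kappa> L f where "L \<ge> 0" "semi_log_convex \<beta> \<nu>" "semi_log_concave \<kappa> \<nu>" "msupport \<nu> = UNIV"
       "f \<in> borel_measurable borel" "log_lipschitz L f" "\<nu> = density (gaussian 1) (\<lambda>x. ennreal (f x))"
    by blast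
  then show ?thesis
  proof cases
    case i
    obtain U G B where P: "\<nu> = density lborel (\<lambda>x. ennreal (exp (- U x)))"
      "\<And>x. (U has_derivative (\<lambda>h. G x \<bullet> h)) (at x)" "\<And>x. \<exists>G'. (G has_derivative G') (at x)"
      "0 \<le> B" "\<And>x y. norm (G x - G y) \<le> B * norm (x - y)"
      "\<And>x y. \<kappa> * (norm (x - y))\<^sup>2 \<le> (G x - G y) \<bullet> (x - y)"
      using semi_log_cases[OF i(2-4)] by blast
    have "potential_smoothing \<nu> U G B \<kappa> 0"
      using gs P i by (intro potential_smoothing.intro potential_smoothing_axioms.intro) auto
    then show ?thesis using P(3) by blast
  next
    case iii
    then show ?thesis using potential_gaussian_mixture[OF iii(2,3,4,1,5) gs] by blast
  next
    case iv
    obtain U G B where P: "\<nu> = density lborel (\<lambda>x. ennreal (exp (- U x)))"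
      "\<And>x. (U has_derivative (\<lambda>h. G x \<bullet> h)) (at x)" "\<And>x. \<exists>G'. (G has_derivative G') (at x)"
      "0 \<le> B" "\<And>x y. norm (G x - G y) \<le> B * norm (x - y)"
      using semi_log_cases[OF iv(2-4)] by blast
    have "density lborel (\<lambda>x. ennreal (exp (- U x))) = density (gaussian 1) (\<lambda>x. ennreal (f x))"
      using P(1) iv(7) by simp
    from potential_log_lipschitz[OF P(2) this iv(6,5)]
    \<comment> \<open>The monotonicity constant 1 stems from the reference Gaussian, while the two
      Hessian bounds supply the Lipschitz constant \<open>B\<close>.\<close>
    have "potential_smoothing \<nu> U G B 1 (2 * L)"
      using gs P iv(1) by (intro potential_smoothing.intro potential_smoothing_axioms.intro) auto
    then show ?thesis using P(3) by blast
  qed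
qed

section \<open>The stability estimate\<close>

lemma time_deriv_eq:
  assumes "t \<in> {0..1}" "(f has_real_derivative d) (at t within {0..1})"
  shows "time_deriv f t = d"
  unfolding time_deriv_def
  by (rule vector_derivative_within_closed_interval)
     (use assms in \<open>auto simp: has_real_derivative_iff_has_vector_derivative\<close>)

text \<open>\<open>c\<close> extends \<open>a' a\<close>, half the derivative of \<open>a\<^sup>2\<close>, to time 1, where \<open>a'\<close> need not exist.\<close>

locale interpolation_path =
  fixes a b a' b' c :: "real \<Rightarrow> real"
  assumes a_deriv: "\<And>t. t \<in> {0..<1} \<Longrightarrow> (a has_real_derivative a' t) (at t within {0..1})"
    and b_deriv: "\<And>t. t \<in> {0..1} \<Longrightarrow> (b has_real_derivative b' t) (at t within {0..1})"
    and a'_cont: "continuous_on {0..<1} a'" and b'_cont: "continuous_on {0..1} b'"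
    and c_cont: "continuous_on {0..1} c" and c_eq: "\<And>t. t \<in> {0..<1} \<Longrightarrow> c t = a' t * a t"
    and a_cont: "continuous_on {0..1} a" and b_cont: "continuous_on {0..1} b"
    and a_pos: "\<And>t. t \<in> {0..<1} \<Longrightarrow> 0 < a t" and b_pos: "\<And>t. t \<in> {0<..1} \<Longrightarrow> 0 < b t"
    and b_0: "0 \<le> b 0" and a_1: "a 1 = 0" and b_1: "b 1 = 1"

lemma interpolation_path_exists:
  assumes "interpolation_coeffs a b"
  shows "\<exists>a' b' c. interpolation_path a b a' b' c"
proof -
  have ab: "0 < a 0" "0 \<le> b 0" "a 1 = 0" "b 1 = 1" "\<And>t. t \<in> {0<..<1} \<Longrightarrow> 0 < a t \<and> 0 < b t"
    "C2_on {0..<1} a" "C1_on {0..1} (\<lambda>t. (a t)\<^sup>2)" "C1_on {0..1} b"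
    using assms unfolding interpolation_coeffs_def by auto
  obtain a' where a': "continuous_on {0..<1} a'" "\<And>t. t \<in> {0..<1} \<Longrightarrow> (a has_real_derivative a' t) (at t within {0..<1})"
  proof -
    obtain a' where 1: "C1_on {0..<1} a'" "\<And>t. t \<in> {0..<1} \<Longrightarrow> (a has_real_derivative a' t) (at t within {0..<1})"
      using ab(6) unfolding C2_on_def by auto
    then have "continuous_on {0..<1} a'" unfolding C1_on_def by (meson DERIV_continuous_on)
    then show thesis by (rule that[OF _ 1(2)])
  qed
  obtain b' where b': "continuous_on {0..1} b'" "\<And>t. t \<in> {0..1} \<Longrightarrow> (b has_real_derivative b' t) (at t within {0..1})"
    using ab(8) unfolding C1_on_def by auto
  obtain q where q: "continuous_on {0..1} q" "\<And>t. t \<in> {0..1} \<Longrightarrow> ((\<lambda>t. (a t)\<^sup>2) has_real_derivative q t) (at t within {0..1})"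
    using ab(7) unfolding C1_on_def by auto
  have da: "(a has_real_derivative a' t) (at t within {0..1})" if "t \<in> {0..<1}" for t
  proof -
    have "at t within {0..<1} = at t within {0..1}"
      by (rule at_within_nhd[of t "{..<1}"]) (use that in auto)
    then show ?thesis using a'(2)[OF that] by simp
  qed
  have apos: "0 < a t" if "t \<in> {0..<1}" for t using ab(1) ab(5)[of t] that by (cases "t = 0") auto
  have a0: "0 \<le> a t" if "t \<in> {0..1}" for t using apos[of t] ab(3) that by (cases "t = 1") (auto intro: less_imp_le)
  \<comment> \<open>Differentiating a^2 by the product rule must reproduce its given continuous
    derivative \<open>q\<close>. So q / 2 is the continuous extension of a' a to time 1.\<close>
  have qc: "q t / 2 = a' t * a t" if t: "t \<in> {0..<1}" for t
  proof -
    have "((\<lambda>t. (a t)\<^sup>2) has_real_derivative 2 * a t * a' t) (at t within {0..1})"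
      by (auto intro!: derivative_eq_intros da[OF t])
    then have "2 * a t * a' t = q t"
      using time_deriv_eq[of t "\<lambda>t. (a t)\<^sup>2" "2 * a t * a' t"]
        time_deriv_eq[of t "\<lambda>t. (a t)\<^sup>2" "q t"] q(2)[of t] t by simp
    then show ?thesis by (simp add: field_simps)
  qed
  have bc: "continuous_on {0..1} b" using b'(2) by (rule DERIV_continuous_on)
  \<comment> \<open>At time 1 only a^2 is known to be differentiable; \<open>a\<close> is recovered
    there as the square root of a^2, using a >= 0.\<close>
  have ac: "continuous_on {0..1} a"
  proof (rule continuous_on_eq)
    have "continuous_on {0..1} (\<lambda>t. (a t)\<^sup>2)" using q(2) by (rule DERIV_continuous_on)
    then show "continuous_on {0..1} (\<lambda>t. sqrt ((a t)\<^sup>2))" by (rule continuous_on_real_sqrt)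
    show "sqrt ((a t)\<^sup>2) = a t" if "t \<in> {0..1}" for t using a0[OF that] by simp
  qed
  have "interpolation_path a b a' b' (\<lambda>t. q t / 2)"
  proof
    show "0 < b t" if "t \<in> {0<..1}" for t using ab(4) ab(5)[of t] that by (cases "t = 1") auto
    show "continuous_on {0..1} (\<lambda>t. q t / 2)" by (intro continuous_intros q(1)) auto
  qed (use da a'(1) b' qc ac bc apos ab in auto)
  then show ?thesis by blast
qed

section \<open>Jacobian norms, Gaussian laws and tested conditional expectations\<close>

lemma spectral_norm_jacobian:
  assumes "(f has_derivative f') (at x)"
  shows "spectral_norm (jacobian f (at x)) = onorm f'"
proof -
  have 1: "frechet_derivative f (at x) = f'" using frechet_derivative_at[OF assms] by simp
  have 2: "(\<lambda>h. matrix f' *v h) = f'"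
    by (rule ext) (rule matrix_works[OF iffD2[OF linear_matrix_vector_mul_eq has_derivative_linear[OF assms]]])
  show ?thesis unfolding spectral_norm_def jacobian_def 1 2 ..
qed

lemma W2_le:
  assumes "\<pi> \<in> couplings \<mu> \<nu>" and "(\<integral>\<^sup>+ p. ennreal ((dist (fst p) (snd p))\<^sup>2) \<partial>\<pi>) \<le> ennreal c" and c: "0 \<le> c"
  shows "W2 \<mu> \<nu> \<le> ennreal (sqrt c)"
proof -
  define I where "I = (INF \<pi>\<in>couplings \<mu> \<nu>. \<integral>\<^sup>+ p. ennreal ((dist (fst p) (snd p))\<^sup>2) \<partial>\<pi>)"
  have le: "I \<le> ennreal c" unfolding I_def by (rule INF_lower2[OF assms(1)]) (rule assms(2))
  then have "I \<noteq> \<infinity>" by (auto simp: top_unique)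
  moreover have "enn2real I \<le> c" using enn2real_mono[OF le] c by simp
  ultimately show ?thesis unfolding W2_def I_def[symmetric] ennreal_sqrt_def by (simp add: ennreal_leI)
qed

lemma gaussian_scale:
  assumes s: "s > 0"
  shows "distr (gaussian 1 :: (real^'n) measure) borel (\<lambda>z. s *\<^sub>R z) = gaussian s"
proof (rule measure_eqI)
  show "sets (distr (gaussian 1 :: (real^'n) measure) borel (\<lambda>z. s *\<^sub>R z)) = sets (gaussian s)"
    by (simp add: gaussian_def)
  fix A :: "(real^'n) set" assume "A \<in> sets (distr (gaussian 1) borel (\<lambda>z. s *\<^sub>R z))"
  then have A[measurable]: "A \<in> sets borel" by simp
  let ?n = "CARD('n)"
  have c: "gauss_const s ?n * s ^ ?n = gauss_const 1 ?n"
    using s by (simp add: gauss_const_def power_mult_distrib[symmetric] real_sqrt_mult)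
  have gm: "sets (gaussian 1 :: (real^'n) measure) = sets borel" by (simp add: gaussian_def)
  have "emeasure (gaussian s) A = (\<integral>\<^sup>+x. ennreal (gauss_const s ?n * exp (- (norm x)\<^sup>2 / (2 * s\<^sup>2))) * indicator A x \<partial>lborel)"
    unfolding gaussian_eq by (subst emeasure_density) auto
  also have "\<dots> = (\<integral>\<^sup>+x. ennreal (gauss_const s ?n * exp (- (norm x)\<^sup>2 / (2 * s\<^sup>2))) * indicator A x
      \<partial>density (distr lborel borel (\<lambda>z. 0 + s *\<^sub>R z)) (\<lambda>_. \<bar>s\<bar>^DIM(real^'n)))"
    using lborel_affine[of s "0 :: real^'n"] s by simp
  also have "\<dots> = (\<integral>\<^sup>+z. ennreal (s ^ ?n) * (ennreal (gauss_const s ?n * exp (- (norm z)\<^sup>2 / 2)) * indicator A (s *\<^sub>R z)) \<partial>lborel)"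
    using s by (simp add: nn_integral_density nn_integral_distr power_mult_distrib ennreal_power)
  also have "\<dots> = (\<integral>\<^sup>+z. ennreal (gauss_const 1 ?n * exp (- (norm z)\<^sup>2 / (2 * 1\<^sup>2))) * indicator A (s *\<^sub>R z) \<partial>lborel)"
    unfolding mult.assoc[symmetric] c[symmetric] using s gauss_const_pos[OF s, of ?n]
    by (intro nn_integral_cong) (simp add: ennreal_mult[symmetric] ac_simps)
  also have "\<dots> = emeasure (distr (gaussian 1) borel (\<lambda>z. s *\<^sub>R z)) A"
  proof -
    have "emeasure (distr (gaussian 1) borel (\<lambda>z. s *\<^sub>R z)) A = (\<integral>\<^sup>+z. indicator A z \<partial>distr (gaussian 1 :: (real^'n) measure) borel (\<lambda>z. s *\<^sub>R z))"
      by simp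
    also have "\<dots> = (\<integral>\<^sup>+z. indicator A (s *\<^sub>R z) \<partial>gaussian 1)"
      by (rule nn_integral_distr) (auto simp: measurable_cong_sets[OF gm refl])
    also have "\<dots> = (\<integral>\<^sup>+z. ennreal (gauss_const 1 ?n * exp (- (norm z)\<^sup>2 / (2 * 1\<^sup>2))) * indicator A (s *\<^sub>R z) \<partial>lborel)"
      unfolding gaussian_eq by (rule nn_integral_density) auto
    finally show ?thesis by simp
  qed
  finally show "emeasure (distr (gaussian 1) borel (\<lambda>z. s *\<^sub>R z)) A = emeasure (gaussian s) A" by simp
qed

lemma integrable_norm_gaussian: "integrable (gaussian 1 :: (real^'n) measure) norm"
proof -
  let ?C = "gauss_const 1 CARD('n)"
  have C: "?C > 0" by (simp add: gauss_const_pos)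
  have "integrable lborel (\<lambda>z :: real^'n. (?C * exp (- (norm z)\<^sup>2 / (2 * 1\<^sup>2))) *\<^sub>R norm z)"
  proof (rule Bochner_Integration.integrable_bound)
    show "integrable lborel (\<lambda>z :: real^'n. ?C * ((1 + 2 / (1/2)) * exp (- (1/2/2) * (norm z)\<^sup>2)))"
      by (intro integrable_mult_right integrable_exp_neg_norm_sq) auto
    have "norm ((?C * exp (- (norm z)\<^sup>2 / (2 * 1\<^sup>2))) *\<^sub>R norm z) \<le> norm (?C * ((1 + 2 / (1/2)) * exp (- (1/2/2) * (norm z)\<^sup>2)))"
      for z :: "real^'n"
    proof -
      have "norm z \<le> 1 + (norm z)\<^sup>2" using sum_squares_bound[of "norm z" 1] by (simp) (use norm_ge_zero[of z] in linarith)
      then have "norm z * exp (- (1/2) * (norm z)\<^sup>2) \<le> (1 + (norm z)\<^sup>2) * exp (- (1/2) * (norm z)\<^sup>2)"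
        by (intro mult_right_mono) auto
      also have "\<dots> \<le> (1 + 2 / (1/2)) * exp (- (1/2/2) * (norm z)\<^sup>2)"
        by (rule quadratic_times_exp_le) simp
      finally have "?C * (norm z * exp (- (1/2) * (norm z)\<^sup>2)) \<le> ?C * ((1 + 2 / (1/2)) * exp (- (1/2/2) * (norm z)\<^sup>2))"
        using C by (intro mult_left_mono) auto
      then show ?thesis using C by (simp add: abs_mult ac_simps)
    qed
    then show "AE z :: real^'n in lborel. norm ((?C * exp (- (norm z)\<^sup>2 / (2 * 1\<^sup>2))) *\<^sub>R norm z)
        \<le> norm (?C * ((1 + 2 / (1/2)) * exp (- (1/2/2) * (norm z)\<^sup>2)))" by (rule AE_I2)
  qed measurable
  then show ?thesis unfolding gaussian_eq using C
    by (subst integrable_density) (auto simp: less_imp_le)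
qed

text \<open>A bounded function of \<open>I\<close> is measurable for the sigma-algebra generated by
  \<open>I\<close>, so it may be moved inside the conditional expectation. The argument runs
  coordinatewise because conditional expectations are scalar; the sum over coordinates is taken at
  the end.\<close>

lemma cond_exp_tower:
  fixes I Y :: "'w \<Rightarrow> real^'n"
  assumes M: "prob_space M" and I: "I \<in> borel_measurable M" and Y: "integrable M Y"
    and ce: "is_cond_exp_given M Y I g" and g: "g \<in> borel_measurable borel"
    and q: "q \<in> borel_measurable borel" "\<And>x. \<bar>q x\<bar> \<le> C"
  shows "integrable M (\<lambda>w. q (I w) * ((Y w - g (I w)) \<bullet> u)) \<and>
    (\<integral>w. q (I w) * ((Y w - g (I w)) \<bullet> u) \<partial>M) = 0"
proof -
  interpret M: prob_space M by fact
  define F where "F = vimage_algebra (space M) I borel"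
  have sub: "subalgebra M F" unfolding subalgebra_def F_def
    using I by (auto simp: sets_vimage_algebra2 intro: measurable_sets)
  interpret F: finite_measure_subalgebra M F by standard (rule sub)
  have IF: "I \<in> borel_measurable F" unfolding F_def by (rule measurable_vimage_algebra1) auto
  have qF: "(\<lambda>w. q (I w)) \<in> borel_measurable F" using IF q(1) by (rule measurable_compose)
  have qM: "(\<lambda>w. q (I w)) \<in> borel_measurable M" using I q(1) by (rule measurable_compose)
  have Yi: "integrable M (\<lambda>w. Y w $ i)" for i
    using integrable_inner_left[OF Y, of "axis i 1"] by (simp add: inner_axis)
  have qY: "integrable M (\<lambda>w. q (I w) * Y w $ i)" for i
  proof (rule Bochner_Integration.integrable_bound[OF integrable_mult_right[OF Yi[of i], of C]])
    have "\<bar>q x\<bar> \<le> \<bar>C\<bar>" for x using q(2)[of x] by linarith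
    then show "AE w in M. norm (q (I w) * Y w $ i) \<le> norm (C * Y w $ i)"
      by (auto simp: abs_mult intro!: AE_I2 mult_right_mono)
  qed (use qM Yi[of i] in measurable)
  have gIm: "(\<lambda>w. g (I w) $ i) \<in> borel_measurable M" for i
    using measurable_compose[OF measurable_compose[OF I g], of "\<lambda>x. x $ i" borel] by simp
  have comp: "integrable M (\<lambda>w. q (I w) * (Y w - g (I w)) $ i) \<and> (\<integral>w. q (I w) * (Y w - g (I w)) $ i \<partial>M) = 0" for i
  proof -
    have ae: "AE w in M. q (I w) * real_cond_exp M F (\<lambda>w. Y w $ i) w = q (I w) * g (I w) $ i"
      using ce unfolding is_cond_exp_given_def F_def by (auto elim!: allE[of _ i] eventually_mono)
    have 1: "integrable M (\<lambda>w. q (I w) * real_cond_exp M F (\<lambda>w. Y w $ i) w)"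
      "(\<integral>w. q (I w) * real_cond_exp M F (\<lambda>w. Y w $ i) w \<partial>M) = (\<integral>w. q (I w) * Y w $ i \<partial>M)"
      using F.real_cond_exp_intg[OF qY qF borel_measurable_integrable[OF Yi]] by auto
    have gm: "(\<lambda>w. q (I w) * g (I w) $ i) \<in> borel_measurable M" using qM gIm by measurable
    have 2: "integrable M (\<lambda>w. q (I w) * g (I w) $ i)"
      using integrable_cong_AE[OF borel_measurable_integrable[OF 1(1)] gm ae] 1(1) by simp
    have 3: "(\<integral>w. q (I w) * g (I w) $ i \<partial>M) = (\<integral>w. q (I w) * Y w $ i \<partial>M)"
      using integral_cong_AE[OF borel_measurable_integrable[OF 1(1)] gm ae] 1(2) by simp
    show ?thesis using 2 3 qY[of i] by (simp add: right_diff_distrib)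
  qed
  have e: "q (I w) * ((Y w - g (I w)) \<bullet> u) = (\<Sum>i\<in>UNIV. (q (I w) * (Y w - g (I w)) $ i) * u $ i)" for w
    by (simp add: inner_vec_def sum_distrib_left mult.assoc)
  show ?thesis unfolding e using comp
    by (auto intro!: Bochner_Integration.integrable_sum simp: Bochner_Integration.integral_sum)
qed

theorem proposition37:
  fixes a b :: "real \<Rightarrow> real"
    and M :: "'w measure"
    and Z X1 :: "'w \<Rightarrow> real^'n"
    and \<nu> :: "(real^'n) measure"
    and v X :: "real \<Rightarrow> real^'n \<Rightarrow> real^'n"
    and C1 C2 :: real
  assumes coeffs: "interpolation_coeffs a b"
    and nu_prob: "prob_space \<nu>" and nu_sets: "sets \<nu> = sets borel"
    and nu_ac: "absolutely_continuous lborel \<nu>"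
    and nu_moment: "integrable \<nu> (\<lambda>x. (norm x)\<^sup>2)"
    and nu_cases:
      "(\<exists>\<beta>>0. \<exists>\<kappa>>0. semi_log_convex \<beta> \<nu> \<and> semi_log_concave \<kappa> \<nu> \<and> msupport \<nu> = UNIV) \<or>
       (\<exists>\<sigma>>0. \<exists>R>0. \<exists>c. \<exists>\<rho>. prob_space \<rho> \<and> sets \<rho> = sets borel \<and> msupport \<rho> \<subseteq> cball c R \<and>
          \<nu> = (gaussian \<sigma> \<star> \<rho>)) \<or>
       (\<exists>\<beta>>0. \<exists>\<kappa>\<le>0. \<exists>L\<ge>0. semi_log_convex \<beta> \<nu> \<and> semi_log_concave \<kappa> \<nu> \<and>
          (\<exists>f\<in>borel_measurable borel. log_lipschitz L f \<and>
             \<nu> = density (gaussian 1) (\<lambda>x. ennreal (f x))) \<and>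
          msupport \<nu> = UNIV)"
    and M_prob: "prob_space M"
    and Z_law: "Z \<in> borel_measurable M" "distr M borel Z = gaussian 1"
    and X1_law: "X1 \<in> borel_measurable M" "distr M borel X1 = \<nu>"
    and indep: "prob_space.indep_var M borel Z borel X1"
    and velocity: "is_velocity_field M a b Z X1 v"
    and flow: "is_flow v X"
    and C1_def: "C1 = (SUP x. spectral_norm (jacobian (X 1) (at x)))"
    and C2_def: "C2 = (SUP (t, x)\<in>{0..1} \<times> UNIV. spectral_norm (jacobian (v t) (at x)))"
  shows "(\<forall>x. X 1 differentiable (at x)) \<and>
    bdd_above (range (\<lambda>x. spectral_norm (jacobian (X 1) (at x)))) \<and>
    (\<forall>t\<in>{0..1}. \<forall>x. v t differentiable (at x)) \<and>
    bdd_above ((\<lambda>(t, x). spectral_norm (jacobian (v t) (at x))) ` ({0..1} \<times> UNIV)) \<and>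
    W2 (distr (gaussian (a 0)) borel (X 1)) \<nu>
      \<le> ennreal (C1 * b 0 * sqrt (\<integral>x. (norm x)\<^sup>2 \<partial>\<nu>) * exp (C2 * real CARD('n)))"
proof -
  obtain U G B \<kappa> L where pot: "potential_smoothing \<nu> U G B \<kappa> L" and Gdiff: "\<And>x. \<exists>G'. (G has_derivative G') (at x)"
    using potential_exists[OF nu_prob nu_sets nu_moment nu_cases] by blast
  interpret S: potential_smoothing \<nu> U G B \<kappa> L by (rule pot)
  interpret M: prob_space M by (rule M_prob)
  obtain a' b' c where "interpolation_path a b a' b' c" using interpolation_path_exists[OF coeffs] by blast
  then interpret P: interpolation_path a b a' b' c .
  note a' = P.a_deriv and b' = P.b_deriv and a'_cont = P.a'_cont and b'_cont = P.b'_cont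
    and c_cont = P.c_cont and c = P.c_eq and a_cont = P.a_cont and b_cont = P.b_cont
    and a_pos = P.a_pos and b_pos = P.b_pos and b0 = P.b_0 and a1 = P.a_1 and b1 = P.b_1
  note [measurable] = Z_law(1) X1_law(1)
  have td: "time_deriv a t = a' t" "time_deriv b t = b' t" if "t \<in> {0<..<1}" for t
    using time_deriv_eq[OF _ a'] time_deriv_eq[OF _ b'] that by auto
  let ?vel = "\<lambda>t. S.vel (a t) (b t) (a' t) (b' t)"
  let ?Dvel = "\<lambda>t. S.Dvel (a t) (b t) (a' t) (b' t)"
  let ?Y' = "\<lambda>t w. a' t *\<^sub>R Z w + b' t *\<^sub>R X1 w"
  have Zi: "integrable M Z"
  proof -
    have "integrable (distr M borel Z) norm" unfolding Z_law(2) by (rule integrable_norm_gaussian)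
    then have "integrable M (\<lambda>w. norm (Z w))" by (subst (asm) integrable_distr_eq) auto
    then show ?thesis by (rule Bochner_Integration.integrable_bound) auto
  qed
  have X1i: "integrable M X1"
  proof -
    have "integrable (distr M borel X1) (\<lambda>x. x)" unfolding X1_law(2) by (rule S.integrable_id)
    then show ?thesis by (subst (asm) integrable_distr_eq) auto
  qed
  have Im: "interpolant a b Z X1 t \<in> borel_measurable M" for t unfolding interpolant_def by measurable
  have v_cont: "continuous_on UNIV (v t)" if "t \<in> {0<..<1}" for t
    using velocity that unfolding is_velocity_field_def by blast
  have tower: "integrable M (\<lambda>w. q (interpolant a b Z X1 t w) * ((?Y' t w - v t (interpolant a b Z X1 t w)) \<bullet> u)) \<and>
      (\<integral>w. q (interpolant a b Z X1 t w) * ((?Y' t w - v t (interpolant a b Z X1 t w)) \<bullet> u) \<partial>M) = 0"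
    if t: "t \<in> {0<..<1}" and q: "q \<in> borel_measurable borel" "\<And>x. \<bar>q x\<bar> \<le> C" for q t u C
  proof (rule cond_exp_tower[OF M_prob Im _ _ _ q])
    show "integrable M (?Y' t)" using Zi X1i by simp
    show "is_cond_exp_given M (?Y' t) (interpolant a b Z X1 t) (v t)"
      using velocity t unfolding is_velocity_field_def td[OF t, symmetric] by blast
    show "v t \<in> borel_measurable borel" by (rule borel_measurable_continuous_onI[OF v_cont[OF t]])
  qed
  have v_int: "v t = ?vel t" if t: "t \<in> {0<..<1}" for t
  proof (rule S.velocity_unique[OF M_prob Z_law(1) X1_law(1) _ gauss_const_pos X1_law(2) indep a_pos v_cont[OF t]])
    show "distr M borel Z = density lborel (\<lambda>z. ennreal (gauss_const 1 CARD('n) * exp (- (norm z)\<^sup>2 / 2)))"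
      unfolding Z_law(2) gaussian_eq by simp
    fix q :: "real^'n \<Rightarrow> real" and u assume "q \<in> borel_measurable borel" "\<And>x. \<bar>q x\<bar> \<le> 1"
    from tower[OF t this, of u]
    show "integrable M (\<lambda>w. q (a t *\<^sub>R Z w + b t *\<^sub>R X1 w) * ((?Y' t w - v t (a t *\<^sub>R Z w + b t *\<^sub>R X1 w)) \<bullet> u)) \<and>
      (\<integral>w. q (a t *\<^sub>R Z w + b t *\<^sub>R X1 w) * ((?Y' t w - v t (a t *\<^sub>R Z w + b t *\<^sub>R X1 w)) \<bullet> u) \<partial>M) = 0"
      by (simp add: interpolant_def)
  qed (use t in auto)
  have sub: "{0..<1} \<subseteq> {0..1::real}" by auto
  have velc: "continuous_on ({0..<1} \<times> UNIV) (\<lambda>(t, x). ?vel t x)"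
    and Dvelc: "continuous_on ({0..<1} \<times> UNIV) (\<lambda>(t, x). ?Dvel t x h)" for h
    by (intro S.vel_path_continuous continuous_on_subset[OF a_cont sub] continuous_on_subset[OF b_cont sub]
          a'_cont continuous_on_subset[OF b'_cont sub] a_pos; assumption)+
  \<comment> \<open>Since a 0 > 0 the explicit formula is continuous up to time 0, so the one-sided
    limit defining \<open>v 0\<close> is its value there.\<close>
  have v_0: "v 0 x = ?vel 0 x" for x
  proof -
    have "continuous_on {0..<1} (\<lambda>t. ?vel t x)"
      by (rule continuous_on_compose2[OF velc, where f = "\<lambda>t. (t, x)", simplified]) (auto intro!: continuous_intros)
    then have "((\<lambda>t. ?vel t x) \<longlongrightarrow> ?vel 0 x) (at 0 within {0..<1})" by (simp add: continuous_on_def)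
    moreover have "at 0 within {0..<1} = at_right (0 :: real)"
      by (rule at_within_nhd[of 0 "{..<1}"]) auto
    ultimately have l: "((\<lambda>t. ?vel t x) \<longlongrightarrow> ?vel 0 x) (at_right 0)" by simp
    have "\<forall>\<^sub>F t in at_right 0. t \<in> {0<..<1::real}" by (rule eventually_at_right_real) simp
    then have "\<forall>\<^sub>F t in at_right 0. v t x = ?vel t x" by eventually_elim (simp add: v_int)
    with l have "((\<lambda>t. v t x) \<longlongrightarrow> ?vel 0 x) (at_right 0)" by (simp add: tendsto_cong)
    moreover have "((\<lambda>t. v t x) \<longlongrightarrow> v 0 x) (at_right 0)" using velocity unfolding is_velocity_field_def by blast
    ultimately show ?thesis using tendsto_unique[OF trivial_limit_at_right_real] by blast
  qed
  have v_eq: "v t = ?vel t" if "t \<in> {0..<1}" for t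
    using v_0 v_int[of t] that by (cases "t = 0") auto
  \<comment> \<open>In the form of \<open>vel_alt\<close> every ingredient has a limit: a' a tends
    to c 1, b to 1, and the posterior concentrates at x.\<close>
  have v_1: "v 1 x = c 1 *\<^sub>R G x + b' 1 *\<^sub>R x" for x
  proof -
    have ev: "\<forall>\<^sub>F t in at_left 1. t \<in> {0<..<1::real}" by (rule eventually_at_left_real) simp
    have lim: "(f \<longlongrightarrow> f 1) (at_left 1)" if "continuous_on {0..1} f" for f :: "real \<Rightarrow> real"
    proof -
      have "(f \<longlongrightarrow> f 1) (at 1 within {0..1})" using that by (simp add: continuous_on_def)
      moreover have "at 1 within {0..1} = at_left (1 :: real)"
        by (rule at_within_nhd[of 1 "{0<..}"]) auto
      ultimately show ?thesis by simp
    qed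
    have la: "(a \<longlongrightarrow> 0) (at_left 1)" and lb: "(b \<longlongrightarrow> 1) (at_left 1)" using lim[OF a_cont] lim[OF b_cont] a1 b1 by auto
    have pos: "\<forall>\<^sub>F t in at_left 1. 0 < a t" using ev by eventually_elim (simp add: a_pos)
    have "((\<lambda>t. (c t / b t) *\<^sub>R (\<integral>y. G y \<partial>S.post (a t) (b t) x) + b' t *\<^sub>R S.pmean (a t) (b t) x)
        \<longlongrightarrow> (c 1 / 1) *\<^sub>R G x + b' 1 *\<^sub>R x) (at_left 1)"
      by (intro tendsto_intros lim[OF c_cont] lim[OF b'_cont] lb S.post_G_limit[OF pos la lb] S.pmean_limit[OF pos la lb]) simp
    moreover have "\<forall>\<^sub>F t in at_left 1.
        (c t / b t) *\<^sub>R (\<integral>y. G y \<partial>S.post (a t) (b t) x) + b' t *\<^sub>R S.pmean (a t) (b t) x = v t x"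
      using ev by eventually_elim (simp add: v_int S.vel_alt a_pos b_pos c)
    ultimately have "((\<lambda>t. v t x) \<longlongrightarrow> (c 1 / 1) *\<^sub>R G x + b' 1 *\<^sub>R x) (at_left 1)" by (rule Lim_transform_eventually)
    moreover have "((\<lambda>t. v t x) \<longlongrightarrow> v 1 x) (at_left 1)" using velocity unfolding is_velocity_field_def by blast
    ultimately show ?thesis using tendsto_unique[OF trivial_limit_at_left_real] by fastforce
  qed
  have cbd: "\<exists>M\<ge>0. \<forall>t\<in>{0..1}. \<bar>f t\<bar> \<le> M" if "continuous_on {0..1} f" for f :: "real \<Rightarrow> real"
  proof -
    have "bounded (f ` {0..1})" by (intro compact_imp_bounded compact_continuous_image that) auto
    then obtain N where N: "\<forall>t\<in>{0..1}. \<bar>f t\<bar> \<le> N" unfolding bounded_iff by auto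
    then have "0 \<le> N" using order_trans[OF abs_ge_zero] by fastforce
    with N show ?thesis by blast
  qed
  obtain M1 where M1: "0 \<le> M1" "\<And>t. t \<in> {0..1} \<Longrightarrow> \<bar>c t\<bar> \<le> M1" using cbd[OF c_cont] by blast
  obtain M2 where M2: "0 \<le> M2" "\<And>t. t \<in> {0..1} \<Longrightarrow> \<bar>b' t * b t\<bar> \<le> M2"
    using cbd[OF continuous_on_mult[OF b'_cont b_cont]] by blast
  \<comment> \<open>The denominator of \<open>Dvel_bound\<close> never vanishes: b = 1 at time 1,
    and a > 0 before, which also covers b 0 = 0. Compactness gives a uniform positive lower
    bound.\<close>
  obtain c0 where c0: "0 < c0" "\<And>t. t \<in> {0..1} \<Longrightarrow> c0 \<le> \<kappa> * (a t)\<^sup>2 + (b t)\<^sup>2"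
  proof -
    have "continuous_on {0..1} (\<lambda>t. \<kappa> * (a t)\<^sup>2 + (b t)\<^sup>2)" by (intro continuous_intros a_cont b_cont)
    then obtain t0 where t0: "t0 \<in> {0..1}" "\<forall>t\<in>{0..1}. \<kappa> * (a t0)\<^sup>2 + (b t0)\<^sup>2 \<le> \<kappa> * (a t)\<^sup>2 + (b t)\<^sup>2"
      using continuous_attains_inf[of "{0..1::real}" "\<lambda>t. \<kappa> * (a t)\<^sup>2 + (b t)\<^sup>2"] by auto
    have "0 < \<kappa> * (a t0)\<^sup>2 + (b t0)\<^sup>2"
    proof (cases "t0 = 1")
      case True then show ?thesis by (simp add: a1 b1)
    next
      case False
      then have "0 < \<kappa> * (a t0)\<^sup>2" using a_pos[of t0] t0 S.\<kappa>0 by simp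
      then show ?thesis by (simp add: add_pos_nonneg)
    qed
    with t0(2) show thesis by (intro that) auto
  qed
  define K where "K = (M1 * B + M2) * (S.Cvar / c0)"
  have K0: "0 \<le> K" using M1 M2 S.B0 S.Cvar_nonneg c0 by (simp add: K_def)
  have Dvel_bound: "norm (?Dvel t x h) \<le> K * norm h" if t: "t \<in> {0..<1}" for t x h
  proof -
    have t': "t \<in> {0..1}" using t by auto
    have d: "0 < \<kappa> * (a t)\<^sup>2 + (b t)\<^sup>2" using c0(1) c0(2)[OF t'] by linarith
    then have q: "0 \<le> S.Cvar / (\<kappa> * (a t)\<^sup>2 + (b t)\<^sup>2)" by (intro divide_nonneg_pos S.Cvar_nonneg)
    have "norm (?Dvel t x h) \<le> (\<bar>a' t * a t\<bar> * B + \<bar>b' t * b t\<bar>) * (S.Cvar / (\<kappa> * (a t)\<^sup>2 + (b t)\<^sup>2)) * norm h"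
      by (rule S.Dvel_bound[OF a_pos[OF t]])
    also have "\<dots> \<le> (M1 * B + M2) * (S.Cvar / c0) * norm h"
    proof (intro mult_right_mono mult_mono add_mono divide_left_mono)
      show "\<bar>a' t * a t\<bar> \<le> M1" using M1(2)[OF t'] c[OF t] by simp
    qed (use M1 M2 t' c0 S.B0 S.Cvar_nonneg in \<open>auto intro!: mult_pos_pos d q\<close>)
    finally show ?thesis by (simp add: K_def)
  qed
  have v_deriv: "(v t has_derivative ?Dvel t x) (at x)" if "t \<in> {0..<1}" for t x
    unfolding v_eq[OF that] by (rule S.vel_deriv[OF a_pos[OF that]])
  interpret F: bounded_flow v ?Dvel K X
  proof
    show "continuous_on ({0..<1} \<times> UNIV) (\<lambda>(t, x). v t x)"
      by (rule continuous_on_eq[OF velc]) (use v_eq in auto)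
    show "X 0 x = x" for x using flow unfolding is_flow_def by blast
    show "((\<lambda>s. X s x) has_vector_derivative v t (X t x)) (at t within {0..1})" if "t \<in> {0..1}" for t x
      using flow that unfolding is_flow_def by blast
  qed (use K0 v_deriv Dvel_bound Dvelc in auto)
  \<comment> \<open>At time 1 the velocity is a combination of \<open>G\<close> and the identity, so
    its spatial derivative rests on the differentiability of \<open>G\<close> and is bounded through
    the Lipschitz constant \<open>B\<close>.\<close>
  obtain G' where G': "\<And>x. (G has_derivative G' x) (at x)" using Gdiff by metis
  have v1_deriv: "(v 1 has_derivative (\<lambda>h. c 1 *\<^sub>R G' x h + b' 1 *\<^sub>R h)) (at x)" for x
    unfolding v_1[abs_def] by (intro has_derivative_add has_derivative_scaleR_right G' has_derivative_ident)
  have v1_bound: "norm (c 1 *\<^sub>R G' x h + b' 1 *\<^sub>R h) \<le> (M1 * B + \<bar>b' 1\<bar>) * norm h" for x h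
  proof -
    have "norm (G' x h) \<le> B * norm h"
      by (rule has_derivative_norm_le[OF G' always_eventually]) (use S.G_lip in blast)
    then have "\<bar>c 1\<bar> * norm (G' x h) \<le> M1 * (B * norm h)" using M1 by (intro mult_mono) auto
    then show ?thesis
      using norm_triangle_ineq[of "c 1 *\<^sub>R G' x h" "b' 1 *\<^sub>R h"] by (simp add: algebra_simps)
  qed
  define Dv where "Dv = (\<lambda>t x h. if t < 1 then ?Dvel t x h else c 1 *\<^sub>R G' x h + b' 1 *\<^sub>R h)"
  define K' where "K' = max K (M1 * B + \<bar>b' 1\<bar>)"
  have Dv: "(v t has_derivative Dv t x) (at x)" if "t \<in> {0..1}" for t x
    using v_deriv[of t x] v1_deriv[of x] that by (cases "t = 1") (auto simp: Dv_def)
  have Dvb: "onorm (Dv t x) \<le> K'" if "t \<in> {0..1}" for t x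
  proof (rule onorm_bound)
    show "0 \<le> K'" using K0 by (simp add: K'_def)
    show "norm (Dv t x h) \<le> K' * norm h" for h
      using Dvel_bound[of t x h] v1_bound[of x h] that mult_right_mono[of K K' "norm h"]
        mult_right_mono[of "M1 * B + \<bar>b' 1\<bar>" K' "norm h"]
      by (cases "t < 1") (auto simp: Dv_def K'_def)
  qed
  have v_diff: "\<forall>t\<in>{0..1}. \<forall>x. v t differentiable (at x)" using Dv unfolding differentiable_def by blast
  have v_bdd: "bdd_above ((\<lambda>(t, x). spectral_norm (jacobian (v t) (at x))) ` ({0..1} \<times> UNIV))"
    by (rule bdd_aboveI[of _ K']) (auto simp: spectral_norm_jacobian[OF Dv] Dvb)
  define X' where "X' = (\<lambda>x. frechet_derivative (X 1) (at x))"
  have X': "(X 1 has_derivative X' x) (at x)" for x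
    unfolding X'_def frechet_derivative_works[symmetric] differentiable_def by (rule F.X_differentiable) simp
  have X_diff: "\<forall>x. X 1 differentiable (at x)" using X' unfolding differentiable_def by blast
  have X'b: "norm (X' x h) \<le> F.E * norm h" for x h
    by (rule has_derivative_norm_le[OF X' always_eventually]) (use F.X_upper[of 1] in auto)
  have X_bdd: "bdd_above (range (\<lambda>x. spectral_norm (jacobian (X 1) (at x))))"
    by (rule bdd_aboveI[of _ F.E])
       (use F.E_pos X'b in \<open>auto simp: spectral_norm_jacobian[OF X'] intro!: onorm_bound\<close>)
  have onorm_C1: "onorm (X' x) \<le> C1" for x
    unfolding C1_def spectral_norm_jacobian[OF X', symmetric] by (rule cSUP_upper[OF UNIV_I X_bdd])
  have C1_0: "0 \<le> C1"
    using onorm_pos_le[OF has_derivative_bounded_linear[OF X'[of 0]]] onorm_C1[of 0] by linarith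
  have C2_0: "0 \<le> C2"
  proof -
    have "spectral_norm (jacobian (v 0) (at 0)) \<le> C2"
      unfolding C2_def using cSUP_upper[OF _ v_bdd, of "(0, 0)"] by simp
    moreover have "0 \<le> spectral_norm (jacobian (v 0) (at 0))"
      unfolding spectral_norm_jacobian[OF Dv[of 0 0], simplified]
      using onorm_pos_le[OF has_derivative_bounded_linear[OF Dv[of 0 0]]] by simp
    ultimately show ?thesis by linarith
  qed
  have X_lip: "norm (X 1 x - X 1 y) \<le> C1 * norm (x - y)" for x y
    by (rule differentiable_bound[where S = UNIV and f' = X']) (use X' onorm_C1 in auto)
  let ?I = "interpolant a b Z X1"
  define R where "R = (\<lambda>w. norm (Z w) + norm (X1 w))"
  have transport: "distr M borel (\<lambda>w. X 1 (?I 0 w)) = distr M borel (?I 1)"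
  proof (rule F.flow_transports_law[where Y = ?I and Y' = ?Y' and R = R, OF M_prob Im])
    have at: "at t within {0..1} = at t" if "t \<in> {0<..<1}" for t :: real
      using at_within_interior[of t "{0..1}"] that by simp
    show "((\<lambda>r. ?I r w) has_vector_derivative ?Y' t w) (at t)" if "t \<in> {0<..<1}" for t w
      unfolding interpolant_def using a'[of t] b'[of t] that at[OF that]
      by (auto intro!: derivative_eq_intros)
    show "integrable M R" unfolding R_def using Zi X1i by simp
    show "0 \<le> R w" for w by (simp add: R_def)
    show "((\<lambda>t. ?I t w) \<longlongrightarrow> ?I 1 w) (at 1 within {0..1})" for w
      unfolding interpolant_def using a_cont b_cont by (intro tendsto_intros) (auto simp: continuous_on_def)
    show "integrable M (\<lambda>w. q (?I s w) * ((?Y' s w - v s (?I s w)) \<bullet> u)) \<and>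
      (\<integral>w. q (?I s w) * ((?Y' s w - v s (?I s w)) \<bullet> u) \<partial>M) = 0"
      if "s \<in> {0<..<1}" "q \<in> borel_measurable borel" "\<And>x. \<bar>q x\<bar> \<le> C" for s q u C
      by (rule tower[OF that])
    fix T :: real assume T: "0 \<le> T" "T < 1"
    have sub2: "{0..T} \<subseteq> {0..1}" "{0..T} \<subseteq> {0..<1}" using T by auto
    \<comment> \<open>The derivative of \<open>a\<close> may be unbounded near time 1, so its bound,
      and with it the Lipschitz constant of the interpolant, depends on T.\<close>
    have "bounded (a' ` {0..T})"
      by (intro compact_imp_bounded compact_continuous_image continuous_on_subset[OF a'_cont sub2(2)]) auto
    then obtain A1 where A1: "\<And>t. t \<in> {0..T} \<Longrightarrow> \<bar>a' t\<bar> \<le> A1" unfolding bounded_iff real_norm_def by (metis imageI)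
    obtain A2 where A2: "0 \<le> A2" "\<forall>t\<in>{0..1}. \<bar>b' t\<bar> \<le> A2" using cbd[OF b'_cont] by blast
    obtain A3 where A3: "0 \<le> A3" "\<forall>t\<in>{0..1}. \<bar>a t\<bar> \<le> A3" using cbd[OF a_cont] by blast
    obtain A4 where A4: "0 \<le> A4" "\<forall>t\<in>{0..1}. \<bar>b t\<bar> \<le> A4" using cbd[OF b_cont] by blast
    have A10: "0 \<le> A1" using A1[of 0] T by (auto intro: order_trans[OF abs_ge_zero])
    have da: "(a has_real_derivative a' z) (at z within {0..T})"
      and db: "(b has_real_derivative b' z) (at z within {0..T})" if "z \<in> {0..T}" for z
      using that sub2 by (auto intro: DERIV_subset[OF a' sub2(1)] DERIV_subset[OF b' sub2(1)])
    define C where "C = A1 + A2 + A3 + A4"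
    have lip: "\<bar>a r - a s\<bar> \<le> C * \<bar>r - s\<bar>" "\<bar>b r - b s\<bar> \<le> C * \<bar>r - s\<bar>" if rs: "r \<in> {0..T}" "s \<in> {0..T}" for r s
    proof -
      have "norm (a r - a s) \<le> A1 * norm (r - s)"
        by (rule field_differentiable_bound[where S = "{0..T}" and f' = a'])
           (use A1 rs da in auto)
      moreover have "norm (b r - b s) \<le> A2 * norm (r - s)"
        by (rule field_differentiable_bound[where S = "{0..T}" and f' = b'])
           (use A2 rs db T in auto)
      moreover have "A1 * \<bar>r - s\<bar> \<le> C * \<bar>r - s\<bar>" "A2 * \<bar>r - s\<bar> \<le> C * \<bar>r - s\<bar>"
        using A10 A2 A3 A4 by (auto simp: C_def intro!: mult_right_mono)
      ultimately show "\<bar>a r - a s\<bar> \<le> C * \<bar>r - s\<bar>" "\<bar>b r - b s\<bar> \<le> C * \<bar>r - s\<bar>" by auto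
    qed
    have le: "norm (p *\<^sub>R Z w + q *\<^sub>R X1 w) \<le> D * R w" if "\<bar>p\<bar> \<le> D" "\<bar>q\<bar> \<le> D" for p q D w
    proof -
      have "norm (p *\<^sub>R Z w + q *\<^sub>R X1 w) \<le> \<bar>p\<bar> * norm (Z w) + \<bar>q\<bar> * norm (X1 w)"
        by (rule order_trans[OF norm_triangle_ineq]) simp
      also have "\<dots> \<le> D * norm (Z w) + D * norm (X1 w)" using that by (intro add_mono mult_right_mono) auto
      finally show ?thesis by (simp add: R_def algebra_simps)
    qed
    show "\<exists>C\<ge>0. \<forall>w. \<forall>r\<in>{0..T}. \<forall>s\<in>{0..T}.
      norm (?I r w - ?I s w) \<le> C * R w * \<bar>r - s\<bar> \<and> norm (?I s w) \<le> C * R w"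
    proof (intro exI[of _ C] conjI allI ballI)
      show "0 \<le> C" using A10 A2 A3 A4 by (simp add: C_def)
      fix w r s assume rs: "r \<in> {0..T}" "s \<in> {0..T}"
      have "?I r w - ?I s w = (a r - a s) *\<^sub>R Z w + (b r - b s) *\<^sub>R X1 w"
        by (simp add: interpolant_def scaleR_diff_left)
      then show "norm (?I r w - ?I s w) \<le> C * R w * \<bar>r - s\<bar>"
        using le[OF lip[OF rs], of w] by (simp add: ac_simps)
      have "\<bar>a s\<bar> \<le> A3" "\<bar>b s\<bar> \<le> A4" using A3 A4 rs sub2 by auto
      then show "norm (?I s w) \<le> C * R w"
        unfolding interpolant_def using A10 A2 A3 A4 by (intro le) (auto simp: C_def)
    qed
  qed
  have X_meas [measurable]: "X 1 \<in> borel_measurable borel"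
    by (rule borel_measurable_continuous_onI[OF F.X_continuous]) simp
  define m2 where "m2 = (\<integral>x. (norm x)\<^sup>2 \<partial>\<nu>)"
  have m2_0: "0 \<le> m2" unfolding m2_def by (rule Bochner_Integration.integral_nonneg) auto
  define \<pi> where "\<pi> = distr M borel (\<lambda>w. (X 1 (a 0 *\<^sub>R Z w), X 1 (a 0 *\<^sub>R Z w + b 0 *\<^sub>R X1 w)))"
  have pm: "(\<lambda>w. (X 1 (a 0 *\<^sub>R Z w), X 1 (a 0 *\<^sub>R Z w + b 0 *\<^sub>R X1 w))) \<in> borel_measurable M"
    by measurable
  have fm: "(fst :: (real^'n) \<times> (real^'n) \<Rightarrow> _) \<in> borel_measurable borel"
    "(snd :: (real^'n) \<times> (real^'n) \<Rightarrow> _) \<in> borel_measurable borel"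
    by (auto intro!: borel_measurable_continuous_onI continuous_intros)
  have coupling: "\<pi> \<in> couplings (distr (gaussian (a 0)) borel (X 1)) \<nu>"
    unfolding couplings_def
  proof (intro CollectI conjI)
    show "sets \<pi> = sets borel" by (simp add: \<pi>_def)
    have a0: "a 0 > 0" by (rule a_pos) simp
    have "distr M borel (\<lambda>w. a 0 *\<^sub>R Z w) = gaussian (a 0)"
      unfolding gaussian_scale[OF a0, symmetric] Z_law(2)[symmetric] by (subst distr_distr) (auto simp: o_def)
    then have "distr (gaussian (a 0)) borel (X 1) = distr M borel (\<lambda>w. X 1 (a 0 *\<^sub>R Z w))"
      by (simp add: distr_distr o_def flip: \<open>distr M borel (\<lambda>w. a 0 *\<^sub>R Z w) = gaussian (a 0)\<close>)
    then show "distr \<pi> borel fst = distr (gaussian (a 0)) borel (X 1)"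
      unfolding \<pi>_def using pm fm by (subst distr_distr) (auto simp: o_def)
    have "distr \<pi> borel snd = distr M borel (\<lambda>w. X 1 (?I 0 w))"
      unfolding \<pi>_def using pm fm by (subst distr_distr) (auto simp: o_def interpolant_def)
    also have "\<dots> = distr M borel (?I 1)" by (rule transport)
    also have "?I 1 = X1" by (simp add: interpolant_def a1 b1)
    finally show "distr \<pi> borel snd = \<nu>" by (simp add: X1_law(2))
  qed
  have cost: "(\<integral>\<^sup>+ p. ennreal ((dist (fst p) (snd p))\<^sup>2) \<partial>\<pi>) \<le> ennreal (C1\<^sup>2 * (b 0)\<^sup>2 * m2)"
  proof -
    have "(\<integral>\<^sup>+ p. ennreal ((dist (fst p) (snd p))\<^sup>2) \<partial>\<pi>)
        = (\<integral>\<^sup>+ w. ennreal ((dist (X 1 (a 0 *\<^sub>R Z w)) (X 1 (a 0 *\<^sub>R Z w + b 0 *\<^sub>R X1 w)))\<^sup>2) \<partial>M)"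
      unfolding \<pi>_def using pm
      by (subst nn_integral_distr) (auto intro!: borel_measurable_continuous_onI continuous_intros)
    also have "\<dots> \<le> (\<integral>\<^sup>+ w. ennreal (C1\<^sup>2 * (b 0)\<^sup>2 * (norm (X1 w))\<^sup>2) \<partial>M)"
    proof (intro nn_integral_mono ennreal_leI)
      fix w
      have "dist (X 1 (a 0 *\<^sub>R Z w)) (X 1 (a 0 *\<^sub>R Z w + b 0 *\<^sub>R X1 w)) \<le> C1 * (b 0 * norm (X1 w))"
        using X_lip[of "a 0 *\<^sub>R Z w" "a 0 *\<^sub>R Z w + b 0 *\<^sub>R X1 w"] b0 by (simp add: dist_norm)
      then have "(dist (X 1 (a 0 *\<^sub>R Z w)) (X 1 (a 0 *\<^sub>R Z w + b 0 *\<^sub>R X1 w)))\<^sup>2 \<le> (C1 * (b 0 * norm (X1 w)))\<^sup>2"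
        by (intro power_mono) auto
      then show "(dist (X 1 (a 0 *\<^sub>R Z w)) (X 1 (a 0 *\<^sub>R Z w + b 0 *\<^sub>R X1 w)))\<^sup>2 \<le> C1\<^sup>2 * (b 0)\<^sup>2 * (norm (X1 w))\<^sup>2"
        by (simp add: power_mult_distrib ac_simps)
    qed
    also have "\<dots> = (\<integral>\<^sup>+ x. ennreal (C1\<^sup>2 * (b 0)\<^sup>2 * (norm x)\<^sup>2) \<partial>\<nu>)"
      unfolding X1_law(2)[symmetric] by (subst nn_integral_distr) auto
    also have "\<dots> = ennreal (\<integral>x. C1\<^sup>2 * (b 0)\<^sup>2 * (norm x)\<^sup>2 \<partial>\<nu>)"
      using nu_moment by (intro nn_integral_eq_integral) auto
    finally show ?thesis by (simp add: m2_def)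
  qed
  have "W2 (distr (gaussian (a 0)) borel (X 1)) \<nu> \<le> ennreal (sqrt (C1\<^sup>2 * (b 0)\<^sup>2 * m2))"
    by (rule W2_le[OF coupling cost]) (use m2_0 in simp)
  also have "sqrt (C1\<^sup>2 * (b 0)\<^sup>2 * m2) = C1 * b 0 * sqrt m2"
    using C1_0 b0 by (simp add: real_sqrt_mult)
  also have "ennreal (C1 * b 0 * sqrt m2) \<le> ennreal (C1 * b 0 * sqrt m2 * exp (C2 * real CARD('n)))"
  proof (rule ennreal_leI)
    have "C1 * b 0 * sqrt m2 * 1 \<le> C1 * b 0 * sqrt m2 * exp (C2 * real CARD('n))"
      using C1_0 b0 m2_0 C2_0 by (intro mult_left_mono) auto
    then show "C1 * b 0 * sqrt m2 \<le> C1 * b 0 * sqrt m2 * exp (C2 * real CARD('n))" by simp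
  qed
  finally show ?thesis using X_diff X_bdd v_diff v_bdd unfolding m2_def by blast
qed

end
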